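(* Let $\mathrm{T}_d:\mathbf{ED}\to\mathbf{ED}$ be the 2-monad of the comprehensive diagonal completion on the 2-category $\mathbf{ED}$ of elementary doctrines. The 2-category $\mathrm{T}_d\text{-}\mathbf{Alg}$ of $\mathrm{T}_d$-algebras is 2-equivalent to the 2-category $\mathbf{CED}$ of elementary doctrines with comprehensive diagonals.
   Context: $\mathbf{InfSL}$ is the category of posets with finite meets and functions preserving finite meets. Let $\mathcal C$ be a category with binary products. An elementary doctrine on $\mathcal C$ is a functor $P:\mathcal C^{\mathrm{op}}\to\mathbf{InfSL}$ (write $P_f=P(f)$) such that for every object $A$ there is $\delta_A\in P(A\times A)$ with: (1) $\alpha\mapsto P_{\mathrm{pr}_1}(\alpha)\wedge\delta_A$ is left adjoint to $P_{\langle \mathrm{id}_A,\mathrm{id}_A\rangle}:P(A\times A)\to P(A)$; (2) for every $e=\langle \mathrm{pr}_1,\mathrm{pr}_2,\mathrm{pr}_2\rangle:X\times A\to X\times A\times A$, the assignment $\alpha\mapsto P_{\langle \mathrm{pr}_1,\mathrm{pr}_2\rangle}(\alpha)\wedge P_{\langle \mathrm{pr}_2,\mathrm{pr}_3\rangle}(\delta_A)$ is left adjoint to $P_e:P(X\times A\times A)\to P(X\times A)$. The 2-category $\mathbf{ED}$: 0-cells are elementary doctrines; a 1-cell $(F,b):P\to R$ (with $P$ on $\mathcal C$, $R$ on $\mathcal D$) is a product-preserving functor $F:\mathcal C\to\mathcal D$ with a natural transformation $b:P\Rightarrow R\circ F^{\mathrm{op}}$ such that each $b_A$ preserves finite meets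 and $b_{A\times A}(\delta_A)=R_{\langle F\mathrm{pr}_1,F\mathrm{pr}_2\rangle}(\delta_{FA})$; a 2-cell $(F,b)\Rightarrow(G,c)$ is a natural transformation $\theta:F\Rightarrow G$ with $b_A(\alpha)\le R_{\theta_A}(c_A(\alpha))$ for all $A$ and $\alpha\in P(A)$. A comprehension of $\alpha\in P(A)$ is an arrow $m:X\to A$ with $P_m(\alpha)=\top_X$ such that every $f:Z\to A$ with $P_f(\alpha)=\top_Z$ factors uniquely through $m$. $P$ has comprehensive diagonals if every diagonal $\langle\mathrm{id}_A,\mathrm{id}_A\rangle:A\to A\times A$ is a comprehension of $\delta_A$. $\mathbf{CED}$ is the 2-category of elementary doctrines with comprehensive diagonals, with the same 1-cells and 2-cells as $\mathbf{ED}$. The 2-monad $\mathrm T_d$: for $P$ on $\mathcal C$, the extensional collapse $\mathcal X_P$ has the objects of $\mathcal C$; a morphism $[f]:A\to B$ is an equivalence class of arrows $f:A\to B$ of $\mathcal C$ with $\delta_A\le P_{f\times f}(\delta_B)$, where $f\sim f'$ when $\delta_A\le P_{f\times f'}(\delta_B)$. $\mathrm T_d(P)=P_x:\mathcal X_P^{\mathrm{op}}\to\mathbf{InfSL}$ is given by $P_x(A)=P(A)$, $P_x([f])=P_f$ (well defined); it is an elementary doctrine with comprehensive diagonals. On a 1-cell, $\mathrm T_d(F,b)=(\widetilde F,b)$ with $\widetilde F(A)=F(A)$, $\widetilde F([f])=[F(f)]$; on a 2-cell, $\widetilde\theta_A=[\theta_A]$. The unit $\eta_P:P\to P_x$ is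 the quotient functor $f\mapsto[f]$ with identity on elements. The multiplication $\mu_P:(P_x)_x\to P_x$ is identity on objects, sends $[[f]]$ to $[f]$, and is the identity on elements. For a 2-monad $(\mathrm T,\mu,\eta)$, the 2-category $\mathrm T\text{-}\mathbf{Alg}$: objects are strict $\mathrm T$-algebras $(A,a:\mathrm TA\to A)$ with $a\circ\mathrm Ta=a\circ\mu_A$, $a\circ\eta_A=1_A$; 1-cells $(A,a)\to(B,b)$ are $\mathrm T$-morphisms $(f,\bar f)$, i.e. a 1-cell $f:A\to B$ with an invertible 2-cell $\bar f:b\circ\mathrm Tf\Rightarrow f\circ a$ such that $\bar f\mu_A=(\bar f\,\mathrm Ta)\cdot(b\,\mathrm T\bar f)$ and $\bar f\eta_A=\mathrm{id}_f$; 2-cells $(f,\bar f)\Rightarrow(g,\bar g)$ are 2-cells $\alpha:f\Rightarrow g$ with $(\alpha a)\cdot\bar f=\bar g\cdot(b\,\mathrm T\alpha)$. *)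

theory Defs
  imports "HOL-Algebra.Lattice"
begin

section \<open>Categories, functors, binary products\<close>

record ('o, 'm) cat =
  Ob :: "'o set"
  Ar :: "'m set"
  Dom :: "'m \<Rightarrow> 'o"
  Cod :: "'m \<Rightarrow> 'o"
  Idn :: "'o \<Rightarrow> 'm"
  Comp :: "'m \<Rightarrow> 'm \<Rightarrow> 'm"  (infixr \<open>\<cdot>\<index>\<close> 75)

definition Hom :: "('o, 'm, 'x) cat_scheme \<Rightarrow> 'o \<Rightarrow> 'o \<Rightarrow> 'm set" where
  "Hom C A B = {f \<in> Ar C. Dom C f = A \<and> Cod C f = B}"

locale category =
  fixes C :: "('o, 'm, 'x) cat_scheme"  (structure)
  assumes dom_ob: "f \<in> Ar C \<Longrightarrow> Dom C f \<in> Ob C"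
    and cod_ob: "f \<in> Ar C \<Longrightarrow> Cod C f \<in> Ob C"
    and idn_hom: "A \<in> Ob C \<Longrightarrow> Idn C A \<in> Hom C A A"
    and comp_hom: "\<lbrakk>f \<in> Ar C; g \<in> Ar C; Dom C g = Cod C f\<rbrakk> \<Longrightarrow> g \<cdot> f \<in> Hom C (Dom C f) (Cod C g)"
    and comp_idn: "f \<in> Ar C \<Longrightarrow> f \<cdot> Idn C (Dom C f) = f"
    and idn_comp: "f \<in> Ar C \<Longrightarrow> Idn C (Cod C f) \<cdot> f = f"
    and comp_assoc: "\<lbrakk>f \<in> Ar C; g \<in> Ar C; h \<in> Ar C; Dom C g = Cod C f; Dom C h = Cod C g\<rbrakk>
      \<Longrightarrow> (h \<cdot> g) \<cdot> f = h \<cdot> (g \<cdot> f)"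

definition is_iso :: "('o, 'm, 'x) cat_scheme \<Rightarrow> 'm \<Rightarrow> bool" where
  "is_iso C f \<longleftrightarrow> f \<in> Ar C \<and> (\<exists>g \<in> Hom C (Cod C f) (Dom C f).
     g \<cdot>\<^bsub>C\<^esub> f = Idn C (Dom C f) \<and> f \<cdot>\<^bsub>C\<^esub> g = Idn C (Cod C f))"

definition is_functor ::
  "('o, 'm, 'x) cat_scheme \<Rightarrow> ('q, 'n, 'y) cat_scheme \<Rightarrow> ('o \<Rightarrow> 'q) \<Rightarrow> ('m \<Rightarrow> 'n) \<Rightarrow> bool" where
  "is_functor C D Fo Fa \<longleftrightarrow>
     (\<forall>A \<in> Ob C. Fo A \<in> Ob D) \<and>
     (\<forall>f \<in> Ar C. Fa f \<in> Hom D (Fo (Dom C f)) (Fo (Cod C f))) \<and>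
     (\<forall>A \<in> Ob C. Fa (Idn C A) = Idn D (Fo A)) \<and>
     (\<forall>f \<in> Ar C. \<forall>g \<in> Ar C. Dom C g = Cod C f \<longrightarrow> Fa (g \<cdot>\<^bsub>C\<^esub> f) = Fa g \<cdot>\<^bsub>D\<^esub> Fa f)"

definition is_product ::
  "('o, 'm, 'x) cat_scheme \<Rightarrow> 'o \<Rightarrow> 'o \<Rightarrow> 'o \<Rightarrow> 'm \<Rightarrow> 'm \<Rightarrow> bool" where
  "is_product C A B W p q \<longleftrightarrow> W \<in> Ob C \<and> p \<in> Hom C W A \<and> q \<in> Hom C W B \<and>
     (\<forall>f \<in> Ar C. \<forall>g \<in> Ar C. Dom C f = Dom C g \<and> Cod C f = A \<and> Cod C g = B \<longrightarrow>
        (\<exists>!h. h \<in> Hom C (Dom C f) W \<and> p \<cdot>\<^bsub>C\<^esub> h = f \<and> q \<cdot>\<^bsub>C\<^esub> h = g))"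

text \<open>The binary products are a chosen part of the structure, so that \<open>A \<times> A\<close>,
  \<open>pr\<^sub>1\<close>, \<open>\<langle>f, g\<rangle>\<close> denote; functors are required to preserve them
  only in the usual non-strict sense.\<close>

record ('o, 'm) prod_cat = "('o, 'm) cat" +
  Prd :: "'o \<Rightarrow> 'o \<Rightarrow> 'o"
  Pr1 :: "'o \<Rightarrow> 'o \<Rightarrow> 'm"
  Pr2 :: "'o \<Rightarrow> 'o \<Rightarrow> 'm"

locale category_with_products = category C
  for C :: "('o, 'm, 'x) prod_cat_scheme"  (structure) +
  assumes products: "\<lbrakk>A \<in> Ob C; B \<in> Ob C\<rbrakk> \<Longrightarrow> is_product C A B (Prd C A B) (Pr1 C A B) (Pr2 C A B)"

definition pair :: "('o, 'm, 'x) prod_cat_scheme \<Rightarrow> 'm \<Rightarrow> 'm \<Rightarrow> 'm" where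
  "pair C f g = (THE h. h \<in> Hom C (Dom C f) (Prd C (Cod C f) (Cod C g)) \<and>
     Pr1 C (Cod C f) (Cod C g) \<cdot>\<^bsub>C\<^esub> h = f \<and> Pr2 C (Cod C f) (Cod C g) \<cdot>\<^bsub>C\<^esub> h = g)"

definition cross :: "('o, 'm, 'x) prod_cat_scheme \<Rightarrow> 'm \<Rightarrow> 'm \<Rightarrow> 'm" where
  "cross C f g = pair C (f \<cdot>\<^bsub>C\<^esub> Pr1 C (Dom C f) (Dom C g)) (g \<cdot>\<^bsub>C\<^esub> Pr2 C (Dom C f) (Dom C g))"

definition diag :: "('o, 'm, 'x) prod_cat_scheme \<Rightarrow> 'o \<Rightarrow> 'm" where
  "diag C A = pair C (Idn C A) (Idn C A)"

definition preserves_products ::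
  "('o, 'm, 'x) prod_cat_scheme \<Rightarrow> ('q, 'n, 'y) prod_cat_scheme \<Rightarrow> ('o \<Rightarrow> 'q) \<Rightarrow> ('m \<Rightarrow> 'n) \<Rightarrow> bool" where
  "preserves_products C D Fo Fa \<longleftrightarrow> (\<forall>A \<in> Ob C. \<forall>B \<in> Ob C.
     is_product D (Fo A) (Fo B) (Fo (Prd C A B)) (Fa (Pr1 C A B)) (Fa (Pr2 C A B)))"


section \<open>Elementary doctrines\<close>

text \<open>The empty meet is the top element.\<close>

definition inf_semilattice :: "('p, 'x) gorder_scheme \<Rightarrow> bool" where
  "inf_semilattice L \<longleftrightarrow> partial_order L \<and>
     (\<forall>S. finite S \<and> S \<subseteq> carrier L \<longrightarrow> (\<exists>i. is_glb L i S))"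

definition inf_hom :: "('p, 'x) gorder_scheme \<Rightarrow> ('q, 'y) gorder_scheme \<Rightarrow> ('p \<Rightarrow> 'q) \<Rightarrow> bool" where
  "inf_hom L M h \<longleftrightarrow> h \<in> carrier L \<rightarrow> carrier M \<and>
     (\<forall>S. finite S \<and> S \<subseteq> carrier L \<longrightarrow> h (\<Sqinter>\<^bsub>L\<^esub> S) = \<Sqinter>\<^bsub>M\<^esub> (h ` S))"

text \<open>\<open>Fib P A\<close> is \<open>P(A)\<close> and \<open>Sub P f\<close> is \<open>P\<^sub>f\<close>.\<close>

record ('o, 'm, 'p) doctrine = "('o, 'm) prod_cat" +
  Fib :: "'o \<Rightarrow> 'p gorder"
  Sub :: "'m \<Rightarrow> 'p \<Rightarrow> 'p"

locale doctrine = category_with_products P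
  for P :: "('o, 'm, 'p, 'x) doctrine_scheme"  (structure) +
  assumes fib: "A \<in> Ob P \<Longrightarrow> inf_semilattice (Fib P A)"
    and sub_hom: "f \<in> Ar P \<Longrightarrow> inf_hom (Fib P (Cod P f)) (Fib P (Dom P f)) (Sub P f)"
    and sub_idn: "\<lbrakk>A \<in> Ob P; \<alpha> \<in> carrier (Fib P A)\<rbrakk> \<Longrightarrow> Sub P (Idn P A) \<alpha> = \<alpha>"
    and sub_comp: "\<lbrakk>f \<in> Ar P; g \<in> Ar P; Dom P g = Cod P f; \<alpha> \<in> carrier (Fib P (Cod P g))\<rbrakk>
      \<Longrightarrow> Sub P (g \<cdot> f) \<alpha> = Sub P f (Sub P g \<alpha>)"

text \<open>\<open>X \<times> A \<times> A\<close> is \<open>(X \<times> A) \<times> A\<close>, with the projections \<open>tpr1\<close>, \<open>tpr2\<close>, \<open>tpr3\<close>.\<close>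

definition tpr1 :: "('o, 'm, 'x) prod_cat_scheme \<Rightarrow> 'o \<Rightarrow> 'o \<Rightarrow> 'm" where
  "tpr1 C X A = Pr1 C X A \<cdot>\<^bsub>C\<^esub> Pr1 C (Prd C X A) A"

definition tpr2 :: "('o, 'm, 'x) prod_cat_scheme \<Rightarrow> 'o \<Rightarrow> 'o \<Rightarrow> 'm" where
  "tpr2 C X A = Pr2 C X A \<cdot>\<^bsub>C\<^esub> Pr1 C (Prd C X A) A"

definition tpr3 :: "('o, 'm, 'x) prod_cat_scheme \<Rightarrow> 'o \<Rightarrow> 'o \<Rightarrow> 'm" where
  "tpr3 C X A = Pr2 C (Prd C X A) A"

definition is_delta :: "('o, 'm, 'p, 'x) doctrine_scheme \<Rightarrow> 'o \<Rightarrow> 'p \<Rightarrow> bool" where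
  "is_delta P A d \<longleftrightarrow>
     d \<in> carrier (Fib P (Prd P A A)) \<and>
     (\<forall>\<alpha> \<in> carrier (Fib P A). \<forall>\<beta> \<in> carrier (Fib P (Prd P A A)).
        Sub P (Pr1 P A A) \<alpha> \<sqinter>\<^bsub>Fib P (Prd P A A)\<^esub> d \<sqsubseteq>\<^bsub>Fib P (Prd P A A)\<^esub> \<beta> \<longleftrightarrow>
        \<alpha> \<sqsubseteq>\<^bsub>Fib P A\<^esub> Sub P (diag P A) \<beta>) \<and>
     (\<forall>X \<in> Ob P. let XA = Prd P X A; XAA = Prd P XA A;
          e = pair P (pair P (Pr1 P X A) (Pr2 P X A)) (Pr2 P X A) in
        \<forall>\<alpha> \<in> carrier (Fib P XA). \<forall>\<beta> \<in> carrier (Fib P XAA).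
          Sub P (pair P (tpr1 P X A) (tpr2 P X A)) \<alpha>
            \<sqinter>\<^bsub>Fib P XAA\<^esub> Sub P (pair P (tpr2 P X A) (tpr3 P X A)) d \<sqsubseteq>\<^bsub>Fib P XAA\<^esub> \<beta> \<longleftrightarrow>
          \<alpha> \<sqsubseteq>\<^bsub>Fib P XA\<^esub> Sub P e \<beta>)"

locale elementary_doctrine = doctrine +
  assumes delta_exists: "A \<in> Ob P \<Longrightarrow> \<exists>d. is_delta P A d"

text \<open>In an elementary doctrine \<open>\<delta>\<^sub>A\<close> is unique, being the value at the top element of a left
  adjoint between posets.\<close>

definition delta :: "('o, 'm, 'p, 'x) doctrine_scheme \<Rightarrow> 'o \<Rightarrow> 'p" where
  "delta P A = (THE d. is_delta P A d)"

definition is_comprehension :: "('o, 'm, 'p, 'x) doctrine_scheme \<Rightarrow> 'o \<Rightarrow> 'p \<Rightarrow> 'm \<Rightarrow> bool" where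
  "is_comprehension P A \<alpha> m \<longleftrightarrow>
     m \<in> Ar P \<and> Cod P m = A \<and> \<alpha> \<in> carrier (Fib P A) \<and>
     Sub P m \<alpha> = \<top>\<^bsub>Fib P (Dom P m)\<^esub> \<and>
     (\<forall>f \<in> Ar P. Cod P f = A \<and> Sub P f \<alpha> = \<top>\<^bsub>Fib P (Dom P f)\<^esub> \<longrightarrow>
        (\<exists>!h. h \<in> Hom P (Dom P f) (Dom P m) \<and> m \<cdot>\<^bsub>P\<^esub> h = f))"

definition comprehensive_diagonals :: "('o, 'm, 'p, 'x) doctrine_scheme \<Rightarrow> bool" where
  "comprehensive_diagonals P \<longleftrightarrow>
     (\<forall>A \<in> Ob P. is_comprehension P (Prd P A A) (delta P A) (diag P A))"


section \<open>Strict 2-categories, 2-functors, 2-equivalence, 2-monads, algebras\<close>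

record ('a, 'b, 'c) two_cat =
  Cell0 :: "'a set"
  Cell1 :: "'b set"
  Cell2 :: "'c set"
  Src1 :: "'b \<Rightarrow> 'a"
  Tgt1 :: "'b \<Rightarrow> 'a"
  Src2 :: "'c \<Rightarrow> 'b"
  Tgt2 :: "'c \<Rightarrow> 'b"
  Id1 :: "'a \<Rightarrow> 'b"
  Id2 :: "'b \<Rightarrow> 'c"
  Comp1 :: "'b \<Rightarrow> 'b \<Rightarrow> 'b"  (infixr \<open>\<odot>\<index>\<close> 75)
  VComp :: "'c \<Rightarrow> 'c \<Rightarrow> 'c"  (infixr \<open>\<bullet>\<index>\<close> 70)
  HComp :: "'c \<Rightarrow> 'c \<Rightarrow> 'c"  (infixr \<open>\<star>\<index>\<close> 75)

text \<open>The three categories underlying a 2-category: 0-cells and 1-cells; 1-cells and 2-cells under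
  vertical composition; 0-cells and 2-cells under horizontal composition.\<close>

definition cat01 :: "('a, 'b, 'c) two_cat \<Rightarrow> ('a, 'b) cat" where
  "cat01 K = \<lparr>Ob = Cell0 K, Ar = Cell1 K, Dom = Src1 K, Cod = Tgt1 K, Idn = Id1 K, Comp = Comp1 K\<rparr>"

definition cat12 :: "('a, 'b, 'c) two_cat \<Rightarrow> ('b, 'c) cat" where
  "cat12 K = \<lparr>Ob = Cell1 K, Ar = Cell2 K, Dom = Src2 K, Cod = Tgt2 K, Idn = Id2 K, Comp = VComp K\<rparr>"

definition cat02 :: "('a, 'b, 'c) two_cat \<Rightarrow> ('a, 'c) cat" where
  "cat02 K = \<lparr>Ob = Cell0 K, Ar = Cell2 K, Dom = Src1 K \<circ> Src2 K, Cod = Tgt1 K \<circ> Src2 K,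
     Idn = Id2 K \<circ> Id1 K, Comp = HComp K\<rparr>"

locale two_category =
  fixes K :: "('a, 'b, 'c) two_cat"  (structure)
  assumes cat01: "category (cat01 K)"
    and cat12: "category (cat12 K)"
    and cat02: "category (cat02 K)"
    and globular: "\<alpha> \<in> Cell2 K \<Longrightarrow>
      Src1 K (Src2 K \<alpha>) = Src1 K (Tgt2 K \<alpha>) \<and> Tgt1 K (Src2 K \<alpha>) = Tgt1 K (Tgt2 K \<alpha>)"
    and hcomp_src_tgt: "\<lbrakk>\<alpha> \<in> Cell2 K; \<beta> \<in> Cell2 K; Src1 K (Src2 K \<beta>) = Tgt1 K (Src2 K \<alpha>)\<rbrakk> \<Longrightarrow>
      Src2 K (\<beta> \<star> \<alpha>) = Src2 K \<beta> \<odot> Src2 K \<alpha> \<and> Tgt2 K (\<beta> \<star> \<alpha>) = Tgt2 K \<beta> \<odot> Tgt2 K \<alpha>"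
    and hcomp_id2: "\<lbrakk>f \<in> Cell1 K; g \<in> Cell1 K; Src1 K g = Tgt1 K f\<rbrakk> \<Longrightarrow>
      Id2 K g \<star> Id2 K f = Id2 K (g \<odot> f)"
    and interchange: "\<lbrakk>\<alpha> \<in> Cell2 K; \<alpha>' \<in> Cell2 K; \<beta> \<in> Cell2 K; \<beta>' \<in> Cell2 K;
      Src2 K \<alpha>' = Tgt2 K \<alpha>; Src2 K \<beta>' = Tgt2 K \<beta>; Src1 K (Src2 K \<beta>) = Tgt1 K (Src2 K \<alpha>)\<rbrakk> \<Longrightarrow>
      (\<beta>' \<bullet> \<beta>) \<star> (\<alpha>' \<bullet> \<alpha>) = (\<beta>' \<star> \<alpha>') \<bullet> (\<beta> \<star> \<alpha>)"

record ('a, 'b, 'c, 'd, 'e, 'f) two_map =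
  Map0 :: "'a \<Rightarrow> 'd"
  Map1 :: "'b \<Rightarrow> 'e"
  Map2 :: "'c \<Rightarrow> 'f"

definition two_functor ::
  "('a, 'b, 'c) two_cat \<Rightarrow> ('d, 'e, 'f) two_cat \<Rightarrow> ('a, 'b, 'c, 'd, 'e, 'f) two_map \<Rightarrow> bool" where
  "two_functor K L F \<longleftrightarrow>
     is_functor (cat01 K) (cat01 L) (Map0 F) (Map1 F) \<and>
     is_functor (cat12 K) (cat12 L) (Map1 F) (Map2 F) \<and>
     is_functor (cat02 K) (cat02 L) (Map0 F) (Map2 F)"

definition id_map :: "('a, 'b, 'c, 'a, 'b, 'c) two_map" where
  "id_map = \<lparr>Map0 = id, Map1 = id, Map2 = id\<rparr>"

definition comp_map :: "('d, 'e, 'f, 'g, 'h, 'i) two_map \<Rightarrow> ('a, 'b, 'c, 'd, 'e, 'f) two_map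
    \<Rightarrow> ('a, 'b, 'c, 'g, 'h, 'i) two_map" where
  "comp_map G F = \<lparr>Map0 = Map0 G \<circ> Map0 F, Map1 = Map1 G \<circ> Map1 F, Map2 = Map2 G \<circ> Map2 F\<rparr>"

definition two_natural :: "('a, 'b, 'c) two_cat \<Rightarrow> ('d, 'e, 'f) two_cat \<Rightarrow>
    ('a, 'b, 'c, 'd, 'e, 'f) two_map \<Rightarrow> ('a, 'b, 'c, 'd, 'e, 'f) two_map \<Rightarrow> ('a \<Rightarrow> 'e) \<Rightarrow> bool" where
  "two_natural K L F G t \<longleftrightarrow>
     (\<forall>X \<in> Cell0 K. t X \<in> Hom (cat01 L) (Map0 F X) (Map0 G X)) \<and>
     (\<forall>f \<in> Cell1 K. Map1 G f \<odot>\<^bsub>L\<^esub> t (Src1 K f) = t (Tgt1 K f) \<odot>\<^bsub>L\<^esub> Map1 F f) \<and>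
     (\<forall>\<alpha> \<in> Cell2 K. Map2 G \<alpha> \<star>\<^bsub>L\<^esub> Id2 L (t (Src1 K (Src2 K \<alpha>))) =
        Id2 L (t (Tgt1 K (Src2 K \<alpha>))) \<star>\<^bsub>L\<^esub> Map2 F \<alpha>)"

definition two_natural_iso :: "('a, 'b, 'c) two_cat \<Rightarrow> ('d, 'e, 'f) two_cat \<Rightarrow>
    ('a, 'b, 'c, 'd, 'e, 'f) two_map \<Rightarrow> ('a, 'b, 'c, 'd, 'e, 'f) two_map \<Rightarrow> ('a \<Rightarrow> 'e) \<Rightarrow> bool" where
  "two_natural_iso K L F G t \<longleftrightarrow>
     two_natural K L F G t \<and> (\<forall>X \<in> Cell0 K. is_iso (cat01 L) (t X))"

definition two_equivalent :: "('a, 'b, 'c) two_cat \<Rightarrow> ('d, 'e, 'f) two_cat \<Rightarrow> bool" where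
  "two_equivalent K L \<longleftrightarrow> two_category K \<and> two_category L \<and>
     (\<exists>F G u v. two_functor K L F \<and> two_functor L K G \<and>
        two_natural_iso K K id_map (comp_map G F) u \<and>
        two_natural_iso L L (comp_map F G) id_map v)"

definition two_monad :: "('a, 'b, 'c) two_cat \<Rightarrow> ('a, 'b, 'c, 'a, 'b, 'c) two_map \<Rightarrow>
    ('a \<Rightarrow> 'b) \<Rightarrow> ('a \<Rightarrow> 'b) \<Rightarrow> bool" where
  "two_monad K T \<mu> \<eta> \<longleftrightarrow> two_category K \<and> two_functor K K T \<and>
     two_natural K K (comp_map T T) T \<mu> \<and> two_natural K K id_map T \<eta> \<and>
     (\<forall>A \<in> Cell0 K.
        \<mu> A \<odot>\<^bsub>K\<^esub> Map1 T (\<mu> A) = \<mu> A \<odot>\<^bsub>K\<^esub> \<mu> (Map0 T A) \<and>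
        \<mu> A \<odot>\<^bsub>K\<^esub> Map1 T (\<eta> A) = Id1 K (Map0 T A) \<and>
        \<mu> A \<odot>\<^bsub>K\<^esub> \<eta> (Map0 T A) = Id1 K (Map0 T A))"

definition algebra :: "('a, 'b, 'c) two_cat \<Rightarrow> ('a, 'b, 'c, 'a, 'b, 'c) two_map \<Rightarrow>
    ('a \<Rightarrow> 'b) \<Rightarrow> ('a \<Rightarrow> 'b) \<Rightarrow> 'a \<times> 'b \<Rightarrow> bool" where
  "algebra K T \<mu> \<eta> = (\<lambda>(A, a).
     A \<in> Cell0 K \<and> a \<in> Hom (cat01 K) (Map0 T A) A \<and>
     a \<odot>\<^bsub>K\<^esub> Map1 T a = a \<odot>\<^bsub>K\<^esub> \<mu> A \<and> a \<odot>\<^bsub>K\<^esub> \<eta> A = Id1 K A)"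

text \<open>A 1-cell \<open>(f, f\<^sup>-)\<close> of algebras carries its source and target, as does a 2-cell.\<close>

record ('a, 'b, 'c) alg_mor =
  AmSrc :: "'a \<times> 'b"
  AmTgt :: "'a \<times> 'b"
  AmMap :: "'b"
  AmCell :: "'c"

record ('a, 'b, 'c) alg_cell =
  AcSrc :: "('a, 'b, 'c) alg_mor"
  AcTgt :: "('a, 'b, 'c) alg_mor"
  AcCell :: "'c"

text \<open>Whiskering of a 2-cell by a 1-cell is horizontal composition with the identity 2-cell.\<close>

definition algebra_morphism :: "('a, 'b, 'c) two_cat \<Rightarrow> ('a, 'b, 'c, 'a, 'b, 'c) two_map \<Rightarrow>
    ('a \<Rightarrow> 'b) \<Rightarrow> ('a \<Rightarrow> 'b) \<Rightarrow> ('a, 'b, 'c) alg_mor \<Rightarrow> bool" where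
  "algebra_morphism K T \<mu> \<eta> m \<longleftrightarrow>
     algebra K T \<mu> \<eta> (AmSrc m) \<and> algebra K T \<mu> \<eta> (AmTgt m) \<and>
     (let A = fst (AmSrc m); a = snd (AmSrc m); B = fst (AmTgt m); b = snd (AmTgt m);
          f = AmMap m; f' = AmCell m in
        f \<in> Hom (cat01 K) A B \<and>
        f' \<in> Hom (cat12 K) (b \<odot>\<^bsub>K\<^esub> Map1 T f) (f \<odot>\<^bsub>K\<^esub> a) \<and> is_iso (cat12 K) f' \<and>
        f' \<star>\<^bsub>K\<^esub> Id2 K (\<mu> A) = (f' \<star>\<^bsub>K\<^esub> Id2 K (Map1 T a)) \<bullet>\<^bsub>K\<^esub> (Id2 K b \<star>\<^bsub>K\<^esub> Map2 T f') \<and>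
        f' \<star>\<^bsub>K\<^esub> Id2 K (\<eta> A) = Id2 K f)"

definition algebra_cell :: "('a, 'b, 'c) two_cat \<Rightarrow> ('a, 'b, 'c, 'a, 'b, 'c) two_map \<Rightarrow>
    ('a \<Rightarrow> 'b) \<Rightarrow> ('a \<Rightarrow> 'b) \<Rightarrow> ('a, 'b, 'c) alg_cell \<Rightarrow> bool" where
  "algebra_cell K T \<mu> \<eta> c \<longleftrightarrow>
     algebra_morphism K T \<mu> \<eta> (AcSrc c) \<and> algebra_morphism K T \<mu> \<eta> (AcTgt c) \<and>
     AmSrc (AcSrc c) = AmSrc (AcTgt c) \<and> AmTgt (AcSrc c) = AmTgt (AcTgt c) \<and>
     (let a = snd (AmSrc (AcSrc c)); b = snd (AmTgt (AcSrc c));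
          f' = AmCell (AcSrc c); g' = AmCell (AcTgt c); \<alpha> = AcCell c in
        \<alpha> \<in> Hom (cat12 K) (AmMap (AcSrc c)) (AmMap (AcTgt c)) \<and>
        (\<alpha> \<star>\<^bsub>K\<^esub> Id2 K a) \<bullet>\<^bsub>K\<^esub> f' = g' \<bullet>\<^bsub>K\<^esub> (Id2 K b \<star>\<^bsub>K\<^esub> Map2 T \<alpha>))"

definition alg_comp :: "('a, 'b, 'c) two_cat \<Rightarrow> ('a, 'b, 'c, 'a, 'b, 'c) two_map \<Rightarrow>
    ('a, 'b, 'c) alg_mor \<Rightarrow> ('a, 'b, 'c) alg_mor \<Rightarrow> ('a, 'b, 'c) alg_mor" where
  "alg_comp K T n m = \<lparr>AmSrc = AmSrc m, AmTgt = AmTgt n, AmMap = AmMap n \<odot>\<^bsub>K\<^esub> AmMap m,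
     AmCell = (Id2 K (AmMap n) \<star>\<^bsub>K\<^esub> AmCell m) \<bullet>\<^bsub>K\<^esub> (AmCell n \<star>\<^bsub>K\<^esub> Id2 K (Map1 T (AmMap m)))\<rparr>"

definition Alg :: "('a, 'b, 'c) two_cat \<Rightarrow> ('a, 'b, 'c, 'a, 'b, 'c) two_map \<Rightarrow>
    ('a \<Rightarrow> 'b) \<Rightarrow> ('a \<Rightarrow> 'b) \<Rightarrow> ('a \<times> 'b, ('a, 'b, 'c) alg_mor, ('a, 'b, 'c) alg_cell) two_cat" where
  "Alg K T \<mu> \<eta> = \<lparr>
     Cell0 = {X. algebra K T \<mu> \<eta> X},
     Cell1 = {m. algebra_morphism K T \<mu> \<eta> m},
     Cell2 = {c. algebra_cell K T \<mu> \<eta> c},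
     Src1 = AmSrc, Tgt1 = AmTgt, Src2 = AcSrc, Tgt2 = AcTgt,
     Id1 = (\<lambda>X. \<lparr>AmSrc = X, AmTgt = X, AmMap = Id1 K (fst X), AmCell = Id2 K (snd X)\<rparr>),
     Id2 = (\<lambda>m. \<lparr>AcSrc = m, AcTgt = m, AcCell = Id2 K (AmMap m)\<rparr>),
     Comp1 = alg_comp K T,
     VComp = (\<lambda>d c. \<lparr>AcSrc = AcSrc c, AcTgt = AcTgt d, AcCell = AcCell d \<bullet>\<^bsub>K\<^esub> AcCell c\<rparr>),
     HComp = (\<lambda>d c. \<lparr>AcSrc = alg_comp K T (AcSrc d) (AcSrc c), AcTgt = alg_comp K T (AcTgt d) (AcTgt c),
       AcCell = AcCell d \<star>\<^bsub>K\<^esub> AcCell c\<rparr>)\<rparr>"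


section \<open>The 2-categories \<open>ED\<close> and \<open>CED\<close>\<close>

text \<open>A 1-cell \<open>(F, b) : P \<rightarrow> R\<close> has \<open>F = (MOb, MAr)\<close> and \<open>b\<^sub>A = MFib A\<close>. All the functions are
  \<open>undefined\<close> outside their domains, so that equality of records is equality of 1-cells.\<close>

record ('o, 'm, 'p) doctrine_mor =
  MSrc :: "('o, 'm, 'p) doctrine"
  MTgt :: "('o, 'm, 'p) doctrine"
  MOb :: "'o \<Rightarrow> 'o"
  MAr :: "'m \<Rightarrow> 'm"
  MFib :: "'o \<Rightarrow> 'p \<Rightarrow> 'p"

record ('o, 'm, 'p) doctrine_cell =
  CSrc :: "('o, 'm, 'p) doctrine_mor"
  CTgt :: "('o, 'm, 'p) doctrine_mor"
  CMap :: "'o \<Rightarrow> 'm"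

definition doctrine_morphism :: "('o, 'm, 'p) doctrine_mor \<Rightarrow> bool" where
  "doctrine_morphism M \<longleftrightarrow>
     elementary_doctrine (MSrc M) \<and> elementary_doctrine (MTgt M) \<and>
     (let P = MSrc M; R = MTgt M; F = MOb M; F' = MAr M; b = MFib M in
        F \<in> extensional (Ob P) \<and> F' \<in> extensional (Ar P) \<and> b \<in> extensional (Ob P) \<and>
        (\<forall>A \<in> Ob P. b A \<in> extensional (carrier (Fib P A))) \<and>
        is_functor P R F F' \<and> preserves_products P R F F' \<and>
        (\<forall>A \<in> Ob P. inf_hom (Fib P A) (Fib R (F A)) (b A)) \<and>
        (\<forall>f \<in> Ar P. \<forall>\<alpha> \<in> carrier (Fib P (Cod P f)).
           b (Dom P f) (Sub P f \<alpha>) = Sub R (F' f) (b (Cod P f) \<alpha>)) \<and>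
        (\<forall>A \<in> Ob P. b (Prd P A A) (delta P A) =
           Sub R (pair R (F' (Pr1 P A A)) (F' (Pr2 P A A))) (delta R (F A))))"

definition doctrine_transformation :: "('o, 'm, 'p) doctrine_cell \<Rightarrow> bool" where
  "doctrine_transformation \<theta> \<longleftrightarrow>
     doctrine_morphism (CSrc \<theta>) \<and> doctrine_morphism (CTgt \<theta>) \<and>
     MSrc (CSrc \<theta>) = MSrc (CTgt \<theta>) \<and> MTgt (CSrc \<theta>) = MTgt (CTgt \<theta>) \<and>
     (let P = MSrc (CSrc \<theta>); R = MTgt (CSrc \<theta>); M = CSrc \<theta>; N = CTgt \<theta>; t = CMap \<theta> in
        t \<in> extensional (Ob P) \<and>
        (\<forall>A \<in> Ob P. t A \<in> Hom R (MOb M A) (MOb N A)) \<and>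
        (\<forall>f \<in> Ar P. MAr N f \<cdot>\<^bsub>R\<^esub> t (Dom P f) = t (Cod P f) \<cdot>\<^bsub>R\<^esub> MAr M f) \<and>
        (\<forall>A \<in> Ob P. \<forall>\<alpha> \<in> carrier (Fib P A).
           MFib M A \<alpha> \<sqsubseteq>\<^bsub>Fib R (MOb M A)\<^esub> Sub R (t A) (MFib N A \<alpha>)))"

definition doctrine_id :: "('o, 'm, 'p) doctrine \<Rightarrow> ('o, 'm, 'p) doctrine_mor" where
  "doctrine_id P = \<lparr>MSrc = P, MTgt = P, MOb = (\<lambda>A\<in>Ob P. A), MAr = (\<lambda>f\<in>Ar P. f),
     MFib = (\<lambda>A\<in>Ob P. \<lambda>\<alpha>\<in>carrier (Fib P A). \<alpha>)\<rparr>"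

definition doctrine_comp ::
  "('o, 'm, 'p) doctrine_mor \<Rightarrow> ('o, 'm, 'p) doctrine_mor \<Rightarrow> ('o, 'm, 'p) doctrine_mor" where
  "doctrine_comp N M = \<lparr>MSrc = MSrc M, MTgt = MTgt N,
     MOb = (\<lambda>A\<in>Ob (MSrc M). MOb N (MOb M A)),
     MAr = (\<lambda>f\<in>Ar (MSrc M). MAr N (MAr M f)),
     MFib = (\<lambda>A\<in>Ob (MSrc M). \<lambda>\<alpha>\<in>carrier (Fib (MSrc M) A). MFib N (MOb M A) (MFib M A \<alpha>))\<rparr>"

definition ED :: "(('o, 'm, 'p) doctrine, ('o, 'm, 'p) doctrine_mor, ('o, 'm, 'p) doctrine_cell) two_cat" where
  "ED = \<lparr>
     Cell0 = {P. elementary_doctrine P},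
     Cell1 = {M. doctrine_morphism M},
     Cell2 = {\<theta>. doctrine_transformation \<theta>},
     Src1 = MSrc, Tgt1 = MTgt, Src2 = CSrc, Tgt2 = CTgt,
     Id1 = doctrine_id,
     Id2 = (\<lambda>M. \<lparr>CSrc = M, CTgt = M, CMap = (\<lambda>A\<in>Ob (MSrc M). Idn (MTgt M) (MOb M A))\<rparr>),
     Comp1 = doctrine_comp,
     VComp = (\<lambda>\<phi> \<theta>. \<lparr>CSrc = CSrc \<theta>, CTgt = CTgt \<phi>,
       CMap = (\<lambda>A\<in>Ob (MSrc (CSrc \<theta>)). CMap \<phi> A \<cdot>\<^bsub>MTgt (CSrc \<theta>)\<^esub> CMap \<theta> A)\<rparr>),
     HComp = (\<lambda>\<phi> \<theta>. \<lparr>CSrc = doctrine_comp (CSrc \<phi>) (CSrc \<theta>), CTgt = doctrine_comp (CTgt \<phi>) (CTgt \<theta>),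
       CMap = (\<lambda>A\<in>Ob (MSrc (CSrc \<theta>)).
         CMap \<phi> (MOb (CTgt \<theta>) A) \<cdot>\<^bsub>MTgt (CSrc \<phi>)\<^esub> MAr (CSrc \<phi>) (CMap \<theta> A))\<rparr>)\<rparr>"

definition CED :: "(('o, 'm, 'p) doctrine, ('o, 'm, 'p) doctrine_mor, ('o, 'm, 'p) doctrine_cell) two_cat" where
  "CED = ED\<lparr>
     Cell0 := {P \<in> Cell0 ED. comprehensive_diagonals P},
     Cell1 := {M \<in> Cell1 ED. comprehensive_diagonals (MSrc M) \<and> comprehensive_diagonals (MTgt M)},
     Cell2 := {\<theta> \<in> Cell2 ED. comprehensive_diagonals (MSrc (CSrc \<theta>)) \<and>
       comprehensive_diagonals (MTgt (CSrc \<theta>))}\<rparr>"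


section \<open>The comprehensive diagonal completion\<close>

definition ext_arrow :: "('o, 'm, 'p, 'x) doctrine_scheme \<Rightarrow> 'm \<Rightarrow> bool" where
  "ext_arrow P f \<longleftrightarrow> f \<in> Ar P \<and>
     delta P (Dom P f) \<sqsubseteq>\<^bsub>Fib P (Prd P (Dom P f) (Dom P f))\<^esub> Sub P (cross P f f) (delta P (Cod P f))"

definition ext_class :: "('o, 'm, 'p, 'x) doctrine_scheme \<Rightarrow> 'm \<Rightarrow> 'm set" where
  "ext_class P f = {f'. ext_arrow P f' \<and> Dom P f' = Dom P f \<and> Cod P f' = Cod P f \<and>
     delta P (Dom P f) \<sqsubseteq>\<^bsub>Fib P (Prd P (Dom P f) (Dom P f))\<^esub> Sub P (cross P f f') (delta P (Cod P f))}"

text \<open>The 0-cells of \<open>ED\<close> have arrows in one fixed type \<open>'m\<close>, and sets of arrows do not embed into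
  \<open>'m\<close>. The equivalence classes of arrows of \<open>P\<close> are therefore named by elements of \<open>'m\<close>, the class
  \<open>c\<close> being named \<open>q P c\<close>; any naming will do that gives different classes different names. The lemma
  \<open>class_naming_exists\<close> below shows that namings exist.\<close>

definition class_naming :: "(('o, 'm, 'p) doctrine \<Rightarrow> 'm set \<Rightarrow> 'm) \<Rightarrow> bool" where
  "class_naming q \<longleftrightarrow>
     (\<forall>P. elementary_doctrine P \<longrightarrow> inj_on (q P) {ext_class P f | f. ext_arrow P f})"

context category
begin

lemma HomI: "\<lbrakk>f \<in> Ar C; Dom C f = A; Cod C f = B\<rbrakk> \<Longrightarrow> f \<in> Hom C A B"
  by (simp add: Hom_def)

lemma HomD: "f \<in> Hom C A B \<Longrightarrow> f \<in> Ar C \<and> Dom C f = A \<and> Cod C f = B"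
  by (simp add: Hom_def)

lemma comp_in: "\<lbrakk>f \<in> Hom C A B; g \<in> Hom C B D\<rbrakk> \<Longrightarrow> g \<cdot> f \<in> Hom C A D"
  using comp_hom[of f g] by (auto simp: Hom_def)

lemma assoc_in: "\<lbrakk>f \<in> Hom C A B; g \<in> Hom C B D; h \<in> Hom C D E\<rbrakk> \<Longrightarrow> (h \<cdot> g) \<cdot> f = h \<cdot> (g \<cdot> f)"
  using comp_assoc[of f g h] by (auto simp: Hom_def)

lemma Hom_ob: "f \<in> Hom C A B \<Longrightarrow> A \<in> Ob C \<and> B \<in> Ob C"
  using dom_ob cod_ob by (auto simp: Hom_def)

end

context category_with_products
begin

lemma pr_in:
  assumes "A \<in> Ob C" "B \<in> Ob C"
  shows "Prd C A B \<in> Ob C" "Pr1 C A B \<in> Hom C (Prd C A B) A" "Pr2 C A B \<in> Hom C (Prd C A B) B"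
  using products[OF assms] by (auto simp: is_product_def)

lemma pair_ex1:
  assumes "f \<in> Hom C Z A" "g \<in> Hom C Z B"
  shows "\<exists>!h. h \<in> Hom C Z (Prd C A B) \<and> Pr1 C A B \<cdot> h = f \<and> Pr2 C A B \<cdot> h = g"
proof -
  have ob: "A \<in> Ob C" "B \<in> Ob C" using assms Hom_ob by blast+
  have f: "f \<in> Ar C" "g \<in> Ar C" "Dom C f = Dom C g \<and> Cod C f = A \<and> Cod C g = B" "Dom C f = Z"
    using assms by (auto simp: Hom_def)
  have "\<forall>f \<in> Ar C. \<forall>g \<in> Ar C. Dom C f = Dom C g \<and> Cod C f = A \<and> Cod C g = B \<longrightarrow>
      (\<exists>!h. h \<in> Hom C (Dom C f) (Prd C A B) \<and> Pr1 C A B \<cdot> h = f \<and> Pr2 C A B \<cdot> h = g)"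
    using products[OF ob] unfolding is_product_def by (elim conjE)
  from this[rule_format, OF f(1,2,3)] show ?thesis unfolding f(4) .
qed

lemma pair_props:
  assumes "f \<in> Hom C Z A" "g \<in> Hom C Z B"
  shows "pair C f g \<in> Hom C Z (Prd C A B) \<and> Pr1 C A B \<cdot> pair C f g = f \<and> Pr2 C A B \<cdot> pair C f g = g"
proof -
  have d: "Dom C f = Z" "Cod C f = A" "Cod C g = B" using assms by (auto simp: Hom_def)
  show ?thesis unfolding pair_def d by (rule theI'[OF pair_ex1[OF assms]])
qed

lemmas pair_in = pair_props[THEN conjunct1]
lemmas pr1_pair = pair_props[THEN conjunct2, THEN conjunct1]
lemmas pr2_pair = pair_props[THEN conjunct2, THEN conjunct2]

lemma pair_eqI:
  assumes "h \<in> Hom C Z (Prd C A B)" "Pr1 C A B \<cdot> h = f" "Pr2 C A B \<cdot> h = g"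
    and "f \<in> Hom C Z A" "g \<in> Hom C Z B"
  shows "h = pair C f g"
  using pair_ex1[OF assms(4,5)] pair_props[OF assms(4,5)] assms(1-3) by blast

lemma pair_comp:
  assumes f: "f \<in> Hom C Z A" and g: "g \<in> Hom C Z B" and k: "k \<in> Hom C Y Z"
  shows "pair C f g \<cdot> k = pair C (f \<cdot> k) (g \<cdot> k)"
proof (rule pair_eqI)
  have ob: "A \<in> Ob C" "B \<in> Ob C" using f g Hom_ob by blast+
  show "pair C f g \<cdot> k \<in> Hom C Y (Prd C A B)" by (rule comp_in[OF k pair_in[OF f g]])
  show "f \<cdot> k \<in> Hom C Y A" "g \<cdot> k \<in> Hom C Y B" by (rule comp_in[OF k f] comp_in[OF k g])+
  show "Pr1 C A B \<cdot> (pair C f g \<cdot> k) = f \<cdot> k"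
    using assoc_in[OF k pair_in[OF f g] pr_in(2)[OF ob]] pr1_pair[OF f g] by simp
  show "Pr2 C A B \<cdot> (pair C f g \<cdot> k) = g \<cdot> k"
    using assoc_in[OF k pair_in[OF f g] pr_in(3)[OF ob]] pr2_pair[OF f g] by simp
qed

lemma cross_diag:
  assumes f: "f \<in> Hom C A B" and g: "g \<in> Hom C A D"
  shows "cross C f g \<in> Hom C (Prd C A A) (Prd C B D)" "cross C f g \<cdot> diag C A = pair C f g"
proof -
  have A: "A \<in> Ob C" using f Hom_ob by blast
  have d: "Dom C f = A" "Dom C g = A" using f g by (auto simp: Hom_def)
  note p = pr_in[OF A A] and i = idn_hom[OF A]
  note fp = comp_in[OF p(2) f] and gp = comp_in[OF p(3) g]
  show "cross C f g \<in> Hom C (Prd C A A) (Prd C B D)"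
    unfolding cross_def d by (rule pair_in[OF fp gp])
  have D: "diag C A \<in> Hom C A (Prd C A A)" unfolding diag_def by (rule pair_in[OF i i])
  have "cross C f g \<cdot> diag C A = pair C ((f \<cdot> Pr1 C A A) \<cdot> diag C A) ((g \<cdot> Pr2 C A A) \<cdot> diag C A)"
    unfolding cross_def d by (rule pair_comp[OF fp gp D])
  also have "(f \<cdot> Pr1 C A A) \<cdot> diag C A = f \<cdot> (Pr1 C A A \<cdot> diag C A)" by (rule assoc_in[OF D p(2) f])
  also have "Pr1 C A A \<cdot> diag C A = Idn C A" unfolding diag_def by (rule pr1_pair[OF i i])
  also have "(g \<cdot> Pr2 C A A) \<cdot> diag C A = g \<cdot> (Pr2 C A A \<cdot> diag C A)" by (rule assoc_in[OF D p(3) g])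
  also have "Pr2 C A A \<cdot> diag C A = Idn C A" unfolding diag_def by (rule pr2_pair[OF i i])
  finally show "cross C f g \<cdot> diag C A = pair C f g"
    using comp_idn[of f] comp_idn[of g] f g by (simp add: Hom_def)
qed

end

lemma inf_semilattice_facts:
  assumes "inf_semilattice L"
  shows "partial_order L"
    and "greatest L (\<top>\<^bsub>L\<^esub>) (carrier L)"
    and "\<lbrakk>finite S; S \<subseteq> carrier L\<rbrakk> \<Longrightarrow> is_glb L (\<Sqinter>\<^bsub>L\<^esub> S) S"
    and "\<lbrakk>x \<in> carrier L; y \<in> carrier L\<rbrakk> \<Longrightarrow> is_glb L (x \<sqinter>\<^bsub>L\<^esub> y) {x, y}"
proof -
  have ex: "\<exists>i. is_glb L i S" if "finite S" "S \<subseteq> carrier L" for S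
    using assms that by (simp add: inf_semilattice_def)
  show "partial_order L" using assms by (simp add: inf_semilattice_def)
  show "greatest L (\<top>\<^bsub>L\<^esub>) (carrier L)" using ex[of "{}"] by (auto simp: top_def intro: someI_ex)
  show g: "is_glb L (\<Sqinter>\<^bsub>L\<^esub> S) S" if "finite S" "S \<subseteq> carrier L" for S
    using ex[OF that] by (auto simp: inf_def intro: someI_ex)
  show "is_glb L (x \<sqinter>\<^bsub>L\<^esub> y) {x, y}" if "x \<in> carrier L" "y \<in> carrier L"
    using g[of "{x, y}"] that by (simp add: meet_def)
qed

lemma inf_hom_closed: "\<lbrakk>inf_hom L M h; x \<in> carrier L\<rbrakk> \<Longrightarrow> h x \<in> carrier M"
  by (auto simp: inf_hom_def)

lemma inf_hom_inf: "\<lbrakk>inf_hom L M h; finite S; S \<subseteq> carrier L\<rbrakk> \<Longrightarrow> h (\<Sqinter>\<^bsub>L\<^esub> S) = \<Sqinter>\<^bsub>M\<^esub> (h ` S)"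
  by (simp add: inf_hom_def)

lemma inf_hom_top: "inf_hom L M h \<Longrightarrow> h (\<top>\<^bsub>L\<^esub>) = \<top>\<^bsub>M\<^esub>"
  using inf_hom_inf[of L M h "{}"] by (simp add: inf_def top_def)

lemma inf_hom_meet:
  "\<lbrakk>inf_hom L M h; x \<in> carrier L; y \<in> carrier L\<rbrakk> \<Longrightarrow> h (x \<sqinter>\<^bsub>L\<^esub> y) = h x \<sqinter>\<^bsub>M\<^esub> h y"
  using inf_hom_inf[of L M h "{x, y}"] by (simp add: meet_def)

lemma meet_eq_left:
  assumes "inf_semilattice L" "x \<in> carrier L" "y \<in> carrier L"
  shows "x \<sqsubseteq>\<^bsub>L\<^esub> y \<longleftrightarrow> x \<sqinter>\<^bsub>L\<^esub> y = x"
proof -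
  interpret partial_order L by (rule inf_semilattice_facts(1)[OF assms(1)])
  have g: "is_glb L (x \<sqinter>\<^bsub>L\<^esub> y) {x, y}" by (rule inf_semilattice_facts(4)[OF assms])
  then have c: "x \<sqinter>\<^bsub>L\<^esub> y \<in> carrier L" by (rule greatest_closed)
  show ?thesis
  proof
    assume "x \<sqsubseteq>\<^bsub>L\<^esub> y"
    then have "x \<in> Lower L {x, y}" using assms by (auto simp: Lower_def)
    then have "x \<sqsubseteq>\<^bsub>L\<^esub> x \<sqinter>\<^bsub>L\<^esub> y" using g by (simp add: greatest_def)
    moreover have "x \<sqinter>\<^bsub>L\<^esub> y \<sqsubseteq>\<^bsub>L\<^esub> x" using g assms by (auto simp: greatest_def Lower_def)
    ultimately show "x \<sqinter>\<^bsub>L\<^esub> y = x" using le_antisym c assms by blast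
  next
    assume e: "x \<sqinter>\<^bsub>L\<^esub> y = x"
    show "x \<sqsubseteq>\<^bsub>L\<^esub> y" using g assms unfolding e by (auto simp: greatest_def Lower_def)
  qed
qed

lemma inf_hom_mono:
  assumes "inf_semilattice L" "inf_semilattice M" "inf_hom L M h" "x \<in> carrier L" "y \<in> carrier L"
    and "x \<sqsubseteq>\<^bsub>L\<^esub> y"
  shows "h x \<sqsubseteq>\<^bsub>M\<^esub> h y"
proof -
  have "h x \<sqinter>\<^bsub>M\<^esub> h y = h x"
    using inf_hom_meet[OF assms(3-5)] meet_eq_left[OF assms(1,4,5)] assms(6) by simp
  then show ?thesis using meet_eq_left[OF assms(2)] inf_hom_closed[OF assms(3)] assms(4,5) by blast
qed

context elementary_doctrine
begin

lemma sub_in: "\<lbrakk>f \<in> Hom P A B; \<alpha> \<in> carrier (Fib P B)\<rbrakk> \<Longrightarrow> Sub P f \<alpha> \<in> carrier (Fib P A)"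
  using inf_hom_closed[OF sub_hom[of f]] by (auto simp: Hom_def)

lemma sub_mono: "\<lbrakk>f \<in> Hom P A B; \<alpha> \<in> carrier (Fib P B); \<beta> \<in> carrier (Fib P B); \<alpha> \<sqsubseteq>\<^bsub>Fib P B\<^esub> \<beta>\<rbrakk>
    \<Longrightarrow> Sub P f \<alpha> \<sqsubseteq>\<^bsub>Fib P A\<^esub> Sub P f \<beta>"
  using inf_hom_mono[OF fib fib sub_hom[of f]] dom_ob[of f] cod_ob[of f] by (auto simp: Hom_def)

lemma sub_top: "f \<in> Hom P A B \<Longrightarrow> Sub P f (\<top>\<^bsub>Fib P B\<^esub>) = \<top>\<^bsub>Fib P A\<^esub>"
  using inf_hom_top[OF sub_hom[of f]] by (auto simp: Hom_def)

lemma sub_meet: "\<lbrakk>f \<in> Hom P A B; \<alpha> \<in> carrier (Fib P B); \<beta> \<in> carrier (Fib P B)\<rbrakk>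
    \<Longrightarrow> Sub P f (\<alpha> \<sqinter>\<^bsub>Fib P B\<^esub> \<beta>) = Sub P f \<alpha> \<sqinter>\<^bsub>Fib P A\<^esub> Sub P f \<beta>"
  using inf_hom_meet[OF sub_hom[of f]] by (auto simp: Hom_def)

lemma sub_sub: "\<lbrakk>f \<in> Hom P A B; g \<in> Hom P B D; \<alpha> \<in> carrier (Fib P D)\<rbrakk>
    \<Longrightarrow> Sub P f (Sub P g \<alpha>) = Sub P (g \<cdot> f) \<alpha>"
  using sub_comp[of f g \<alpha>] by (auto simp: Hom_def)

lemma top_in: "A \<in> Ob P \<Longrightarrow> \<top>\<^bsub>Fib P A\<^esub> \<in> carrier (Fib P A)"
  using inf_semilattice_facts(2)[OF fib] by (simp add: greatest_def)

lemma le_top: "\<lbrakk>A \<in> Ob P; \<alpha> \<in> carrier (Fib P A)\<rbrakk> \<Longrightarrow> \<alpha> \<sqsubseteq>\<^bsub>Fib P A\<^esub> \<top>\<^bsub>Fib P A\<^esub>"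
  using inf_semilattice_facts(2)[OF fib] by (simp add: greatest_def)

lemma top_le: "\<lbrakk>A \<in> Ob P; \<alpha> \<in> carrier (Fib P A); \<top>\<^bsub>Fib P A\<^esub> \<sqsubseteq>\<^bsub>Fib P A\<^esub> \<alpha>\<rbrakk> \<Longrightarrow> \<alpha> = \<top>\<^bsub>Fib P A\<^esub>"
  using partial_order.le_antisym[OF inf_semilattice_facts(1)[OF fib]] le_top top_in by blast

lemma fib_refl: "\<lbrakk>A \<in> Ob P; \<alpha> \<in> carrier (Fib P A)\<rbrakk> \<Longrightarrow> \<alpha> \<sqsubseteq>\<^bsub>Fib P A\<^esub> \<alpha>"
  by (rule weak_partial_order.le_refl[OF partial_order.axioms(1)[OF inf_semilattice_facts(1)[OF fib]]])

lemma top_meet: "\<lbrakk>A \<in> Ob P; \<alpha> \<in> carrier (Fib P A)\<rbrakk> \<Longrightarrow> \<top>\<^bsub>Fib P A\<^esub> \<sqinter>\<^bsub>Fib P A\<^esub> \<alpha> = \<alpha>"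
  using meet_eq_left[OF fib, of A \<alpha> "\<top>\<^bsub>Fib P A\<^esub>"] le_top[of A \<alpha>] top_in[of A]
  by (simp add: meet_def insert_commute)

lemma delta_char:
  assumes A: "A \<in> Ob P" and d: "is_delta P A d" and b: "\<beta> \<in> carrier (Fib P (Prd P A A))"
  shows "d \<sqsubseteq>\<^bsub>Fib P (Prd P A A)\<^esub> \<beta> \<longleftrightarrow> Sub P (diag P A) \<beta> = \<top>\<^bsub>Fib P A\<^esub>"
proof -
  have dc: "d \<in> carrier (Fib P (Prd P A A))" using d by (simp add: is_delta_def)
  have "Sub P (Pr1 P A A) (\<top>\<^bsub>Fib P A\<^esub>) \<sqinter>\<^bsub>Fib P (Prd P A A)\<^esub> d = d"
    using sub_top[OF pr_in(2)[OF A A]] top_meet[OF pr_in(1)[OF A A] dc] by simp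
  then have "d \<sqsubseteq>\<^bsub>Fib P (Prd P A A)\<^esub> \<beta> \<longleftrightarrow> \<top>\<^bsub>Fib P A\<^esub> \<sqsubseteq>\<^bsub>Fib P A\<^esub> Sub P (diag P A) \<beta>"
    using d top_in[OF A] b unfolding is_delta_def by metis
  moreover have D: "diag P A \<in> Hom P A (Prd P A A)"
    unfolding diag_def by (rule pair_in[OF idn_hom[OF A] idn_hom[OF A]])
  ultimately show ?thesis using top_le[OF A sub_in[OF D b]] fib_refl[OF A top_in[OF A]] by auto
qed

lemma delta_unique:
  assumes A: "A \<in> Ob P" and d: "is_delta P A d" and d': "is_delta P A d'"
  shows "d = d'"
proof -
  have O: "Prd P A A \<in> Ob P" by (rule pr_in(1)[OF A A])
  have c: "d \<in> carrier (Fib P (Prd P A A))" "d' \<in> carrier (Fib P (Prd P A A))"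
    using d d' by (auto simp: is_delta_def)
  have "d \<sqsubseteq>\<^bsub>Fib P (Prd P A A)\<^esub> d'" "d' \<sqsubseteq>\<^bsub>Fib P (Prd P A A)\<^esub> d"
    using delta_char[OF A d] delta_char[OF A d'] c fib_refl[OF O] by blast+
  then show ?thesis using partial_order.le_antisym[OF inf_semilattice_facts(1)[OF fib[OF O]]] c by blast
qed

lemma is_delta_delta: "A \<in> Ob P \<Longrightarrow> is_delta P A (delta P A)"
  unfolding delta_def using theI'[of "is_delta P A"] delta_exists delta_unique by blast

lemma delta_in: "A \<in> Ob P \<Longrightarrow> delta P A \<in> carrier (Fib P (Prd P A A))"
  using is_delta_delta by (simp add: is_delta_def)

lemma ext_le_iff:
  assumes f: "f \<in> Hom P A B" and g: "g \<in> Hom P A B"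
  shows "delta P A \<sqsubseteq>\<^bsub>Fib P (Prd P A A)\<^esub> Sub P (cross P f g) (delta P B) \<longleftrightarrow>
    Sub P (pair P f g) (delta P B) = \<top>\<^bsub>Fib P A\<^esub>"
proof -
  have A: "A \<in> Ob P" and B: "B \<in> Ob P" using f Hom_ob by blast+
  have D: "diag P A \<in> Hom P A (Prd P A A)"
    unfolding diag_def by (rule pair_in[OF idn_hom[OF A] idn_hom[OF A]])
  note c = cross_diag[OF f g]
  show ?thesis
    using delta_char[OF A is_delta_delta[OF A] sub_in[OF c(1) delta_in[OF B]]]
      sub_sub[OF D c(1) delta_in[OF B]] c(2) by simp
qed

lemma delta_refl:
  assumes f: "f \<in> Hom P A B"
  shows "Sub P (pair P f f) (delta P B) = \<top>\<^bsub>Fib P A\<^esub>"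
proof -
  have B: "B \<in> Ob P" using f Hom_ob by blast
  note i = idn_hom[OF B]
  have D: "diag P B \<in> Hom P B (Prd P B B)" unfolding diag_def by (rule pair_in[OF i i])
  have "Sub P (diag P B) (delta P B) = \<top>\<^bsub>Fib P B\<^esub>"
    using delta_char[OF B is_delta_delta[OF B] delta_in[OF B]] fib_refl[OF pr_in(1)[OF B B] delta_in[OF B]]
    by blast
  moreover have "diag P B \<cdot> f = pair P f f"
    using pair_comp[OF i i f] idn_comp[of f] f by (auto simp: diag_def Hom_def)
  ultimately show ?thesis using sub_sub[OF f D delta_in[OF B]] sub_top[OF f] by simp
qed

lemma delta_sym:
  assumes f: "f \<in> Hom P A B" and g: "g \<in> Hom P A B"
    and e: "Sub P (pair P f g) (delta P B) = \<top>\<^bsub>Fib P A\<^esub>"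
  shows "Sub P (pair P g f) (delta P B) = \<top>\<^bsub>Fib P A\<^esub>"
proof -
  have A: "A \<in> Ob P" and B: "B \<in> Ob P" using f Hom_ob by blast+
  note i = idn_hom[OF B] and p = pr_in[OF B B]
  define s where "s = pair P (Pr2 P B B) (Pr1 P B B)"
  have s: "s \<in> Hom P (Prd P B B) (Prd P B B)" unfolding s_def by (rule pair_in[OF p(3) p(2)])
  have comm: "s \<cdot> pair P h k = pair P k h" if h: "h \<in> Hom P Z B" and k: "k \<in> Hom P Z B" for h k Z
    unfolding s_def using pair_comp[OF p(3) p(2) pair_in[OF h k]] pr1_pair[OF h k] pr2_pair[OF h k] by simp
  note d = delta_in[OF B]
  have D: "diag P B \<in> Hom P B (Prd P B B)" unfolding diag_def by (rule pair_in[OF i i])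
  have "Sub P (diag P B) (Sub P s (delta P B)) = \<top>\<^bsub>Fib P B\<^esub>"
    using sub_sub[OF D s d] comm[OF i i] delta_refl[OF i] by (simp add: diag_def)
  then have le: "delta P B \<sqsubseteq>\<^bsub>Fib P (Prd P B B)\<^esub> Sub P s (delta P B)"
    using delta_char[OF B is_delta_delta[OF B] sub_in[OF s d]] by blast
  have "Sub P (pair P f g) (delta P B) \<sqsubseteq>\<^bsub>Fib P A\<^esub> Sub P (pair P f g) (Sub P s (delta P B))"
    by (rule sub_mono[OF pair_in[OF f g] d sub_in[OF s d] le])
  then have "\<top>\<^bsub>Fib P A\<^esub> \<sqsubseteq>\<^bsub>Fib P A\<^esub> Sub P (pair P g f) (delta P B)"
    using sub_sub[OF pair_in[OF f g] s d] comm[OF f g] e by simp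
  then show ?thesis using top_le[OF A sub_in[OF pair_in[OF g f] d]] by blast
qed

lemma delta_trans:
  assumes f: "f \<in> Hom P A B" and g: "g \<in> Hom P A B" and h: "h \<in> Hom P A B"
    and e1: "Sub P (pair P f g) (delta P B) = \<top>\<^bsub>Fib P A\<^esub>"
    and e2: "Sub P (pair P g h) (delta P B) = \<top>\<^bsub>Fib P A\<^esub>"
  shows "Sub P (pair P f h) (delta P B) = \<top>\<^bsub>Fib P A\<^esub>"
proof -
  have A: "A \<in> Ob P" and B: "B \<in> Ob P" using f Hom_ob by blast+
  define BB where "BB = Prd P B B"
  define BBB where "BBB = Prd P BB B"
  note p = pr_in[OF B B, folded BB_def] and d = delta_in[OF B]
  note t = pr_in[OF p(1) B, folded BBB_def]
  have t1: "tpr1 P B B \<in> Hom P BBB B" unfolding tpr1_def BB_def[symmetric] by (rule comp_in[OF t(2) p(2)])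
  have t2: "tpr2 P B B \<in> Hom P BBB B" unfolding tpr2_def BB_def[symmetric] by (rule comp_in[OF t(2) p(3)])
  have t3: "tpr3 P B B \<in> Hom P BBB B" unfolding tpr3_def BB_def[symmetric] by (rule t(3))
  have tp: "pair P (pair P h k) l \<in> Hom P Z BBB"
    "tpr1 P B B \<cdot> pair P (pair P h k) l = h" "tpr2 P B B \<cdot> pair P (pair P h k) l = k"
    "tpr3 P B B \<cdot> pair P (pair P h k) l = l"
    if h: "h \<in> Hom P Z B" and k: "k \<in> Hom P Z B" and l: "l \<in> Hom P Z B" for h k l Z
  proof -
    have hk: "pair P h k \<in> Hom P Z BB" unfolding BB_def by (rule pair_in[OF h k])
    show m: "pair P (pair P h k) l \<in> Hom P Z BBB" unfolding BBB_def by (rule pair_in[OF hk l])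
    note q1 = pr1_pair[OF hk l] and q2 = pr2_pair[OF hk l]
    show "tpr1 P B B \<cdot> pair P (pair P h k) l = h"
      unfolding tpr1_def BB_def[symmetric] using assoc_in[OF m t(2) p(2)] q1 pr1_pair[OF h k] by (simp add: BB_def)
    show "tpr2 P B B \<cdot> pair P (pair P h k) l = k"
      unfolding tpr2_def BB_def[symmetric] using assoc_in[OF m t(2) p(3)] q1 pr2_pair[OF h k] by (simp add: BB_def)
    show "tpr3 P B B \<cdot> pair P (pair P h k) l = l"
      unfolding tpr3_def BB_def[symmetric] by (rule q2)
  qed
  define m12 where "m12 = pair P (tpr1 P B B) (tpr2 P B B)"
  define m23 where "m23 = pair P (tpr2 P B B) (tpr3 P B B)"
  define m13 where "m13 = pair P (tpr1 P B B) (tpr3 P B B)"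
  have m: "m12 \<in> Hom P BBB BB" "m23 \<in> Hom P BBB BB" "m13 \<in> Hom P BBB BB"
    unfolding m12_def m23_def m13_def BB_def by (rule pair_in[OF t1 t2] pair_in[OF t2 t3] pair_in[OF t1 t3])+
  define e where "e = pair P (pair P (Pr1 P B B) (Pr2 P B B)) (Pr2 P B B)"
  have e: "e \<in> Hom P BB BBB" unfolding e_def by (rule tp(1)[OF p(2) p(3) p(3)])
  have "m13 \<cdot> e = pair P (Pr1 P B B) (Pr2 P B B)"
    unfolding m13_def using pair_comp[OF t1 t3 e] tp(2,4)[OF p(2) p(3) p(3)] by (simp add: e_def)
  also have "\<dots> = Idn P BB"
    using pair_eqI[of "Idn P BB" BB B B "Pr1 P B B" "Pr2 P B B"] idn_hom[OF p(1)] p(2,3)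
      comp_idn[of "Pr1 P B B"] comp_idn[of "Pr2 P B B"] by (simp add: Hom_def BB_def)
  finally have me: "Sub P e (Sub P m13 (delta P B)) = delta P B"
    using sub_sub[OF e m(3)] sub_idn[OF p(1)] d by (simp add: BB_def)
  note d' = d[folded BB_def]
  note md = sub_in[OF m(1) d'] sub_in[OF m(2) d'] sub_in[OF m(3) d']
  have "Sub P m12 (delta P B) \<sqinter>\<^bsub>Fib P BBB\<^esub> Sub P m23 (delta P B) \<sqsubseteq>\<^bsub>Fib P BBB\<^esub> Sub P m13 (delta P B)
      \<longleftrightarrow> delta P B \<sqsubseteq>\<^bsub>Fib P BB\<^esub> Sub P e (Sub P m13 (delta P B))"
    using is_delta_delta[OF B, unfolded is_delta_def Let_def, THEN conjunct2, THEN conjunct2,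
        rule_format, OF B, folded BB_def, folded BBB_def, folded m12_def m23_def e_def, OF d' md(3)] .
  then have le: "Sub P m12 (delta P B) \<sqinter>\<^bsub>Fib P BBB\<^esub> Sub P m23 (delta P B) \<sqsubseteq>\<^bsub>Fib P BBB\<^esub> Sub P m13 (delta P B)"
    using me fib_refl[OF p(1) d'] by simp
  define w where "w = pair P (pair P f g) h"
  note W = tp[OF f g h, folded w_def]
  have mw: "m12 \<cdot> w = pair P f g" "m23 \<cdot> w = pair P g h" "m13 \<cdot> w = pair P f h"
    unfolding m12_def m23_def m13_def
    using pair_comp[OF t1 t2 W(1)] pair_comp[OF t2 t3 W(1)] pair_comp[OF t1 t3 W(1)] W(2-4) by simp_all
  have mc: "Sub P m12 (delta P B) \<sqinter>\<^bsub>Fib P BBB\<^esub> Sub P m23 (delta P B) \<in> carrier (Fib P BBB)"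
    using greatest_closed[OF inf_semilattice_facts(4)[OF fib[OF t(1)] md(1,2)]] .
  have "Sub P w (Sub P m12 (delta P B) \<sqinter>\<^bsub>Fib P BBB\<^esub> Sub P m23 (delta P B))
      \<sqsubseteq>\<^bsub>Fib P A\<^esub> Sub P w (Sub P m13 (delta P B))"
    by (rule sub_mono[OF W(1) mc md(3) le])
  then have "\<top>\<^bsub>Fib P A\<^esub> \<sqsubseteq>\<^bsub>Fib P A\<^esub> Sub P (pair P f h) (delta P B)"
    using sub_meet[OF W(1) md(1,2)] sub_sub[OF W(1) m(1) d'] sub_sub[OF W(1) m(2) d'] sub_sub[OF W(1) m(3) d']
      mw e1 e2 top_meet[OF A top_in[OF A]] by simp
  then show ?thesis using top_le[OF A sub_in[OF pair_in[OF f h] d]] by blast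
qed

lemma ext_class_iff:
  assumes f: "f \<in> Hom P A B"
  shows "g \<in> ext_class P f \<longleftrightarrow> g \<in> Hom P A B \<and> Sub P (pair P f g) (delta P B) = \<top>\<^bsub>Fib P A\<^esub>"
proof -
  have fd: "Dom P f = A" "Cod P f = B" using f by (auto simp: Hom_def)
  have "g \<in> ext_class P f \<longleftrightarrow> g \<in> Hom P A B \<and>
      delta P A \<sqsubseteq>\<^bsub>Fib P (Prd P A A)\<^esub> Sub P (cross P g g) (delta P B) \<and>
      delta P A \<sqsubseteq>\<^bsub>Fib P (Prd P A A)\<^esub> Sub P (cross P f g) (delta P B)"
    by (auto simp: ext_class_def ext_arrow_def Hom_def fd)
  then show ?thesis using ext_le_iff[OF f] ext_le_iff[of g A B g] delta_refl[of g A B] by blast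
qed

lemma ext_class_disjoint:
  assumes f: "f \<in> Ar P" and g: "g \<in> Ar P" and h: "h \<in> ext_class P f" "h \<in> ext_class P g"
  shows "ext_class P f = ext_class P g"
proof -
  obtain A B where fH: "f \<in> Hom P A B" using f by (auto simp: Hom_def)
  have "Dom P g = Dom P h" "Cod P g = Cod P h" using h by (auto simp: ext_class_def)
  moreover have "h \<in> Hom P A B" using h ext_class_iff[OF fH] by blast
  ultimately have gH: "g \<in> Hom P A B" and hH: "h \<in> Hom P A B" using g by (auto simp: Hom_def)
  have fh: "Sub P (pair P f h) (delta P B) = \<top>\<^bsub>Fib P A\<^esub>" using h ext_class_iff[OF fH] by blast
  have gh: "Sub P (pair P g h) (delta P B) = \<top>\<^bsub>Fib P A\<^esub>" using h ext_class_iff[OF gH] by blast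
  have fg: "Sub P (pair P f g) (delta P B) = \<top>\<^bsub>Fib P A\<^esub>"
    by (rule delta_trans[OF fH hH gH fh delta_sym[OF gH hH gh]])
  have gf: "Sub P (pair P g f) (delta P B) = \<top>\<^bsub>Fib P A\<^esub>" by (rule delta_sym[OF fH gH fg])
  have "k \<in> ext_class P f \<longleftrightarrow> k \<in> ext_class P g" for k
    unfolding ext_class_iff[OF fH] ext_class_iff[OF gH]
    using delta_trans[OF fH gH _ fg] delta_trans[OF gH fH _ gf] by blast
  then show ?thesis by blast
qed

end

lemma class_naming_exists: "\<exists>q :: ('o, 'm, 'p) doctrine \<Rightarrow> 'm set \<Rightarrow> 'm. class_naming q"
proof -
  have "class_naming (\<lambda>(P :: ('o, 'm, 'p) doctrine) c. SOME f. f \<in> c)"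
    unfolding class_naming_def
  proof (intro allI impI inj_onI)
    fix P :: "('o, 'm, 'p) doctrine" and c d
    assume P: "elementary_doctrine P"
      and c: "c \<in> {ext_class P f | f. ext_arrow P f}" and d: "d \<in> {ext_class P f | f. ext_arrow P f}"
      and e: "(SOME f. f \<in> c) = (SOME f. f \<in> d)"
    obtain f g where f: "c = ext_class P f" "ext_arrow P f" and g: "d = ext_class P g" "ext_arrow P g"
      using c d by blast
    have "f \<in> c" "g \<in> d" using f g by (auto simp: ext_class_def ext_arrow_def)
    then have "(SOME f. f \<in> c) \<in> c" "(SOME f. f \<in> d) \<in> d" by (metis someI)+
    then show "c = d"
      using elementary_doctrine.ext_class_disjoint[OF P] f g e by (auto simp: ext_arrow_def)
  qed
  then show ?thesis by blast
qed

context
  fixes q :: "('o, 'm, 'p) doctrine \<Rightarrow> 'm set \<Rightarrow> 'm"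
begin

definition eqv :: "('o, 'm, 'p) doctrine \<Rightarrow> 'm \<Rightarrow> 'm" where
  "eqv P f = q P (ext_class P f)"

definition rep :: "('o, 'm, 'p) doctrine \<Rightarrow> 'm \<Rightarrow> 'm" where
  "rep P x = (SOME f. ext_arrow P f \<and> eqv P f = x)"

definition collapse :: "('o, 'm, 'p) doctrine \<Rightarrow> ('o, 'm, 'p) doctrine" where
  "collapse P = \<lparr>
     Ob = Ob P,
     Ar = {eqv P f | f. ext_arrow P f},
     Dom = (\<lambda>x. Dom P (rep P x)),
     Cod = (\<lambda>x. Cod P (rep P x)),
     Idn = (\<lambda>A. eqv P (Idn P A)),
     Comp = (\<lambda>y x. eqv P (rep P y \<cdot>\<^bsub>P\<^esub> rep P x)),
     Prd = Prd P,
     Pr1 = (\<lambda>A B. eqv P (Pr1 P A B)),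
     Pr2 = (\<lambda>A B. eqv P (Pr2 P A B)),
     Fib = Fib P,
     Sub = (\<lambda>x. Sub P (rep P x))\<rparr>"

definition collapse_mor :: "('o, 'm, 'p) doctrine_mor \<Rightarrow> ('o, 'm, 'p) doctrine_mor" where
  "collapse_mor M = \<lparr>
     MSrc = collapse (MSrc M), MTgt = collapse (MTgt M),
     MOb = MOb M,
     MAr = (\<lambda>x\<in>Ar (collapse (MSrc M)). eqv (MTgt M) (MAr M (rep (MSrc M) x))),
     MFib = MFib M\<rparr>"

definition collapse_cell :: "('o, 'm, 'p) doctrine_cell \<Rightarrow> ('o, 'm, 'p) doctrine_cell" where
  "collapse_cell \<theta> = \<lparr>
     CSrc = collapse_mor (CSrc \<theta>), CTgt = collapse_mor (CTgt \<theta>),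
     CMap = (\<lambda>A\<in>Ob (MSrc (CSrc \<theta>)). eqv (MTgt (CSrc \<theta>)) (CMap \<theta> A))\<rparr>"

definition Td :: "(('o, 'm, 'p) doctrine, ('o, 'm, 'p) doctrine_mor, ('o, 'm, 'p) doctrine_cell,
    ('o, 'm, 'p) doctrine, ('o, 'm, 'p) doctrine_mor, ('o, 'm, 'p) doctrine_cell) two_map" where
  "Td = \<lparr>Map0 = collapse, Map1 = collapse_mor, Map2 = collapse_cell\<rparr>"

definition Td_unit :: "('o, 'm, 'p) doctrine \<Rightarrow> ('o, 'm, 'p) doctrine_mor" where
  "Td_unit P = \<lparr>
     MSrc = P, MTgt = collapse P,
     MOb = (\<lambda>A\<in>Ob P. A),
     MAr = (\<lambda>f\<in>Ar P. eqv P f),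
     MFib = (\<lambda>A\<in>Ob P. \<lambda>\<alpha>\<in>carrier (Fib P A). \<alpha>)\<rparr>"

text \<open>On arrows, \<open>rep (collapse P)\<close> maps (the name of) \<open>[[f]]\<close> to (the name of) \<open>[f]\<close>.\<close>

definition Td_mult :: "('o, 'm, 'p) doctrine \<Rightarrow> ('o, 'm, 'p) doctrine_mor" where
  "Td_mult P = \<lparr>
     MSrc = collapse (collapse P), MTgt = collapse P,
     MOb = (\<lambda>A\<in>Ob P. A),
     MAr = (\<lambda>x\<in>Ar (collapse (collapse P)). rep (collapse P) x),
     MFib = (\<lambda>A\<in>Ob P. \<lambda>\<alpha>\<in>carrier (Fib P A). \<alpha>)\<rparr>"

end

end

theory Submission
  imports Defs
begin

text \<open>
The completion is strictly idempotent. Both \<open>T \<eta>\<close> and \<open>\<eta> T\<close> send \<open>[f]\<close> to \<open>[[f]]\<close>, and the multiplication is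
their inverse, since the collapse of a doctrine has comprehensive diagonals and collapsing it again
identifies no further arrows (\<open>idempotent_Td\<close>).

For such a 2-monad on any 2-category an algebra structure \<open>a\<close> on \<open>A\<close> is the same thing as an inverse of
the unit \<open>\<eta>\<close> at \<open>A\<close>: \<open>\<eta> a = (T a) (\<eta> T) = (T a) (T \<eta>) = T (a \<eta>) = 1\<close> (\<open>algebra_iff\<close>). Being an algebra is
therefore a property. The invertible 2-cell of a morphism of algebras is the identity, because its
unit law says so after whiskering with \<open>\<eta>\<close>, which is invertible (\<open>algebra_morphism_iff\<close>); and every 2-cell
of the base satisfies the condition on 2-cells of algebras, by naturality of \<open>\<eta>\<close>
(\<open>algebra_cell_condition\<close>). So the 2-category of algebras is isomorphic to the full sub-2-category of
the base on the 0-cells with invertible unit (\<open>Alg_equivalent_full_sub\<close>), from which it also inherits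
the axioms of a 2-category.

It remains to see that the unit \<open>f \<mapsto> [f]\<close> of a doctrine is invertible iff its diagonals are
comprehensive (\<open>is_iso_unit_iff\<close>). Call parallel arrows \<open>f\<close>, \<open>g\<close> internally equal if \<open>\<delta>\<close> reindexed along
\<open>(f, g)\<close> is the top element. The unit is invertible iff internally equal arrows are equal, and this is
what comprehensiveness of the diagonals says (\<open>comprehensive_diagonals_iff\<close>).

That the collapse is an elementary doctrine at all rests on one fact, \<open>int_eq_subst\<close>: internally equal
arrows may be substituted for each other in any context. It is the form of the second condition on
\<open>\<delta>\<close>, the one with a parameter \<open>X\<close>, that the collapse uses. It makes composition well defined on classes
and makes pairing unique on them, so that the collapse has products.
\<close>

section \<open>2-categories and 2-functors\<close>

lemma cat01_simps [simp]:
  "Ob (cat01 K) = Cell0 K" "Ar (cat01 K) = Cell1 K" "Dom (cat01 K) = Src1 K" "Cod (cat01 K) = Tgt1 K"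
  "Idn (cat01 K) = Id1 K" "Comp (cat01 K) = Comp1 K"
  by (simp_all add: cat01_def)

lemma cat12_simps [simp]:
  "Ob (cat12 K) = Cell1 K" "Ar (cat12 K) = Cell2 K" "Dom (cat12 K) = Src2 K" "Cod (cat12 K) = Tgt2 K"
  "Idn (cat12 K) = Id2 K" "Comp (cat12 K) = VComp K"
  by (simp_all add: cat12_def)

lemma cat02_simps [simp]:
  "Ob (cat02 K) = Cell0 K" "Ar (cat02 K) = Cell2 K" "Dom (cat02 K) \<alpha> = Src1 K (Src2 K \<alpha>)"
  "Cod (cat02 K) \<alpha> = Tgt1 K (Src2 K \<alpha>)" "Idn (cat02 K) A = Id2 K (Id1 K A)" "Comp (cat02 K) = HComp K"
  by (simp_all add: cat02_def)

context two_category
begin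

abbreviation hom1 :: "'a \<Rightarrow> 'a \<Rightarrow> 'b set" where "hom1 \<equiv> Hom (cat01 K)"
abbreviation hom2 :: "'b \<Rightarrow> 'b \<Rightarrow> 'c set" where "hom2 \<equiv> Hom (cat12 K)"

lemma hom1_iff: "f \<in> hom1 A B \<longleftrightarrow> f \<in> Cell1 K \<and> Src1 K f = A \<and> Tgt1 K f = B"
  by (simp add: Hom_def)

lemma hom2_iff: "\<alpha> \<in> hom2 f g \<longleftrightarrow> \<alpha> \<in> Cell2 K \<and> Src2 K \<alpha> = f \<and> Tgt2 K \<alpha> = g"
  by (simp add: Hom_def)

lemma hom1_ob: "f \<in> hom1 A B \<Longrightarrow> A \<in> Cell0 K" "f \<in> hom1 A B \<Longrightarrow> B \<in> Cell0 K"
  using category.Hom_ob[OF cat01] by force+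

lemma hom2_cell1: "\<alpha> \<in> hom2 f g \<Longrightarrow> f \<in> Cell1 K" "\<alpha> \<in> hom2 f g \<Longrightarrow> g \<in> Cell1 K"
  using category.Hom_ob[OF cat12] by force+

lemma comp1_in: "\<lbrakk>f \<in> hom1 A B; g \<in> hom1 B D\<rbrakk> \<Longrightarrow> g \<odot> f \<in> hom1 A D"
  using category.comp_in[OF cat01] by force

lemma comp1_assoc: "\<lbrakk>f \<in> hom1 A B; g \<in> hom1 B D; h \<in> hom1 D E\<rbrakk> \<Longrightarrow> (h \<odot> g) \<odot> f = h \<odot> (g \<odot> f)"
  using category.assoc_in[OF cat01] by force

lemma Id1_in: "A \<in> Cell0 K \<Longrightarrow> Id1 K A \<in> hom1 A A"
  using category.idn_hom[OF cat01] by force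

lemma comp1_Id1: "f \<in> hom1 A B \<Longrightarrow> f \<odot> Id1 K A = f" "f \<in> hom1 A B \<Longrightarrow> Id1 K B \<odot> f = f"
  using category.comp_idn[OF cat01, of f] category.idn_comp[OF cat01, of f] by (auto simp: hom1_iff)

lemma Id2_in: "f \<in> Cell1 K \<Longrightarrow> Id2 K f \<in> hom2 f f"
  using category.idn_hom[OF cat12] by force

lemma Id2_in1: "f \<in> hom1 A B \<Longrightarrow> Id2 K f \<in> hom2 f f"
  using Id2_in by (auto simp: hom1_iff)

lemma vcomp_in: "\<lbrakk>\<alpha> \<in> hom2 f g; \<beta> \<in> hom2 g h\<rbrakk> \<Longrightarrow> \<beta> \<bullet> \<alpha> \<in> hom2 f h"
  using category.comp_in[OF cat12] by force

lemma vcomp_Id2: "\<alpha> \<in> hom2 f g \<Longrightarrow> \<alpha> \<bullet> Id2 K f = \<alpha>" "\<alpha> \<in> hom2 f g \<Longrightarrow> Id2 K g \<bullet> \<alpha> = \<alpha>"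
  using category.comp_idn[OF cat12, of \<alpha>] category.idn_comp[OF cat12, of \<alpha>] by (auto simp: hom2_iff)

lemma hom2_hom1: "\<lbrakk>\<alpha> \<in> hom2 f g; f \<in> hom1 A B\<rbrakk> \<Longrightarrow> g \<in> hom1 A B"
  using globular[of \<alpha>] hom2_cell1[of \<alpha> f g] by (auto simp: hom1_iff hom2_iff)

lemma hcomp_in:
  "\<lbrakk>\<alpha> \<in> hom2 f g; \<beta> \<in> hom2 h k; f \<in> hom1 A B; h \<in> hom1 B D\<rbrakk> \<Longrightarrow> \<beta> \<star> \<alpha> \<in> hom2 (h \<odot> f) (k \<odot> g)"
  using hcomp_src_tgt[of \<alpha> \<beta>] category.comp_hom[OF cat02, of \<alpha> \<beta>]
  by (auto simp: hom1_iff hom2_iff Hom_def)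

lemma hcomp_assoc:
  "\<lbrakk>\<alpha> \<in> hom2 f f'; \<beta> \<in> hom2 g g'; \<gamma> \<in> hom2 h h'; f \<in> hom1 A B; g \<in> hom1 B D; h \<in> hom1 D E\<rbrakk>
    \<Longrightarrow> (\<gamma> \<star> \<beta>) \<star> \<alpha> = \<gamma> \<star> (\<beta> \<star> \<alpha>)"
  using category.comp_assoc[OF cat02, of \<alpha> \<beta> \<gamma>] by (auto simp: hom1_iff hom2_iff)

lemma hcomp_Id1:
  "\<lbrakk>\<alpha> \<in> hom2 f g; f \<in> hom1 A B\<rbrakk> \<Longrightarrow> \<alpha> \<star> Id2 K (Id1 K A) = \<alpha>"
  "\<lbrakk>\<alpha> \<in> hom2 f g; f \<in> hom1 A B\<rbrakk> \<Longrightarrow> Id2 K (Id1 K B) \<star> \<alpha> = \<alpha>"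
  using category.comp_idn[OF cat02, of \<alpha>] category.idn_comp[OF cat02, of \<alpha>]
  by (auto simp: hom1_iff hom2_iff)

lemma hcomp_Id2: "\<lbrakk>f \<in> hom1 A B; g \<in> hom1 B D\<rbrakk> \<Longrightarrow> Id2 K g \<star> Id2 K f = Id2 K (g \<odot> f)"
  using hcomp_id2 by (auto simp: hom1_iff)

lemma is_iso_hom1:
  "f \<in> hom1 A B \<Longrightarrow> is_iso (cat01 K) f \<longleftrightarrow> (\<exists>g \<in> hom1 B A. g \<odot> f = Id1 K A \<and> f \<odot> g = Id1 K B)"
  by (auto simp: is_iso_def hom1_iff)

lemma is_iso_Id1: "A \<in> Cell0 K \<Longrightarrow> is_iso (cat01 K) (Id1 K A)"
  using is_iso_hom1[OF Id1_in[of A]] Id1_in[of A] comp1_Id1(1)[OF Id1_in[of A]] by blast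

lemma is_iso_Id2: "f \<in> Cell1 K \<Longrightarrow> is_iso (cat12 K) (Id2 K f)"
  using Id2_in[of f] vcomp_Id2(1)[OF Id2_in[of f]] by (auto simp: is_iso_def hom2_iff)

end

lemma two_functorD:
  assumes F: "two_functor K L F"
  shows "A \<in> Cell0 K \<Longrightarrow> Map0 F A \<in> Cell0 L"
    and "f \<in> Hom (cat01 K) A B \<Longrightarrow> Map1 F f \<in> Hom (cat01 L) (Map0 F A) (Map0 F B)"
    and "A \<in> Cell0 K \<Longrightarrow> Map1 F (Id1 K A) = Id1 L (Map0 F A)"
    and "\<lbrakk>f \<in> Hom (cat01 K) A B; g \<in> Hom (cat01 K) B D\<rbrakk> \<Longrightarrow>
      Map1 F (g \<odot>\<^bsub>K\<^esub> f) = Map1 F g \<odot>\<^bsub>L\<^esub> Map1 F f"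
    and "\<alpha> \<in> Hom (cat12 K) f g \<Longrightarrow> Map2 F \<alpha> \<in> Hom (cat12 L) (Map1 F f) (Map1 F g)"
    and "f \<in> Cell1 K \<Longrightarrow> Map2 F (Id2 K f) = Id2 L (Map1 F f)"
    and "\<lbrakk>\<alpha> \<in> Hom (cat12 K) f g; \<beta> \<in> Hom (cat12 K) g h\<rbrakk> \<Longrightarrow>
      Map2 F (\<beta> \<bullet>\<^bsub>K\<^esub> \<alpha>) = Map2 F \<beta> \<bullet>\<^bsub>L\<^esub> Map2 F \<alpha>"
    and "\<lbrakk>\<alpha> \<in> Hom (cat12 K) f f'; \<beta> \<in> Hom (cat12 K) g g'; f \<in> Hom (cat01 K) A B; g \<in> Hom (cat01 K) B D\<rbrakk> \<Longrightarrow>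
      Map2 F (\<beta> \<star>\<^bsub>K\<^esub> \<alpha>) = Map2 F \<beta> \<star>\<^bsub>L\<^esub> Map2 F \<alpha>"
  using F by (auto simp: two_functor_def is_functor_def Hom_def)

section \<open>Isomorphic 2-categories are 2-equivalent\<close>

text \<open>Every axiom of a category is an equation or a typing statement between composites of arrows, so it
is carried along a structure-preserving bijection. That \<open>D\<close> is a category is a conclusion here.\<close>

lemma category_transport:
  assumes C: "category C" and F: "is_functor C D Fo Fa"
    and bo: "bij_betw Fo (Ob C) (Ob D)" and ba: "bij_betw Fa (Ar C) (Ar D)"
  shows "category D"
    and "is_functor D C (inv_into (Ob C) Fo) (inv_into (Ar C) Fa)"
proof -
  interpret category C by (rule C)
  have ob: "\<exists>B\<in>Ob C. A = Fo B" if "A \<in> Ob D" for A using bo that by (auto simp: bij_betw_def)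
  have ar: "\<exists>g\<in>Ar C. f = Fa g" if "f \<in> Ar D" for f using ba that by (auto simp: bij_betw_def)
  have Fo: "A \<in> Ob C \<Longrightarrow> Fo A \<in> Ob D" for A using F by (auto simp: is_functor_def)
  have Fa: "f \<in> Ar C \<Longrightarrow> Fa f \<in> Ar D \<and> Dom D (Fa f) = Fo (Dom C f) \<and> Cod D (Fa f) = Fo (Cod C f)" for f
    using F by (auto simp: is_functor_def Hom_def)
  have Fi: "A \<in> Ob C \<Longrightarrow> Idn D (Fo A) = Fa (Idn C A)" for A using F by (auto simp: is_functor_def)
  have eqo: "A \<in> Ob C \<Longrightarrow> B \<in> Ob C \<Longrightarrow> Fo A = Fo B \<longleftrightarrow> A = B" for A B
    using bo by (auto simp: bij_betw_def inj_on_def)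
  have Fc: "Fa g \<cdot>\<^bsub>D\<^esub> Fa f = Fa (g \<cdot>\<^bsub>C\<^esub> f)" if "f \<in> Ar C" "g \<in> Ar C" "Fo (Dom C g) = Fo (Cod C f)" for f g
    using F that eqo[OF dom_ob[OF that(2)] cod_ob[OF that(1)]] by (auto simp: is_functor_def)
  have comp: "g \<cdot>\<^bsub>C\<^esub> f \<in> Ar C \<and> Dom C (g \<cdot>\<^bsub>C\<^esub> f) = Dom C f \<and> Cod C (g \<cdot>\<^bsub>C\<^esub> f) = Cod C g"
    if "f \<in> Ar C" "g \<in> Ar C" "Fo (Dom C g) = Fo (Cod C f)" for f g
    using comp_hom[OF that(1,2)] eqo[OF dom_ob[OF that(2)] cod_ob[OF that(1)]] that by (simp add: Hom_def)
  have idn: "A \<in> Ob C \<Longrightarrow> Idn C A \<in> Ar C \<and> Dom C (Idn C A) = A \<and> Cod C (Idn C A) = A" for A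
    using idn_hom[of A] by (simp add: Hom_def)
  show "category D"
  proof
    show "Dom D f \<in> Ob D" "Cod D f \<in> Ob D" if "f \<in> Ar D" for f
      using ar[OF that] Fa Fo dom_ob cod_ob by auto
    show "Idn D A \<in> Hom D A A" if "A \<in> Ob D" for A
      using ob[OF that] Fi Fa idn by (auto simp: Hom_def)
    show "g \<cdot>\<^bsub>D\<^esub> f \<in> Hom D (Dom D f) (Cod D g)" if "f \<in> Ar D" "g \<in> Ar D" "Dom D g = Cod D f" for f g
      using ar[OF that(1)] ar[OF that(2)] that Fa Fc comp by (auto simp: Hom_def)
    show "f \<cdot>\<^bsub>D\<^esub> Idn D (Dom D f) = f" "Idn D (Cod D f) \<cdot>\<^bsub>D\<^esub> f = f" if "f \<in> Ar D" for f
      using ar[OF that] by (auto simp: Fa Fi Fc idn comp_idn idn_comp dom_ob cod_ob)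
    show "(h \<cdot>\<^bsub>D\<^esub> g) \<cdot>\<^bsub>D\<^esub> f = h \<cdot>\<^bsub>D\<^esub> (g \<cdot>\<^bsub>D\<^esub> f)"
      if c: "f \<in> Ar D" "g \<in> Ar D" "h \<in> Ar D" and s: "Dom D g = Cod D f" "Dom D h = Cod D g" for f g h
    proof -
      obtain f' g' h' where e: "f' \<in> Ar C" "g' \<in> Ar C" "h' \<in> Ar C" "f = Fa f'" "g = Fa g'" "h = Fa h'"
        using ar[OF c(1)] ar[OF c(2)] ar[OF c(3)] by blast
      then have d: "Fo (Dom C g') = Fo (Cod C f')" "Fo (Dom C h') = Fo (Cod C g')" using s Fa by auto
      then have "Dom C g' = Cod C f'" "Dom C h' = Cod C g'"
        using eqo e dom_ob cod_ob by blast+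
      then show ?thesis using e d comp by (simp add: Fc comp_assoc)
    qed
  qed
  have io: "A \<in> Ob C \<Longrightarrow> inv_into (Ob C) Fo (Fo A) = A" for A
    using bo by (simp add: bij_betw_def)
  have ia: "f \<in> Ar C \<Longrightarrow> inv_into (Ar C) Fa (Fa f) = f" for f
    using ba by (simp add: bij_betw_def)
  show "is_functor D C (inv_into (Ob C) Fo) (inv_into (Ar C) Fa)"
    unfolding is_functor_def
  proof (intro conjI ballI impI)
    show "inv_into (Ob C) Fo A \<in> Ob C" if "A \<in> Ob D" for A using ob[OF that] io by auto
    show "inv_into (Ar C) Fa f \<in> Hom C (inv_into (Ob C) Fo (Dom D f)) (inv_into (Ob C) Fo (Cod D f))"
      if "f \<in> Ar D" for f
      using ar[OF that] by (auto simp: Fa io ia dom_ob cod_ob Hom_def)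
    show "inv_into (Ar C) Fa (Idn D A) = Idn C (inv_into (Ob C) Fo A)" if "A \<in> Ob D" for A
      using ob[OF that] by (auto simp: io ia Fi idn)
    show "inv_into (Ar C) Fa (g \<cdot>\<^bsub>D\<^esub> f) = inv_into (Ar C) Fa g \<cdot>\<^bsub>C\<^esub> inv_into (Ar C) Fa f"
      if "f \<in> Ar D" "g \<in> Ar D" "Dom D g = Cod D f" for f g
      using ar[OF that(1)] ar[OF that(2)] that by (auto simp: Fa ia Fc comp)
  qed
qed

text \<open>A 2-functor that is bijective on cells of each dimension has an inverse, and the identity 1-cells are
then the two required 2-natural isomorphisms. Since \<open>K\<close> inherits the axioms of a 2-category from \<open>L\<close>,
the lemma spares a direct verification of these axioms for a 2-category of algebras.\<close>

lemma two_equivalent_if_iso: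
  assumes L: "two_category L" and G: "two_functor L K G"
    and b0: "bij_betw (Map0 G) (Cell0 L) (Cell0 K)" and b1: "bij_betw (Map1 G) (Cell1 L) (Cell1 K)"
    and b2: "bij_betw (Map2 G) (Cell2 L) (Cell2 K)"
  shows "two_equivalent K L"
proof -
  interpret L: two_category L by (rule L)
  define F where "F = \<lparr>Map0 = inv_into (Cell0 L) (Map0 G), Map1 = inv_into (Cell1 L) (Map1 G),
    Map2 = inv_into (Cell2 L) (Map2 G)\<rparr>"
  note G' = G[unfolded two_functor_def, THEN conjunct1] G[unfolded two_functor_def, THEN conjunct2, THEN conjunct1]
    G[unfolded two_functor_def, THEN conjunct2, THEN conjunct2]
  note t01 = category_transport[OF L.cat01 G'(1), simplified, OF b0 b1]
  note t12 = category_transport[OF L.cat12 G'(2), simplified, OF b1 b2]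
  note t02 = category_transport[OF L.cat02 G'(3), simplified, OF b0 b2]
  have F: "two_functor K L F"
    unfolding two_functor_def F_def using t01(2) t12(2) t02(2) by simp
  have eq0: "Map0 G A = Map0 G B \<longleftrightarrow> A = B" if "A \<in> Cell0 L" "B \<in> Cell0 L" for A B
    using b0 that by (auto simp: bij_betw_def inj_on_def)
  have eq1: "Map1 G A = Map1 G B \<longleftrightarrow> A = B" if "A \<in> Cell1 L" "B \<in> Cell1 L" for A B
    using b1 that by (auto simp: bij_betw_def inj_on_def)
  have ex1: "\<exists>g\<in>Cell1 L. f = Map1 G g" if "f \<in> Cell1 K" for f using b1 that by (auto simp: bij_betw_def)
  have ex2: "\<exists>g\<in>Cell2 L. f = Map2 G g" if "f \<in> Cell2 K" for f using b2 that by (auto simp: bij_betw_def)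
  have m1: "Map1 G f \<in> Cell1 K \<and> Src1 K (Map1 G f) = Map0 G (Src1 L f) \<and> Tgt1 K (Map1 G f) = Map0 G (Tgt1 L f)
     \<and> Src1 L f \<in> Cell0 L \<and> Tgt1 L f \<in> Cell0 L"
    if "f \<in> Cell1 L" for f
    using two_functorD(2)[OF G, of f "Src1 L f" "Tgt1 L f"] L.hom1_ob[of f "Src1 L f" "Tgt1 L f"] that
    by (simp add: Hom_def)
  have m2: "Map2 G f \<in> Cell2 K \<and> Src2 K (Map2 G f) = Map1 G (Src2 L f) \<and> Tgt2 K (Map2 G f) = Map1 G (Tgt2 L f)
     \<and> Src2 L f \<in> Cell1 L \<and> Tgt2 L f \<in> Cell1 L"
    if "f \<in> Cell2 L" for f
    using two_functorD(5)[OF G, of f "Src2 L f" "Tgt2 L f"] L.hom2_cell1[of f "Src2 L f" "Tgt2 L f"] that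
    by (simp add: Hom_def)
  have c1: "Map1 G g \<odot>\<^bsub>K\<^esub> Map1 G f = Map1 G (g \<odot>\<^bsub>L\<^esub> f) \<and> g \<odot>\<^bsub>L\<^esub> f \<in> Cell1 L"
    if "f \<in> Cell1 L" "g \<in> Cell1 L" "Src1 L g = Tgt1 L f" for f g
    using two_functorD(4)[OF G, of f _ _ g] L.comp1_in[of f "Src1 L f" "Tgt1 L f" g] that by (simp add: Hom_def)
  have cv: "Map2 G g \<bullet>\<^bsub>K\<^esub> Map2 G f = Map2 G (g \<bullet>\<^bsub>L\<^esub> f) \<and> g \<bullet>\<^bsub>L\<^esub> f \<in> Cell2 L \<and> Src2 L (g \<bullet>\<^bsub>L\<^esub> f) = Src2 L f
      \<and> Tgt2 L (g \<bullet>\<^bsub>L\<^esub> f) = Tgt2 L g"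
    if "f \<in> Cell2 L" "g \<in> Cell2 L" "Src2 L g = Tgt2 L f" for f g
    using two_functorD(7)[OF G, of f _ _ g] L.vcomp_in[of f "Src2 L f" "Tgt2 L f" g] that by (simp add: Hom_def)
  have ch: "Map2 G g \<star>\<^bsub>K\<^esub> Map2 G f = Map2 G (g \<star>\<^bsub>L\<^esub> f) \<and> g \<star>\<^bsub>L\<^esub> f \<in> Cell2 L
      \<and> Src2 L (g \<star>\<^bsub>L\<^esub> f) = Src2 L g \<odot>\<^bsub>L\<^esub> Src2 L f \<and> Tgt2 L (g \<star>\<^bsub>L\<^esub> f) = Tgt2 L g \<odot>\<^bsub>L\<^esub> Tgt2 L f"
    if "f \<in> Cell2 L" "g \<in> Cell2 L" "Src1 L (Src2 L g) = Tgt1 L (Src2 L f)" for f g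
    using two_functorD(8)[OF G, of f "Src2 L f" _ g] L.hcomp_in[of f "Src2 L f" "Tgt2 L f" g] that m2[of f] m2[of g]
    by (simp add: Hom_def)
  have i2: "Id2 K (Map1 G f) = Map2 G (Id2 L f)" if "f \<in> Cell1 L" for f
    using two_functorD(6)[OF G that] by simp
  have gl: "Src1 L (Src2 L f) = Src1 L (Tgt2 L f) \<and> Tgt1 L (Src2 L f) = Tgt1 L (Tgt2 L f)" if "f \<in> Cell2 L" for f
    by (rule L.globular[OF that])
  have id2: "Id2 L f \<in> Cell2 L \<and> Src2 L (Id2 L f) = f \<and> Tgt2 L (Id2 L f) = f" if "f \<in> Cell1 L" for f
    using L.Id2_in[OF that] by (simp add: Hom_def)
  have K: "two_category K"
  proof (rule two_category.intro)
    show "category (cat01 K)" "category (cat12 K)" "category (cat02 K)" by (rule t01(1) t12(1) t02(1))+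
    show "Src1 K (Src2 K \<alpha>) = Src1 K (Tgt2 K \<alpha>) \<and> Tgt1 K (Src2 K \<alpha>) = Tgt1 K (Tgt2 K \<alpha>)"
      if "\<alpha> \<in> Cell2 K" for \<alpha> using ex2[OF that] by (auto simp: m1 m2 gl)
    show "Src2 K (\<beta> \<star>\<^bsub>K\<^esub> \<alpha>) = Src2 K \<beta> \<odot>\<^bsub>K\<^esub> Src2 K \<alpha> \<and> Tgt2 K (\<beta> \<star>\<^bsub>K\<^esub> \<alpha>) = Tgt2 K \<beta> \<odot>\<^bsub>K\<^esub> Tgt2 K \<alpha>"
      if "\<alpha> \<in> Cell2 K" "\<beta> \<in> Cell2 K" "Src1 K (Src2 K \<beta>) = Tgt1 K (Src2 K \<alpha>)" for \<alpha> \<beta>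
      using ex2[OF that(1)] ex2[OF that(2)] that(3) by (auto simp: m1 m2 gl eq0 ch c1)
    show "Id2 K g \<star>\<^bsub>K\<^esub> Id2 K f = Id2 K (g \<odot>\<^bsub>K\<^esub> f)" if "f \<in> Cell1 K" "g \<in> Cell1 K" "Src1 K g = Tgt1 K f" for f g
      using ex1[OF that(1)] ex1[OF that(2)] that(3) by (auto simp: m1 m2 i2 eq0 id2 ch c1 L.hcomp_id2)
    show "(\<beta>' \<bullet>\<^bsub>K\<^esub> \<beta>) \<star>\<^bsub>K\<^esub> (\<alpha>' \<bullet>\<^bsub>K\<^esub> \<alpha>) = (\<beta>' \<star>\<^bsub>K\<^esub> \<alpha>') \<bullet>\<^bsub>K\<^esub> (\<beta> \<star>\<^bsub>K\<^esub> \<alpha>)"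
      if c: "\<alpha> \<in> Cell2 K" "\<alpha>' \<in> Cell2 K" "\<beta> \<in> Cell2 K" "\<beta>' \<in> Cell2 K"
        and s: "Src2 K \<alpha>' = Tgt2 K \<alpha>" "Src2 K \<beta>' = Tgt2 K \<beta>" "Src1 K (Src2 K \<beta>) = Tgt1 K (Src2 K \<alpha>)" for \<alpha> \<alpha>' \<beta> \<beta>'
    proof -
      obtain a a' b b' where e: "a \<in> Cell2 L" "a' \<in> Cell2 L" "b \<in> Cell2 L" "b' \<in> Cell2 L"
        "\<alpha> = Map2 G a" "\<alpha>' = Map2 G a'" "\<beta> = Map2 G b" "\<beta>' = Map2 G b'" using ex2 c by meson
      have s': "Src2 L a' = Tgt2 L a" "Src2 L b' = Tgt2 L b" "Src1 L (Src2 L b) = Tgt1 L (Src2 L a)"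
        using s e by (auto simp: m1 m2 eq0 eq1)
      have s'': "Src1 L (Tgt2 L b) = Tgt1 L (Tgt2 L a)" using s'(3) gl e(1,3) by simp
      show ?thesis using s' s'' e(1-4) unfolding e(5-8) by (simp add: cv ch L.interchange)
    qed
  qed
  interpret K: two_category K by (rule K)
  have GF: "Map0 G (Map0 F A) = A" if "A \<in> Cell0 K" for A
    using b0 that by (simp add: F_def bij_betw_def f_inv_into_f)
  have GF1: "Map1 G (Map1 F A) = A" if "A \<in> Cell1 K" for A
    using b1 that by (simp add: F_def bij_betw_def f_inv_into_f)
  have GF2: "Map2 G (Map2 F A) = A" if "A \<in> Cell2 K" for A
    using b2 that by (simp add: F_def bij_betw_def f_inv_into_f)
  have FG: "Map0 F (Map0 G A) = A" if "A \<in> Cell0 L" for A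
    using b0 that by (simp add: F_def bij_betw_def)
  have FG1: "Map1 F (Map1 G A) = A" if "A \<in> Cell1 L" for A
    using b1 that by (simp add: F_def bij_betw_def)
  have FG2: "Map2 F (Map2 G A) = A" if "A \<in> Cell2 L" for A
    using b2 that by (simp add: F_def bij_betw_def)
  have nat: "two_natural_iso J J M N (Id1 J)"
    if J: "two_category J" and eq: "\<And>A. A \<in> Cell0 J \<Longrightarrow> Map0 M A = A \<and> Map0 N A = A"
      "\<And>f. f \<in> Cell1 J \<Longrightarrow> Map1 M f = f \<and> Map1 N f = f"  "\<And>f. f \<in> Cell2 J \<Longrightarrow> Map2 M f = f \<and> Map2 N f = f"
    for J :: "('s, 't, 'u) two_cat" and M N
  proof -
    interpret two_category J by (rule J)
    have "Map1 N f \<odot>\<^bsub>J\<^esub> Id1 J (Src1 J f) = Id1 J (Tgt1 J f) \<odot>\<^bsub>J\<^esub> Map1 M f" if "f \<in> Cell1 J" for f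
      using eq(2)[OF that] that comp1_Id1[of f] by (simp add: hom1_iff)
    moreover have "Map2 N \<alpha> \<star>\<^bsub>J\<^esub> Id2 J (Id1 J (Src1 J (Src2 J \<alpha>))) =
        Id2 J (Id1 J (Tgt1 J (Src2 J \<alpha>))) \<star>\<^bsub>J\<^esub> Map2 M \<alpha>" if "\<alpha> \<in> Cell2 J" for \<alpha>
      using eq(3)[OF that] that hcomp_Id1[of \<alpha> "Src2 J \<alpha>" "Tgt2 J \<alpha>"] hom2_cell1[of \<alpha>]
      by (simp add: hom1_iff hom2_iff)
    ultimately show ?thesis
      unfolding two_natural_iso_def two_natural_def using eq(1) Id1_in is_iso_Id1 by simp
  qed
  have "two_natural_iso K K id_map (comp_map G F) (Id1 K)"
    by (rule nat[OF K]) (simp_all add: id_map_def comp_map_def GF GF1 GF2)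
  moreover have "two_natural_iso L L (comp_map F G) id_map (Id1 L)"
    by (rule nat[OF L]) (simp_all add: id_map_def comp_map_def FG FG1 FG2)
  ultimately show ?thesis unfolding two_equivalent_def using K L F G by blast
qed

section \<open>Full sub-2-categories\<close>

definition full_sub :: "('a, 'b, 'c) two_cat \<Rightarrow> ('a \<Rightarrow> bool) \<Rightarrow> ('a, 'b, 'c) two_cat" where
  "full_sub K S = K\<lparr>
     Cell0 := {A \<in> Cell0 K. S A},
     Cell1 := {f \<in> Cell1 K. S (Src1 K f) \<and> S (Tgt1 K f)},
     Cell2 := {\<alpha> \<in> Cell2 K. S (Src1 K (Src2 K \<alpha>)) \<and> S (Tgt1 K (Src2 K \<alpha>))}\<rparr>"

lemma full_sub_simps [simp]:
  "Cell0 (full_sub K S) = {A \<in> Cell0 K. S A}"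
  "Cell1 (full_sub K S) = {f \<in> Cell1 K. S (Src1 K f) \<and> S (Tgt1 K f)}"
  "Cell2 (full_sub K S) = {\<alpha> \<in> Cell2 K. S (Src1 K (Src2 K \<alpha>)) \<and> S (Tgt1 K (Src2 K \<alpha>))}"
  "Src1 (full_sub K S) = Src1 K" "Tgt1 (full_sub K S) = Tgt1 K"
  "Src2 (full_sub K S) = Src2 K" "Tgt2 (full_sub K S) = Tgt2 K"
  "Id1 (full_sub K S) = Id1 K" "Id2 (full_sub K S) = Id2 K"
  "Comp1 (full_sub K S) = Comp1 K" "VComp (full_sub K S) = VComp K" "HComp (full_sub K S) = HComp K"
  by (simp_all add: full_sub_def)

lemma full_sub_cong:
  assumes "two_category K" and "\<And>A. A \<in> Cell0 K \<Longrightarrow> S A \<longleftrightarrow> S' A"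
  shows "full_sub K S = full_sub K S'"
proof -
  interpret two_category K by (rule assms(1))
  have 1: "S (Src1 K f) \<longleftrightarrow> S' (Src1 K f)" "S (Tgt1 K f) \<longleftrightarrow> S' (Tgt1 K f)" if "f \<in> Cell1 K" for f
    using assms(2) hom1_ob[of f "Src1 K f" "Tgt1 K f"] that by (auto simp: hom1_iff)
  have "Src2 K \<alpha> \<in> Cell1 K" if "\<alpha> \<in> Cell2 K" for \<alpha>
    using hom2_cell1(1)[of \<alpha>] that by (simp add: hom2_iff)
  then show ?thesis
    unfolding full_sub_def using 1 assms(2) by (auto intro!: two_cat.fold_congs)
qed

context two_category
begin

lemma two_category_full_sub: "two_category (full_sub K S)"
proof (rule two_category.intro)
  have s1: "Src1 K f \<in> Cell0 K" "Tgt1 K f \<in> Cell0 K" if "f \<in> Cell1 K" for f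
    using hom1_ob[of f "Src1 K f" "Tgt1 K f"] that by (auto simp: hom1_iff)
  have s2: "Src2 K \<alpha> \<in> Cell1 K" "Tgt2 K \<alpha> \<in> Cell1 K" if "\<alpha> \<in> Cell2 K" for \<alpha>
    using hom2_cell1[of \<alpha> "Src2 K \<alpha>" "Tgt2 K \<alpha>"] that by (auto simp: hom2_iff)
  have i1: "Id1 K A \<in> Cell1 K \<and> Src1 K (Id1 K A) = A \<and> Tgt1 K (Id1 K A) = A" if "A \<in> Cell0 K" for A
    using Id1_in[OF that] by (simp add: hom1_iff)
  have i2: "Id2 K A \<in> Cell2 K \<and> Src2 K (Id2 K A) = A \<and> Tgt2 K (Id2 K A) = A" if "A \<in> Cell1 K" for A
    using Id2_in[OF that] by (simp add: hom2_iff)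
  have c1: "g \<odot> f \<in> Cell1 K \<and> Src1 K (g \<odot> f) = Src1 K f \<and> Tgt1 K (g \<odot> f) = Tgt1 K g"
    if "f \<in> Cell1 K" "g \<in> Cell1 K" "Src1 K g = Tgt1 K f" for f g
    using comp1_in[of f "Src1 K f" "Tgt1 K f" g] that by (simp add: hom1_iff)
  have cv: "g \<bullet> f \<in> Cell2 K \<and> Src2 K (g \<bullet> f) = Src2 K f \<and> Tgt2 K (g \<bullet> f) = Tgt2 K g"
    if "f \<in> Cell2 K" "g \<in> Cell2 K" "Src2 K g = Tgt2 K f" for f g
    using vcomp_in[of f "Src2 K f" "Tgt2 K f" g] that by (simp add: hom2_iff)
  have ch: "g \<star> f \<in> Cell2 K \<and> Src2 K (g \<star> f) = Src2 K g \<odot> Src2 K f \<and> Tgt2 K (g \<star> f) = Tgt2 K g \<odot> Tgt2 K f"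
    if "f \<in> Cell2 K" "g \<in> Cell2 K" "Src1 K (Src2 K g) = Tgt1 K (Src2 K f)" for f g
    using hcomp_in[of f "Src2 K f" "Tgt2 K f" g] that s2 by (simp add: hom1_iff hom2_iff)
  note c01 = category.comp_idn[OF cat01] category.idn_comp[OF cat01] category.comp_assoc[OF cat01]
  note c12 = category.comp_idn[OF cat12] category.idn_comp[OF cat12] category.comp_assoc[OF cat12]
  note c02 = category.comp_idn[OF cat02] category.idn_comp[OF cat02] category.comp_assoc[OF cat02]
  show "category (cat01 (full_sub K S))"
    by (rule category.intro) (use c01 in \<open>auto simp: Hom_def s1 i1 c1\<close>)
  show "category (cat12 (full_sub K S))"
    by (rule category.intro) (use c12 in \<open>auto simp: Hom_def s2 i2 cv globular\<close>)
  show "category (cat02 (full_sub K S))"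
    by (rule category.intro) (use c02 in \<open>auto simp: Hom_def s1 s2 i1 i2 c1 ch\<close>)
qed (use globular hcomp_src_tgt hcomp_id2 interchange in auto)

end

section \<open>Algebras of strictly idempotent 2-monads\<close>

text \<open>The usual notion of an idempotent 2-monad asks for \<open>\<mu>\<close> to be invertible. The conditions below are an
equivalent form in terms of the unit: the two ways to include \<open>T A\<close> in \<open>T (T A)\<close>, namely \<open>T \<eta>\<close> and \<open>\<eta> T\<close>,
agree, and \<open>\<mu>\<close> is their inverse. They mention naturality for \<open>\<eta>\<close> only; that of \<open>\<mu>\<close> and the monad laws
follow.\<close>

locale idempotent_two_monad = two_category K
  for K :: "('a, 'b, 'c) two_cat"  (structure) +
  fixes T :: "('a, 'b, 'c, 'a, 'b, 'c) two_map" and \<mu> \<eta> :: "'a \<Rightarrow> 'b"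
  assumes T_functor: "two_functor K K T"
    and unit_natural: "two_natural K K id_map T \<eta>"
    and T_unit: "A \<in> Cell0 K \<Longrightarrow> Map1 T (\<eta> A) = \<eta> (Map0 T A)"
    and mult_in: "A \<in> Cell0 K \<Longrightarrow> \<mu> A \<in> Hom (cat01 K) (Map0 T (Map0 T A)) (Map0 T A)"
    and mult_unit: "A \<in> Cell0 K \<Longrightarrow> \<mu> A \<odot> \<eta> (Map0 T A) = Id1 K (Map0 T A)"
    and unit_mult: "A \<in> Cell0 K \<Longrightarrow> \<eta> (Map0 T A) \<odot> \<mu> A = Id1 K (Map0 T (Map0 T A))"
begin

lemmas T_in0 = two_functorD(1)[OF T_functor] and T_in1 = two_functorD(2)[OF T_functor]
  and T_Id1 = two_functorD(3)[OF T_functor] and T_comp = two_functorD(4)[OF T_functor]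
  and T_in2 = two_functorD(5)[OF T_functor] and T_Id2 = two_functorD(6)[OF T_functor]

lemma unit_in: "A \<in> Cell0 K \<Longrightarrow> \<eta> A \<in> hom1 A (Map0 T A)"
  using unit_natural by (simp add: two_natural_def id_map_def)

lemma unit_nat1: "f \<in> hom1 A B \<Longrightarrow> Map1 T f \<odot> \<eta> A = \<eta> B \<odot> f"
  using unit_natural by (auto simp: two_natural_def id_map_def hom1_iff)

lemma unit_nat2:
  "\<lbrakk>\<alpha> \<in> hom2 f g; f \<in> hom1 A B\<rbrakk> \<Longrightarrow> Map2 T \<alpha> \<star> Id2 K (\<eta> A) = Id2 K (\<eta> B) \<star> \<alpha>"
  using unit_natural by (auto simp: two_natural_def id_map_def hom1_iff hom2_iff)

text \<open>The components of \<open>\<mu>\<close> are inverse to those of the 2-natural transformation \<open>\<eta> T\<close>.\<close>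

lemma mult_natural: "two_natural K K (comp_map T T) T \<mu>"
  unfolding two_natural_def comp_map_def
proof (intro conjI ballI; simp)
  show "\<mu> A \<in> hom1 (Map0 T (Map0 T A)) (Map0 T A)" if "A \<in> Cell0 K" for A
    by (rule mult_in[OF that])
  fix f assume "f \<in> Cell1 K"
  then obtain A B where f: "f \<in> hom1 A B" by (auto simp: hom1_iff)
  note o = hom1_ob[OF f]
  note Tf = T_in1[OF f] and TTf = T_in1[OF T_in1[OF f]]
  note m = mult_in[OF o(1)] mult_in[OF o(2)] and e = unit_in[OF T_in0[OF o(1)]] unit_in[OF T_in0[OF o(2)]]
  \<comment> \<open>Both sides equal \<open>\<mu> \<odot> \<eta> \<odot> T f \<odot> \<mu>\<close>, the left one by \<open>\<mu> \<odot> \<eta> = 1\<close>, the right one by naturality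
    of \<open>\<eta>\<close> and \<open>\<eta> \<odot> \<mu> = 1\<close>.\<close>
  have "Map1 T f \<odot> \<mu> A = (\<mu> B \<odot> \<eta> (Map0 T B)) \<odot> (Map1 T f \<odot> \<mu> A)"
    using comp1_Id1(2)[OF comp1_in[OF m(1) Tf]] mult_unit[OF o(2)] by simp
  also have "\<dots> = \<mu> B \<odot> ((\<eta> (Map0 T B) \<odot> Map1 T f) \<odot> \<mu> A)"
    using comp1_assoc[OF comp1_in[OF m(1) Tf] e(2) m(2)] comp1_assoc[OF m(1) Tf e(2)] by simp
  also have "\<eta> (Map0 T B) \<odot> Map1 T f = Map1 T (Map1 T f) \<odot> \<eta> (Map0 T A)"
    using unit_nat1[OF Tf] by simp
  also have "(Map1 T (Map1 T f) \<odot> \<eta> (Map0 T A)) \<odot> \<mu> A = Map1 T (Map1 T f)"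
    using comp1_assoc[OF m(1) e(1) TTf] unit_mult[OF o(1)] comp1_Id1(1)[OF TTf] by simp
  finally show "Map1 T f \<odot> \<mu> (Src1 K f) = \<mu> (Tgt1 K f) \<odot> Map1 T (Map1 T f)"
    using f by (simp add: hom1_iff)
next
  fix \<alpha> assume "\<alpha> \<in> Cell2 K"
  then obtain f g A B where \<alpha>: "\<alpha> \<in> hom2 f g" and f: "f \<in> hom1 A B"
    using hom2_cell1 by (auto simp: hom1_iff hom2_iff)
  note o = hom1_ob[OF f]
  note Tf = T_in1[OF f] and TTf = T_in1[OF T_in1[OF f]]
  note Ta = T_in2[OF \<alpha>] and TTa = T_in2[OF T_in2[OF \<alpha>]]
  note m = mult_in[OF o(1)] mult_in[OF o(2)] and e = unit_in[OF T_in0[OF o(1)]] unit_in[OF T_in0[OF o(2)]]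
  note im = m[THEN Id2_in1] and ie = e[THEN Id2_in1]
  have "Map2 T \<alpha> \<star> Id2 K (\<mu> A) = Id2 K (\<mu> B \<odot> \<eta> (Map0 T B)) \<star> (Map2 T \<alpha> \<star> Id2 K (\<mu> A))"
    using hcomp_Id1(2)[OF hcomp_in[OF im(1) Ta m(1) Tf] comp1_in[OF m(1) Tf]] mult_unit[OF o(2)] by simp
  also have "\<dots> = (Id2 K (\<mu> B) \<star> Id2 K (\<eta> (Map0 T B))) \<star> (Map2 T \<alpha> \<star> Id2 K (\<mu> A))"
    using hcomp_Id2[OF e(2) m(2)] by simp
  also have "\<dots> = Id2 K (\<mu> B) \<star> ((Id2 K (\<eta> (Map0 T B)) \<star> Map2 T \<alpha>) \<star> Id2 K (\<mu> A))"
    using hcomp_assoc[OF hcomp_in[OF im(1) Ta m(1) Tf] ie(2) im(2) comp1_in[OF m(1) Tf] e(2) m(2)]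
      hcomp_assoc[OF im(1) Ta ie(2) m(1) Tf e(2)] by simp
  also have "Id2 K (\<eta> (Map0 T B)) \<star> Map2 T \<alpha> = Map2 T (Map2 T \<alpha>) \<star> Id2 K (\<eta> (Map0 T A))"
    using unit_nat2[OF Ta Tf] by simp
  also have "(Map2 T (Map2 T \<alpha>) \<star> Id2 K (\<eta> (Map0 T A))) \<star> Id2 K (\<mu> A) = Map2 T (Map2 T \<alpha>)"
    using hcomp_assoc[OF im(1) ie(1) TTa m(1) e(1) TTf] hcomp_Id2[OF m(1) e(1)] unit_mult[OF o(1)]
      hcomp_Id1(1)[OF TTa TTf] by simp
  finally show "Map2 T \<alpha> \<star> Id2 K (\<mu> (Src1 K (Src2 K \<alpha>))) =
      Id2 K (\<mu> (Tgt1 K (Src2 K \<alpha>))) \<star> Map2 T (Map2 T \<alpha>)"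
    using f \<alpha> by (simp add: hom1_iff hom2_iff)
qed

text \<open>\<open>T a\<close> is a retraction of \<open>T \<eta>\<close>, which is \<open>\<eta> T\<close> and has the inverse \<open>\<mu>\<close>; so \<open>T a\<close> is this inverse. It makes
the associativity law of an algebra a consequence of its unit law.\<close>

lemma T_retraction_eq_mult:
  assumes A: "A \<in> Cell0 K" and a: "a \<in> hom1 (Map0 T A) A" and ae: "a \<odot> \<eta> A = Id1 K A"
  shows "Map1 T a = \<mu> A"
proof -
  note TA = T_in0[OF A]
  note Ta = T_in1[OF a] and e = unit_in[OF TA] and m = mult_in[OF A]
  have "Map1 T a = Map1 T a \<odot> (\<eta> (Map0 T A) \<odot> \<mu> A)"
    using unit_mult[OF A] comp1_Id1(1)[OF Ta] by simp
  also have "\<dots> = (Map1 T a \<odot> Map1 T (\<eta> A)) \<odot> \<mu> A"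
    using comp1_assoc[OF m e Ta] T_unit[OF A] by simp
  also have "Map1 T a \<odot> Map1 T (\<eta> A) = Id1 K (Map0 T A)"
    using T_comp[OF unit_in[OF A] a] ae T_Id1[OF A] by simp
  finally show ?thesis using comp1_Id1(2)[OF m] by simp
qed

lemma two_monad: "two_monad K T \<mu> \<eta>"
proof -
  have "\<mu> A \<odot> Map1 T (\<mu> A) = \<mu> A \<odot> \<mu> (Map0 T A)" if A: "A \<in> Cell0 K" for A
    using T_retraction_eq_mult[OF T_in0[OF A] mult_in[OF A] mult_unit[OF A]] by simp
  then show ?thesis
    unfolding two_monad_def using two_category_axioms T_functor mult_natural unit_natural mult_unit T_unit by simp
qed

text \<open>An algebra structure is a two-sided inverse of the unit: \<open>\<eta> a = (T a) (\<eta> T) = \<mu> (\<eta> T) = 1\<close> by naturality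
of \<open>\<eta>\<close> and the preceding lemma. Being an algebra is thus a property of \<open>A\<close>.\<close>

lemma algebra_iff:
  "algebra K T \<mu> \<eta> (A, a) \<longleftrightarrow> A \<in> Cell0 K \<and> a \<in> hom1 (Map0 T A) A \<and>
     a \<odot> \<eta> A = Id1 K A \<and> \<eta> A \<odot> a = Id1 K (Map0 T A)"
proof -
  have "\<eta> A \<odot> a = Id1 K (Map0 T A)"
    if A: "A \<in> Cell0 K" and a: "a \<in> hom1 (Map0 T A) A" and ae: "a \<odot> \<eta> A = Id1 K A"
    using unit_nat1[OF a] T_retraction_eq_mult[OF A a ae] mult_unit[OF A] by simp
  then show ?thesis unfolding algebra_def using T_retraction_eq_mult by auto
qed

lemma algebra_ex_iff:
  assumes A: "A \<in> Cell0 K"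
  shows "(\<exists>a. algebra K T \<mu> \<eta> (A, a)) \<longleftrightarrow> is_iso (cat01 K) (\<eta> A)"
  unfolding is_iso_hom1[OF unit_in[OF A]] algebra_iff using A by blast

lemma algebra_unique:
  assumes "algebra K T \<mu> \<eta> (A, a)" and "algebra K T \<mu> \<eta> (A, b)"
  shows "a = b"
proof -
  note a = assms(1)[unfolded algebra_iff] and b = assms(2)[unfolded algebra_iff]
  have "a = a \<odot> (\<eta> A \<odot> b)" using a b comp1_Id1(1)[of a "Map0 T A" A] by simp
  also have "\<dots> = (a \<odot> \<eta> A) \<odot> b"
    using a b comp1_assoc[of b "Map0 T A" A "\<eta> A" "Map0 T A" a A] unit_in[of A] by simp
  also have "\<dots> = b" using a b comp1_Id1(2)[of b "Map0 T A" A] by simp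
  finally show ?thesis .
qed

text \<open>Every 1-cell between algebras commutes with the structures strictly, because it commutes with the
units, whose inverses the structures are.\<close>

lemma algebra_square:
  assumes a: "algebra K T \<mu> \<eta> (A, a)" and b: "algebra K T \<mu> \<eta> (B, b)" and f: "f \<in> hom1 A B"
  shows "b \<odot> Map1 T f = f \<odot> a"
proof -
  note a = a[unfolded algebra_iff] and b = b[unfolded algebra_iff]
  have A: "A \<in> Cell0 K" and B: "B \<in> Cell0 K" and ah: "a \<in> hom1 (Map0 T A) A" and bh: "b \<in> hom1 (Map0 T B) B"
    using a b by auto
  note Tf = T_in1[OF f] and e = unit_in[OF A] unit_in[OF B]
  have "b \<odot> Map1 T f = (b \<odot> Map1 T f) \<odot> (\<eta> A \<odot> a)"
    using comp1_Id1(1)[OF comp1_in[OF Tf bh]] a by simp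
  also have "\<dots> = b \<odot> ((Map1 T f \<odot> \<eta> A) \<odot> a)"
    using comp1_assoc[OF comp1_in[OF ah e(1)] Tf bh] comp1_assoc[OF ah e(1) Tf] by simp
  also have "\<dots> = (b \<odot> \<eta> B) \<odot> (f \<odot> a)"
    using comp1_assoc[OF ah f e(2)] comp1_assoc[OF comp1_in[OF ah f] e(2) bh] unit_nat1[OF f] by simp
  also have "\<dots> = f \<odot> a" using b comp1_Id1(2)[OF comp1_in[OF ah f]] by simp
  finally show ?thesis .
qed

text \<open>The unit law \<open>\<phi> \<eta> = id\<close> determines \<open>\<phi> = \<phi> \<eta> a\<close>, as \<open>\<eta> a = 1\<close>. So the 2-cell of a morphism of algebras
is the identity of \<open>f a = b (T f)\<close>, and it satisfies the multiplication law.\<close>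

lemma algebra_morphism_iff:
  assumes a: "algebra K T \<mu> \<eta> (A, a)" and b: "algebra K T \<mu> \<eta> (B, b)"
  shows "algebra_morphism K T \<mu> \<eta> \<lparr>AmSrc = (A, a), AmTgt = (B, b), AmMap = f, AmCell = \<phi>\<rparr> \<longleftrightarrow>
    f \<in> hom1 A B \<and> \<phi> = Id2 K (f \<odot> a)"
proof -
  note a' = a[unfolded algebra_iff] and b' = b[unfolded algebra_iff]
  have A: "A \<in> Cell0 K" and B: "B \<in> Cell0 K" and ah: "a \<in> hom1 (Map0 T A) A" and bh: "b \<in> hom1 (Map0 T B) B"
    using a' b' by auto
  note e = unit_in[OF A] and m = mult_in[OF A]
  have Ta: "Map1 T a = \<mu> A" using T_retraction_eq_mult[OF A ah] a' by blast
  show ?thesis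
  proof (cases "f \<in> hom1 A B")
    case f: True
    note Tf = T_in1[OF f] and fa = comp1_in[OF ah f] and sq = algebra_square[OF a b f]
    have "\<phi> = Id2 K (f \<odot> a)" if \<phi>: "\<phi> \<in> hom2 (f \<odot> a) (f \<odot> a)" and "\<phi> \<star> Id2 K (\<eta> A) = Id2 K f"
    proof -
      have "\<phi> = \<phi> \<star> (Id2 K (\<eta> A) \<star> Id2 K a)"
        using hcomp_Id1(1)[OF \<phi> fa] a' hcomp_Id2[OF ah e] by simp
      also have "\<dots> = Id2 K f \<star> Id2 K a"
        using hcomp_assoc[OF Id2_in1[OF ah] Id2_in1[OF e] \<phi> ah e fa] that(2) by simp
      finally show ?thesis using hcomp_Id2[OF ah f] by simp
    qed
    moreover have "Id2 K (f \<odot> a) \<in> hom2 (f \<odot> a) (f \<odot> a)" by (rule Id2_in1[OF fa])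
    moreover have "is_iso (cat12 K) (Id2 K (f \<odot> a))" using is_iso_Id2 fa by (simp add: hom1_iff)
    moreover have "Id2 K (f \<odot> a) \<star> Id2 K (\<eta> A) = Id2 K f"
      using hcomp_Id2[OF e fa] comp1_assoc[OF e ah f] a' comp1_Id1(1)[OF f] by simp
    moreover have "Id2 K (f \<odot> a) \<star> Id2 K (\<mu> A) =
        (Id2 K (f \<odot> a) \<star> Id2 K (Map1 T a)) \<bullet> (Id2 K b \<star> Map2 T (Id2 K (f \<odot> a)))"
    proof -
      have "Id2 K b \<star> Map2 T (Id2 K (f \<odot> a)) = Id2 K (b \<odot> (Map1 T f \<odot> Map1 T a))"
        using T_Id2[of "f \<odot> a"] fa T_comp[OF ah f] hcomp_Id2[OF comp1_in[OF T_in1[OF ah] Tf] bh]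
        by (simp add: hom1_iff)
      also have "b \<odot> (Map1 T f \<odot> Map1 T a) = (f \<odot> a) \<odot> \<mu> A"
        using comp1_assoc[OF T_in1[OF ah] Tf bh] sq Ta by simp
      finally show ?thesis
        using Ta hcomp_Id2[OF m fa] vcomp_Id2(1)[OF Id2_in1[OF comp1_in[OF m fa]]] by simp
    qed
    ultimately show ?thesis unfolding algebra_morphism_def using a b f sq by (auto simp: Let_def)
  qed (simp add: algebra_morphism_def Let_def)
qed

text \<open>The compatibility condition on 2-cells of algebras always holds: once the identities are removed it
reads \<open>\<alpha> a = b (T \<alpha>)\<close>, which is naturality of \<open>\<eta>\<close> at \<open>\<alpha>\<close> composed with \<open>b\<close> and \<open>a\<close>.\<close>

lemma algebra_cell_condition:
  assumes a: "algebra K T \<mu> \<eta> (A, a)" and b: "algebra K T \<mu> \<eta> (B, b)"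
    and f: "f \<in> hom1 A B" and g: "g \<in> hom1 A B"
    and \<alpha>: "\<alpha> \<in> hom2 f g"
  shows "(\<alpha> \<star> Id2 K a) \<bullet> Id2 K (f \<odot> a) = Id2 K (g \<odot> a) \<bullet> (Id2 K b \<star> Map2 T \<alpha>)"
proof -
  note a' = a[unfolded algebra_iff] and b' = b[unfolded algebra_iff]
  have A: "A \<in> Cell0 K" and B: "B \<in> Cell0 K" and ah: "a \<in> hom1 (Map0 T A) A" and bh: "b \<in> hom1 (Map0 T B) B"
    using a' b' by auto
  note e = unit_in[OF A] unit_in[OF B] and Tf = T_in1[OF f] and T\<alpha> = T_in2[OF \<alpha>]
  note i = Id2_in1[OF ah] Id2_in1[OF bh] Id2_in1[OF e(1)] Id2_in1[OF e(2)]
  have \<alpha>a: "\<alpha> \<star> Id2 K a \<in> hom2 (f \<odot> a) (g \<odot> a)" by (rule hcomp_in[OF i(1) \<alpha> ah f])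
  have bT\<alpha>: "Id2 K b \<star> Map2 T \<alpha> \<in> hom2 (b \<odot> Map1 T f) (b \<odot> Map1 T g)" by (rule hcomp_in[OF T\<alpha> i(2) Tf bh])
  have "Id2 K b \<star> Map2 T \<alpha> = Id2 K b \<star> (Map2 T \<alpha> \<star> (Id2 K (\<eta> A) \<star> Id2 K a))"
    using hcomp_Id2[OF ah e(1)] a' hcomp_Id1(1)[OF T\<alpha> Tf] by simp
  also have "\<dots> = Id2 K b \<star> (Id2 K (\<eta> B) \<star> (\<alpha> \<star> Id2 K a))"
    using hcomp_assoc[OF i(1) i(3) T\<alpha> ah e(1) Tf] hcomp_assoc[OF i(1) \<alpha> i(4) ah f e(2)] unit_nat2[OF \<alpha> f] by simp
  also have "\<dots> = (Id2 K b \<star> Id2 K (\<eta> B)) \<star> (\<alpha> \<star> Id2 K a)"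
    using hcomp_assoc[OF \<alpha>a i(4) i(2) comp1_in[OF ah f] e(2) bh] by simp
  also have "\<dots> = \<alpha> \<star> Id2 K a"
    using hcomp_Id2[OF e(2) bh] b' hcomp_Id1(2)[OF \<alpha>a comp1_in[OF ah f]] by simp
  finally show ?thesis
    using vcomp_Id2(1)[OF \<alpha>a] vcomp_Id2(2)[OF bT\<alpha>] algebra_square[OF a b g] by simp
qed

text \<open>The next three maps send a 0-cell with invertible unit, a 1-cell and a 2-cell between such 0-cells to
the algebra, the morphism and the 2-cell of algebras that lie over them; by the preceding lemmas
there is exactly one of each.\<close>

definition algebra_on :: "'a \<Rightarrow> 'a \<times> 'b" where
  "algebra_on A = (A, SOME a. algebra K T \<mu> \<eta> (A, a))"

definition strict_mor :: "'b \<Rightarrow> ('a, 'b, 'c) alg_mor" where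
  "strict_mor f = \<lparr>AmSrc = algebra_on (Src1 K f), AmTgt = algebra_on (Tgt1 K f), AmMap = f,
     AmCell = Id2 K (f \<odot> snd (algebra_on (Src1 K f)))\<rparr>"

definition strict_cell :: "'c \<Rightarrow> ('a, 'b, 'c) alg_cell" where
  "strict_cell \<alpha> = \<lparr>AcSrc = strict_mor (Src2 K \<alpha>), AcTgt = strict_mor (Tgt2 K \<alpha>), AcCell = \<alpha>\<rparr>"

text \<open>Forgetting the structure is a bijection from the cells of \<open>Alg K T \<mu> \<eta>\<close> to those cells of \<open>K\<close> that lie
between 0-cells with invertible unit.\<close>

theorem Alg_equivalent_full_sub:
  "two_equivalent (Alg K T \<mu> \<eta>) (full_sub K (\<lambda>A. is_iso (cat01 K) (\<eta> A)))"
proof -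
  define L where "L = full_sub K (\<lambda>A. is_iso (cat01 K) (\<eta> A))"
  define G where "G = \<lparr>Map0 = algebra_on, Map1 = strict_mor, Map2 = strict_cell\<rparr>"
  have L: "two_category L" unfolding L_def by (rule two_category_full_sub)
  have L0: "A \<in> Cell0 L \<longleftrightarrow> A \<in> Cell0 K \<and> is_iso (cat01 K) (\<eta> A)" for A
    by (simp add: L_def)
  have L1: "f \<in> Cell1 L \<longleftrightarrow> f \<in> Cell1 K \<and> Src1 K f \<in> Cell0 L \<and> Tgt1 K f \<in> Cell0 L" for f
    using hom1_ob[of f "Src1 K f" "Tgt1 K f"] by (auto simp: L_def hom1_iff)
  have Lo: "Src1 L = Src1 K" "Tgt1 L = Tgt1 K" "Src2 L = Src2 K" "Tgt2 L = Tgt2 K" "Id1 L = Id1 K" "Id2 L = Id2 K"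
    "Comp1 L = Comp1 K" "VComp L = VComp K" "HComp L = HComp K" by (simp_all add: L_def)
  have L2: "\<alpha> \<in> Cell2 L \<longleftrightarrow> \<alpha> \<in> Cell2 K \<and> Src2 K \<alpha> \<in> Cell1 L \<and> Tgt2 K \<alpha> \<in> Cell1 L" for \<alpha>
    using hom2_cell1[of \<alpha> "Src2 K \<alpha>" "Tgt2 K \<alpha>"] globular[of \<alpha>] by (auto simp: L_def hom2_iff)
  have algebra_on: "algebra K T \<mu> \<eta> (algebra_on A)" "fst (algebra_on A) = A" if "A \<in> Cell0 L" for A
    using someI_ex[of "\<lambda>a. algebra K T \<mu> \<eta> (A, a)"] algebra_ex_iff[of A] that
    by (auto simp: L0 algebra_on_def)
  have algebra_on_eq: "X = algebra_on (fst X) \<and> fst X \<in> Cell0 L" if "algebra K T \<mu> \<eta> X" for X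
  proof -
    obtain A a where X: "X = (A, a)" by (cases X)
    then have "A \<in> Cell0 L" using that algebra_ex_iff[of A] by (auto simp: L0 algebra_iff)
    then show ?thesis using algebra_on[of A] that algebra_unique[of A a "snd (algebra_on A)"] by (cases "algebra_on A") (auto simp: X)
  qed
  have strict_mor_in: "algebra_morphism K T \<mu> \<eta> (strict_mor f)" if "f \<in> Cell1 L" for f
  proof -
    have "algebra K T \<mu> \<eta> (Src1 K f, snd (algebra_on (Src1 K f)))" "algebra K T \<mu> \<eta> (Tgt1 K f, snd (algebra_on (Tgt1 K f)))"
      using algebra_on[of "Src1 K f"] algebra_on[of "Tgt1 K f"] that unfolding L1 by (metis prod.collapse)+
    from algebra_morphism_iff[OF this, of f] show ?thesis
      using that unfolding L1 strict_mor_def by (simp add: algebra_on_def hom1_iff)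
  qed
  have strict_mor_eq: "m = strict_mor (AmMap m) \<and> AmMap m \<in> Cell1 L \<and> AmSrc m = algebra_on (Src1 K (AmMap m)) \<and> AmTgt m = algebra_on (Tgt1 K (AmMap m))"
    if m: "algebra_morphism K T \<mu> \<eta> m" for m
  proof -
    obtain A a B b f \<phi> where e: "m = \<lparr>AmSrc = (A, a), AmTgt = (B, b), AmMap = f, AmCell = \<phi>\<rparr>"
      by (metis alg_mor.cases prod.collapse)
    have ab: "algebra K T \<mu> \<eta> (A, a)" "algebra K T \<mu> \<eta> (B, b)"
      using m by (simp_all add: e algebra_morphism_def)
    then have "f \<in> hom1 A B" "\<phi> = Id2 K (f \<odot> a)" using m algebra_morphism_iff[OF ab] e by auto
    then show ?thesis using algebra_on_eq[OF ab(1)] algebra_on_eq[OF ab(2)]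
      by (auto simp: e strict_mor_def hom1_iff L1) (metis snd_conv)
  qed
  have cell: "algebra_cell K T \<mu> \<eta> (strict_cell \<alpha>)" if "\<alpha> \<in> Cell2 L" for \<alpha>
  proof -
    let ?f = "Src2 K \<alpha>" and ?g = "Tgt2 K \<alpha>"
    let ?A = "Src1 K ?f" and ?B = "Tgt1 K ?f"
    have \<alpha>: "\<alpha> \<in> hom2 ?f ?g" and fg: "?f \<in> Cell1 L" "?g \<in> Cell1 L" using that by (auto simp: L2 hom2_iff)
    then have f: "?f \<in> hom1 ?A ?B" "?g \<in> hom1 ?A ?B" using hom2_hom1[OF \<alpha>] by (auto simp: L1 hom1_iff)
    have "algebra K T \<mu> \<eta> (?A, snd (algebra_on ?A))" "algebra K T \<mu> \<eta> (?B, snd (algebra_on ?B))"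
      using algebra_on[of ?A] algebra_on[of ?B] fg(1) unfolding L1 by (metis prod.collapse)+
    from algebra_cell_condition[OF this f \<alpha>] show ?thesis
      using strict_mor_in[OF fg(1)] strict_mor_in[OF fg(2)] f(2) \<alpha>
      unfolding algebra_cell_def strict_cell_def Let_def by (simp add: strict_mor_def hom1_iff)
  qed
  have cell_eq: "c = strict_cell (AcCell c) \<and> AcCell c \<in> Cell2 L" if c: "algebra_cell K T \<mu> \<eta> c" for c
  proof -
    have "algebra_morphism K T \<mu> \<eta> (AcSrc c)" "algebra_morphism K T \<mu> \<eta> (AcTgt c)"
      "AcCell c \<in> hom2 (AmMap (AcSrc c)) (AmMap (AcTgt c))"
      using c by (auto simp: algebra_cell_def Let_def)
    then show ?thesis using strict_mor_eq[of "AcSrc c"] strict_mor_eq[of "AcTgt c"]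
      by (auto simp: strict_cell_def L2 hom2_iff intro!: alg_cell.equality)
  qed
  have comp: "alg_comp K T (strict_mor g) (strict_mor f) = strict_mor (g \<odot> f)"
    if fL: "f \<in> Cell1 L" and gL: "g \<in> Cell1 L" and s: "Src1 K g = Tgt1 K f" for f g
  proof -
    let ?A = "Src1 K f" and ?B = "Tgt1 K f" and ?D = "Tgt1 K g"
    let ?a = "snd (algebra_on ?A)" and ?b = "snd (algebra_on ?B)"
    have f: "f \<in> hom1 ?A ?B" and g: "g \<in> hom1 ?B ?D" using fL gL s by (auto simp: L1 hom1_iff)
    have alg: "algebra K T \<mu> \<eta> (?A, ?a)" "algebra K T \<mu> \<eta> (?B, ?b)"
      using algebra_on[of ?A] algebra_on[of ?B] fL unfolding L1 by (metis prod.collapse)+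
    have a: "?a \<in> hom1 (Map0 T ?A) ?A" and b: "?b \<in> hom1 (Map0 T ?B) ?B"
      using alg unfolding algebra_iff by auto
    note Tf = T_in1[OF f] and gfa = comp1_in[OF comp1_in[OF a f] g]
    have "Id2 K (g \<odot> ?b) \<star> Id2 K (Map1 T f) = Id2 K (g \<odot> (f \<odot> ?a))"
      using hcomp_Id2[OF Tf comp1_in[OF b g]] comp1_assoc[OF Tf b g] algebra_square[OF alg f] by simp
    moreover have "Id2 K g \<star> Id2 K (f \<odot> ?a) = Id2 K (g \<odot> (f \<odot> ?a))"
      by (rule hcomp_Id2[OF comp1_in[OF a f] g])
    ultimately show ?thesis
      using vcomp_Id2(1)[OF Id2_in1[OF gfa]] comp1_assoc[OF a f g] comp1_in[OF f g]
      by (simp add: alg_comp_def strict_mor_def s hom1_iff)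
  qed
  have s2: "Src2 K f \<in> Cell1 L" "Tgt2 K f \<in> Cell1 L" if "f \<in> Cell2 L" for f using that by (auto simp: L2)
  have i1: "Id1 K A \<in> Cell1 K" "Src1 K (Id1 K A) = A" "Tgt1 K (Id1 K A) = A" if "A \<in> Cell0 L" for A
    using Id1_in[of A] that by (auto simp: L0 hom1_iff)
  have i2: "Id2 K A \<in> Cell2 K \<and> Src2 K (Id2 K A) = A \<and> Tgt2 K (Id2 K A) = A" if "A \<in> Cell1 L" for A
    using Id2_in[of A] that by (simp add: hom2_iff L1)
  have strict_mor_Id1: "strict_mor (Id1 K A) = \<lparr>AmSrc = algebra_on A, AmTgt = algebra_on A, AmMap = Id1 K A, AmCell = Id2 K (snd (algebra_on A))\<rparr>"
    if "A \<in> Cell0 L" for A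
  proof -
    have "snd (algebra_on A) \<in> hom1 (Map0 T A) A"
      using algebra_on[OF that] algebra_iff[of A "snd (algebra_on A)"] by (cases "algebra_on A") auto
    then show ?thesis using comp1_Id1(2) i1[OF that] by (simp add: strict_mor_def)
  qed
  note Alg_simps = Alg_def G_def Lo Hom_def
  have G: "two_functor L (Alg K T \<mu> \<eta>) G"
    unfolding two_functor_def
  proof (intro conjI)
    show "is_functor (cat01 L) (cat01 (Alg K T \<mu> \<eta>)) (Map0 G) (Map1 G)"
      unfolding is_functor_def
    proof (intro conjI ballI impI)
      show "Map0 G A \<in> Ob (cat01 (Alg K T \<mu> \<eta>))" if "A \<in> Ob (cat01 L)" for A using that algebra_on by (simp add: Alg_simps)
      show "Map1 G f \<in> Hom (cat01 (Alg K T \<mu> \<eta>)) (Map0 G (Dom (cat01 L) f)) (Map0 G (Cod (cat01 L) f))"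
        if "f \<in> Ar (cat01 L)" for f using that strict_mor_in[of f] by (simp add: Alg_simps strict_mor_def)
      show "Map1 G (Idn (cat01 L) A) = Idn (cat01 (Alg K T \<mu> \<eta>)) (Map0 G A)" if "A \<in> Ob (cat01 L)" for A
        using that strict_mor_Id1[of A] by (simp add: Alg_simps algebra_on_def)
      show "Map1 G (g \<cdot>\<^bsub>cat01 L\<^esub> f) = Map1 G g \<cdot>\<^bsub>cat01 (Alg K T \<mu> \<eta>)\<^esub> Map1 G f"
        if "f \<in> Ar (cat01 L)" "g \<in> Ar (cat01 L)" "Dom (cat01 L) g = Cod (cat01 L) f" for f g
        using that comp[of f g] by (simp add: Alg_simps)
    qed
    show "is_functor (cat12 L) (cat12 (Alg K T \<mu> \<eta>)) (Map1 G) (Map2 G)"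
      unfolding is_functor_def
    proof (intro conjI ballI impI)
      show "Map1 G f \<in> Ob (cat12 (Alg K T \<mu> \<eta>))" if "f \<in> Ob (cat12 L)" for f
        using that strict_mor_in by (simp add: Alg_simps)
      show "Map2 G \<alpha> \<in> Hom (cat12 (Alg K T \<mu> \<eta>)) (Map1 G (Dom (cat12 L) \<alpha>)) (Map1 G (Cod (cat12 L) \<alpha>))"
        if "\<alpha> \<in> Ar (cat12 L)" for \<alpha> using that cell[of \<alpha>] by (simp add: Alg_simps strict_cell_def)
      show "Map2 G (Idn (cat12 L) f) = Idn (cat12 (Alg K T \<mu> \<eta>)) (Map1 G f)" if "f \<in> Ob (cat12 L)" for f
        using that i2[of f] by (simp add: Alg_simps strict_cell_def strict_mor_def)
      show "Map2 G (\<beta> \<cdot>\<^bsub>cat12 L\<^esub> \<alpha>) = Map2 G \<beta> \<cdot>\<^bsub>cat12 (Alg K T \<mu> \<eta>)\<^esub> Map2 G \<alpha>"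
        if "\<alpha> \<in> Ar (cat12 L)" "\<beta> \<in> Ar (cat12 L)" "Dom (cat12 L) \<beta> = Cod (cat12 L) \<alpha>" for \<alpha> \<beta>
        using that vcomp_in[of \<alpha> "Src2 K \<alpha>" "Tgt2 K \<alpha>" \<beta> "Tgt2 K \<beta>"]
        by (simp add: Alg_simps strict_cell_def L2)
    qed
    show "is_functor (cat02 L) (cat02 (Alg K T \<mu> \<eta>)) (Map0 G) (Map2 G)"
      unfolding is_functor_def
    proof (intro conjI ballI impI)
      show "Map0 G A \<in> Ob (cat02 (Alg K T \<mu> \<eta>))" if "A \<in> Ob (cat02 L)" for A using that algebra_on by (simp add: Alg_simps)
      show "Map2 G \<alpha> \<in> Hom (cat02 (Alg K T \<mu> \<eta>)) (Map0 G (Dom (cat02 L) \<alpha>)) (Map0 G (Cod (cat02 L) \<alpha>))"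
        if "\<alpha> \<in> Ar (cat02 L)" for \<alpha> using that cell[of \<alpha>] by (simp add: Alg_simps strict_cell_def strict_mor_def)
      show "Map2 G (Idn (cat02 L) A) = Idn (cat02 (Alg K T \<mu> \<eta>)) (Map0 G A)" if "A \<in> Ob (cat02 L)" for A
      proof -
        have "Id1 K A \<in> Cell1 L" using that i1[of A] by (simp add: L1)
        then show ?thesis using that i1[of A] i2[of "Id1 K A"] strict_mor_Id1[of A]
          by (simp add: Alg_simps strict_cell_def algebra_on_def)
      qed
      show "Map2 G (\<beta> \<cdot>\<^bsub>cat02 L\<^esub> \<alpha>) = Map2 G \<beta> \<cdot>\<^bsub>cat02 (Alg K T \<mu> \<eta>)\<^esub> Map2 G \<alpha>"
        if "\<alpha> \<in> Ar (cat02 L)" "\<beta> \<in> Ar (cat02 L)" "Dom (cat02 L) \<beta> = Cod (cat02 L) \<alpha>" for \<alpha> \<beta>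
      proof -
        have c: "\<alpha> \<in> Cell2 L" "\<beta> \<in> Cell2 L" "Src1 K (Src2 K \<beta>) = Tgt1 K (Src2 K \<alpha>)"
          using that by (simp_all add: Lo)
        then have K: "\<alpha> \<in> Cell2 K" "\<beta> \<in> Cell2 K" by (simp_all add: L2)
        have t: "Src1 K (Tgt2 K \<beta>) = Tgt1 K (Tgt2 K \<alpha>)" using c(3) globular[OF K(1)] globular[OF K(2)] by simp
        show ?thesis
          using comp[OF s2(1)[OF c(1)] s2(1)[OF c(2)] c(3)] comp[OF s2(2)[OF c(1)] s2(2)[OF c(2)] t]
            hcomp_src_tgt[OF K c(3)]
          by (simp add: Alg_simps strict_cell_def)
      qed
    qed
  qed
  have "bij_betw (Map0 G) (Cell0 L) (Cell0 (Alg K T \<mu> \<eta>))"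
    by (rule bij_betw_byWitness[where f' = fst]) (use algebra_on algebra_on_eq in \<open>auto simp: G_def Alg_def\<close>)
  moreover have "bij_betw (Map1 G) (Cell1 L) (Cell1 (Alg K T \<mu> \<eta>))"
    by (rule bij_betw_byWitness[where f' = AmMap])
      (use strict_mor_in strict_mor_eq in \<open>auto simp: G_def Alg_def strict_mor_def\<close>)
  moreover have "bij_betw (Map2 G) (Cell2 L) (Cell2 (Alg K T \<mu> \<eta>))"
    by (rule bij_betw_byWitness[where f' = AcCell])
      (use cell cell_eq in \<open>auto simp: G_def Alg_def strict_cell_def\<close>)
  ultimately show ?thesis using two_equivalent_if_iso[OF L G] by (simp add: L_def)
qed

end

section \<open>Internal equality of arrows\<close>

text \<open>The fibre over \<open>A\<close> regards \<open>f\<close> and \<open>g\<close> as equal when the predicate \<open>\<delta>(f, g)\<close> is true at \<open>A\<close>. For parallel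
arrows this is the relation \<open>\<delta> \<le> P(f \<times> g)(\<delta>)\<close> that the collapse divides by, in a form that is easier
to compute with.\<close>

definition int_eq :: "('o, 'm, 'p, 'x) doctrine_scheme \<Rightarrow> 'm \<Rightarrow> 'm \<Rightarrow> bool" where
  "int_eq P f g \<longleftrightarrow> f \<in> Ar P \<and> g \<in> Hom P (Dom P f) (Cod P f) \<and>
     Sub P (pair P f g) (delta P (Cod P f)) = \<top>\<^bsub>Fib P (Dom P f)\<^esub>"

context elementary_doctrine
begin

lemma int_eq_Hom: "\<lbrakk>int_eq P f g; f \<in> Hom P A B\<rbrakk> \<Longrightarrow> g \<in> Hom P A B"
  by (auto simp: int_eq_def Hom_def)

lemma int_eq_iff: "\<lbrakk>f \<in> Hom P A B; g \<in> Hom P A B\<rbrakk> \<Longrightarrow>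
    int_eq P f g \<longleftrightarrow> Sub P (pair P f g) (delta P B) = \<top>\<^bsub>Fib P A\<^esub>"
  by (auto simp: int_eq_def Hom_def)

lemma int_eqE:
  assumes "int_eq P f g"
  obtains A B where "f \<in> Hom P A B" "g \<in> Hom P A B" "Sub P (pair P f g) (delta P B) = \<top>\<^bsub>Fib P A\<^esub>"
  using assms by (auto simp: int_eq_def Hom_def)

lemma int_eq_refl: "f \<in> Ar P \<Longrightarrow> int_eq P f f"
  using delta_refl[of f] by (auto simp: int_eq_def Hom_def)

lemma int_eq_sym:
  assumes fg: "int_eq P f g"
  shows "int_eq P g f"
proof -
  obtain A B where f: "f \<in> Hom P A B" and g: "g \<in> Hom P A B"
    and e: "Sub P (pair P f g) (delta P B) = \<top>\<^bsub>Fib P A\<^esub>" using fg by (rule int_eqE)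
  show ?thesis using delta_sym[OF f g e] int_eq_iff[OF g f] by blast
qed

lemma int_eq_trans:
  assumes fg: "int_eq P f g" and gh: "int_eq P g h"
  shows "int_eq P f h"
proof -
  obtain A B where f: "f \<in> Hom P A B" and g: "g \<in> Hom P A B"
    and e: "Sub P (pair P f g) (delta P B) = \<top>\<^bsub>Fib P A\<^esub>" using fg by (rule int_eqE)
  have h: "h \<in> Hom P A B" by (rule int_eq_Hom[OF gh g])
  show ?thesis using delta_trans[OF f g h e] gh int_eq_iff[OF g h] int_eq_iff[OF f h] by blast
qed

text \<open>Leibniz' law in a context \<open>X\<close>. In the internal language, \<open>\<delta>(a, a') \<le> \<delta>(\<phi>(x, a), \<phi>(x, a'))\<close> holds over
\<open>X \<times> A \<times> A\<close>: by the second adjunction defining \<open>\<delta>\<close> it is enough to check it for \<open>a = a'\<close>, where the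
right-hand side is true. Substituting \<open>x\<close>, \<open>f\<close>, \<open>g\<close> for the variables gives the claim. All the congruence
properties below are instances.\<close>

lemma int_eq_subst:
  assumes \<phi>: "\<phi> \<in> Hom P (Prd P X A) D" and x: "x \<in> Hom P Z X" and f: "f \<in> Hom P Z A"
    and fg: "int_eq P f g"
  shows "int_eq P (\<phi> \<cdot> pair P x f) (\<phi> \<cdot> pair P x g)"
proof -
  have X: "X \<in> Ob P" and A: "A \<in> Ob P" and Z: "Z \<in> Ob P" and D: "D \<in> Ob P"
    using \<phi> x f Hom_ob by blast+
  have g: "g \<in> Hom P Z A" by (rule int_eq_Hom[OF fg f])
  define XA where "XA = Prd P X A"
  define XAA where "XAA = Prd P XA A"
  note p = pr_in[OF X A, folded XA_def] and dA = delta_in[OF A] and dD = delta_in[OF D]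
  note t = pr_in[OF p(1) A, folded XAA_def]
  have t1: "tpr1 P X A \<in> Hom P XAA X" unfolding tpr1_def XA_def[symmetric] by (rule comp_in[OF t(2) p(2)])
  have t2: "tpr2 P X A \<in> Hom P XAA A" unfolding tpr2_def XA_def[symmetric] by (rule comp_in[OF t(2) p(3)])
  have t3: "tpr3 P X A \<in> Hom P XAA A" unfolding tpr3_def XA_def[symmetric] by (rule t(3))
  have tp: "pair P (pair P h k) l \<in> Hom P Y XAA"
    "tpr1 P X A \<cdot> pair P (pair P h k) l = h" "tpr2 P X A \<cdot> pair P (pair P h k) l = k"
    "tpr3 P X A \<cdot> pair P (pair P h k) l = l"
    if h: "h \<in> Hom P Y X" and k: "k \<in> Hom P Y A" and l: "l \<in> Hom P Y A" for h k l Y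
  proof -
    have hk: "pair P h k \<in> Hom P Y XA" unfolding XA_def by (rule pair_in[OF h k])
    show m: "pair P (pair P h k) l \<in> Hom P Y XAA" unfolding XAA_def by (rule pair_in[OF hk l])
    note q1 = pr1_pair[OF hk l] and q2 = pr2_pair[OF hk l]
    show "tpr1 P X A \<cdot> pair P (pair P h k) l = h"
      unfolding tpr1_def XA_def[symmetric] using assoc_in[OF m t(2) p(2)] q1 pr1_pair[OF h k] by (simp add: XA_def)
    show "tpr2 P X A \<cdot> pair P (pair P h k) l = k"
      unfolding tpr2_def XA_def[symmetric] using assoc_in[OF m t(2) p(3)] q1 pr2_pair[OF h k] by (simp add: XA_def)
    show "tpr3 P X A \<cdot> pair P (pair P h k) l = l"
      unfolding tpr3_def XA_def[symmetric] by (rule q2)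
  qed
  define m12 where "m12 = pair P (tpr1 P X A) (tpr2 P X A)"
  define m13 where "m13 = pair P (tpr1 P X A) (tpr3 P X A)"
  define m23 where "m23 = pair P (tpr2 P X A) (tpr3 P X A)"
  have m: "m12 \<in> Hom P XAA XA" "m13 \<in> Hom P XAA XA" "m23 \<in> Hom P XAA (Prd P A A)"
    unfolding m12_def m13_def m23_def XA_def by (rule pair_in[OF t1 t2] pair_in[OF t1 t3] pair_in[OF t2 t3])+
  note \<phi>' = \<phi>[folded XA_def]
  note \<phi>m = comp_in[OF m(1) \<phi>'] comp_in[OF m(2) \<phi>']
  \<comment> \<open>\<open>r\<close> is \<open>(x, a, a') \<mapsto> (\<phi>(x, a), \<phi>(x, a'))\<close>, and \<open>e\<close> below is \<open>(x, a) \<mapsto> (x, a, a)\<close>.\<close>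
  define r where "r = pair P (\<phi> \<cdot> m12) (\<phi> \<cdot> m13)"
  have r: "r \<in> Hom P XAA (Prd P D D)" unfolding r_def by (rule pair_in[OF \<phi>m])
  have r_tp: "r \<cdot> pair P (pair P h k) l = pair P (\<phi> \<cdot> pair P h k) (\<phi> \<cdot> pair P h l)"
    if "h \<in> Hom P Y X" "k \<in> Hom P Y A" "l \<in> Hom P Y A" for h k l Y
  proof -
    note w = tp[OF that]
    have "m12 \<cdot> pair P (pair P h k) l = pair P h k" "m13 \<cdot> pair P (pair P h k) l = pair P h l"
      unfolding m12_def m13_def using pair_comp[OF t1 t2 w(1)] pair_comp[OF t1 t3 w(1)] w by simp_all
    then show ?thesis
      unfolding r_def using pair_comp[OF \<phi>m w(1)] assoc_in[OF w(1) m(1) \<phi>'] assoc_in[OF w(1) m(2) \<phi>'] by simp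
  qed
  define e where "e = pair P (pair P (Pr1 P X A) (Pr2 P X A)) (Pr2 P X A)"
  have e: "e \<in> Hom P XA XAA" unfolding e_def by (rule tp(1)[OF p(2) p(3) p(3)])
  have "r \<cdot> e = pair P (\<phi> \<cdot> pair P (Pr1 P X A) (Pr2 P X A)) (\<phi> \<cdot> pair P (Pr1 P X A) (Pr2 P X A))"
    unfolding e_def by (rule r_tp[OF p(2) p(3) p(3)])
  then have "Sub P e (Sub P r (delta P D)) = \<top>\<^bsub>Fib P XA\<^esub>"
    using sub_sub[OF e r dD] delta_refl[OF comp_in[OF pair_in[OF p(2) p(3)] \<phi>]] by simp
  moreover have "Sub P m12 (\<top>\<^bsub>Fib P XA\<^esub>) \<sqinter>\<^bsub>Fib P XAA\<^esub> Sub P m23 (delta P A) = Sub P m23 (delta P A)"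
    using sub_top[OF m(1)] top_meet[OF t(1) sub_in[OF m(3) dA]] by simp
  ultimately have le: "Sub P m23 (delta P A) \<sqsubseteq>\<^bsub>Fib P XAA\<^esub> Sub P r (delta P D)"
    using is_delta_delta[OF A, unfolded is_delta_def Let_def, THEN conjunct2, THEN conjunct2,
        rule_format, OF X, folded XA_def, folded XAA_def, folded m12_def m23_def e_def,
        OF top_in[OF p(1)] sub_in[OF r dD]] fib_refl[OF p(1) top_in[OF p(1)]] by simp
  define w where "w = pair P (pair P x f) g"
  note W = tp[OF x f g, folded w_def]
  have "m23 \<cdot> w = pair P f g"
    unfolding m23_def using pair_comp[OF t2 t3 W(1)] W by simp
  moreover have "r \<cdot> w = pair P (\<phi> \<cdot> pair P x f) (\<phi> \<cdot> pair P x g)"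
    unfolding w_def by (rule r_tp[OF x f g])
  moreover have "Sub P w (Sub P m23 (delta P A)) \<sqsubseteq>\<^bsub>Fib P Z\<^esub> Sub P w (Sub P r (delta P D))"
    by (rule sub_mono[OF W(1) sub_in[OF m(3) dA] sub_in[OF r dD] le])
  moreover have "Sub P (pair P f g) (delta P A) = \<top>\<^bsub>Fib P Z\<^esub>"
    using fg int_eq_iff[OF f g] by simp
  ultimately have "\<top>\<^bsub>Fib P Z\<^esub> \<sqsubseteq>\<^bsub>Fib P Z\<^esub> Sub P (pair P (\<phi> \<cdot> pair P x f) (\<phi> \<cdot> pair P x g)) (delta P D)"
    using sub_sub[OF W(1) m(3) dA] sub_sub[OF W(1) r dD] by simp
  moreover note c = comp_in[OF pair_in[OF x f] \<phi>] comp_in[OF pair_in[OF x g] \<phi>]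
  ultimately show ?thesis
    using top_le[OF Z sub_in[OF pair_in[OF c] dD]] int_eq_iff[OF c] by blast
qed

text \<open>The components are replaced one at a time, the other one serving as the context.\<close>

lemma int_eq_pair:
  assumes f: "f \<in> Hom P Z A" and g: "g \<in> Hom P Z B" and ff: "int_eq P f f'" and gg: "int_eq P g g'"
  shows "int_eq P (pair P f g) (pair P f' g')"
proof -
  have A: "A \<in> Ob P" and B: "B \<in> Ob P" using f g Hom_ob by blast+
  note f' = int_eq_Hom[OF ff f] and g' = int_eq_Hom[OF gg g]
  note p = pr_in[OF B A] and i = idn_hom[OF pr_in(1)[OF A B]]
  have id: "Idn P (Prd P A B) \<cdot> h = h" if "h \<in> Hom P Z (Prd P A B)" for h
    using idn_comp[of h] that by (auto simp: Hom_def)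
  have s: "pair P (Pr2 P B A) (Pr1 P B A) \<cdot> pair P g h = pair P h g" if "h \<in> Hom P Z A" for h
    using pair_comp[OF p(3) p(2) pair_in[OF g that]] pr1_pair[OF g that] pr2_pair[OF g that] by simp
  have "int_eq P (pair P f g) (pair P f' g)"
    using int_eq_subst[OF pair_in[OF p(3) p(2)] g f ff] s[OF f] s[OF f'] by simp
  moreover have "int_eq P (pair P f' g) (pair P f' g')"
    using int_eq_subst[OF i f' g gg] id[OF pair_in[OF f' g]] id[OF pair_in[OF f' g']] by simp
  ultimately show ?thesis by (rule int_eq_trans)
qed

text \<open>Replacing \<open>f\<close> is substitution into \<open>(x, b) \<mapsto> g(b)\<close>, whose context is a dummy; it is taken to be \<open>B\<close> with
the arrow \<open>f\<close>. Replacing \<open>g\<close> is reindexing along \<open>f'\<close>.\<close>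

lemma int_eq_comp:
  assumes f: "f \<in> Hom P A B" and g: "g \<in> Hom P B D" and ff: "int_eq P f f'" and gg: "int_eq P g g'"
  shows "int_eq P (g \<cdot> f) (g' \<cdot> f')"
proof -
  have B: "B \<in> Ob P" and D: "D \<in> Ob P" using g Hom_ob by blast+
  note f' = int_eq_Hom[OF ff f] and g' = int_eq_Hom[OF gg g]
  note p = pr_in[OF B B]
  have s: "(g \<cdot> Pr2 P B B) \<cdot> pair P f h = g \<cdot> h" if "h \<in> Hom P A B" for h
    using assoc_in[OF pair_in[OF f that] p(3) g] pr2_pair[OF f that] by simp
  have "int_eq P (g \<cdot> f) (g \<cdot> f')"
    using int_eq_subst[OF comp_in[OF p(3) g] f f ff] s[OF f] s[OF f'] by simp
  moreover have "int_eq P (g \<cdot> f') (g' \<cdot> f')"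
    using gg sub_sub[OF f' pair_in[OF g g'] delta_in[OF D]] pair_comp[OF g g' f'] sub_top[OF f']
      int_eq_iff[OF g g'] int_eq_iff[OF comp_in[OF f' g] comp_in[OF f' g']] by simp
  ultimately show ?thesis by (rule int_eq_trans)
qed

text \<open>Predicates respect internal equality: \<open>\<alpha>(b) \<and> \<delta>(b, b') \<le> \<alpha>(b')\<close> by the first adjunction defining \<open>\<delta>\<close>,
and \<open>f\<close>, \<open>g\<close> may be substituted for \<open>b\<close>, \<open>b'\<close>. Antisymmetry of the fibre order gives equality.\<close>

lemma int_eq_Sub:
  assumes f: "f \<in> Hom P A B" and fg: "int_eq P f g" and \<alpha>: "\<alpha> \<in> carrier (Fib P B)"
  shows "Sub P f \<alpha> = Sub P g \<alpha>"
proof -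
  have le: "Sub P f \<alpha> \<sqsubseteq>\<^bsub>Fib P A\<^esub> Sub P g \<alpha>" if f: "f \<in> Hom P A B" and fg: "int_eq P f g" for f g
  proof -
    have A: "A \<in> Ob P" and B: "B \<in> Ob P" using f Hom_ob by blast+
    have g: "g \<in> Hom P A B" by (rule int_eq_Hom[OF fg f])
    note p = pr_in[OF B B] and i = idn_hom[OF B] and d = delta_in[OF B]
    note s1 = sub_in[OF p(2) \<alpha>] and s2 = sub_in[OF p(3) \<alpha>]
    have "Sub P (diag P B) (Sub P (Pr2 P B B) \<alpha>) = \<alpha>"
      using sub_sub[OF pair_in[OF i i] p(3) \<alpha>] pr2_pair[OF i i] sub_idn[OF B \<alpha>] by (simp add: diag_def)
    then have "Sub P (Pr1 P B B) \<alpha> \<sqinter>\<^bsub>Fib P (Prd P B B)\<^esub> delta P B \<sqsubseteq>\<^bsub>Fib P (Prd P B B)\<^esub> Sub P (Pr2 P B B) \<alpha>"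
      using is_delta_delta[OF B, unfolded is_delta_def, THEN conjunct2, THEN conjunct1, rule_format, OF \<alpha> s2]
        fib_refl[OF B \<alpha>] by simp
    then have "Sub P (pair P f g) (Sub P (Pr1 P B B) \<alpha> \<sqinter>\<^bsub>Fib P (Prd P B B)\<^esub> delta P B) \<sqsubseteq>\<^bsub>Fib P A\<^esub>
        Sub P (pair P f g) (Sub P (Pr2 P B B) \<alpha>)"
      by (rule sub_mono[OF pair_in[OF f g] greatest_closed[OF inf_semilattice_facts(4)[OF fib[OF p(1)] s1 d]] s2])
    moreover have "Sub P (pair P f g) (Sub P (Pr1 P B B) \<alpha> \<sqinter>\<^bsub>Fib P (Prd P B B)\<^esub> delta P B) =
        Sub P f \<alpha> \<sqinter>\<^bsub>Fib P A\<^esub> \<top>\<^bsub>Fib P A\<^esub>"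
      using sub_meet[OF pair_in[OF f g] s1 d] sub_sub[OF pair_in[OF f g] p(2) \<alpha>] pr1_pair[OF f g]
        fg int_eq_iff[OF f g] by simp
    moreover have "Sub P f \<alpha> \<sqinter>\<^bsub>Fib P A\<^esub> \<top>\<^bsub>Fib P A\<^esub> = Sub P f \<alpha>"
      using top_meet[OF A sub_in[OF f \<alpha>]] by (simp add: meet_def insert_commute)
    moreover have "Sub P (pair P f g) (Sub P (Pr2 P B B) \<alpha>) = Sub P g \<alpha>"
      using sub_sub[OF pair_in[OF f g] p(3) \<alpha>] pr2_pair[OF f g] by simp
    ultimately show ?thesis by simp
  qed
  have g: "g \<in> Hom P A B" by (rule int_eq_Hom[OF fg f])
  have "partial_order (Fib P A)" using fib[of A] f Hom_ob inf_semilattice_facts(1) by blast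
  from partial_order.le_antisym[OF this le[OF f fg] le[OF g int_eq_sym[OF fg]] sub_in[OF f \<alpha>] sub_in[OF g \<alpha>]]
  show ?thesis .
qed

text \<open>An arrow into \<open>A \<times> A\<close> is a pair \<open>(f, g)\<close>. It makes \<open>\<delta>\<close> true iff \<open>f\<close> and \<open>g\<close> are internally equal, and it
factors through the diagonal iff they are equal.\<close>

lemma comprehensive_diagonals_iff:
  "comprehensive_diagonals P \<longleftrightarrow> (\<forall>f g. int_eq P f g \<longrightarrow> f = g)"
proof (intro iffI allI impI)
  fix f g assume c: "comprehensive_diagonals P" and fg: "int_eq P f g"
  then obtain A B where f: "f \<in> Hom P A B" and g: "g \<in> Hom P A B"
    and e: "Sub P (pair P f g) (delta P B) = \<top>\<^bsub>Fib P A\<^esub>" by (elim int_eqE)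
  have B: "B \<in> Ob P" using f Hom_ob by blast
  note i = idn_hom[OF B] and p = pr_in[OF B B]
  have d: "diag P B \<in> Hom P B (Prd P B B)" unfolding diag_def by (rule pair_in[OF i i])
  have fgp: "pair P f g \<in> Hom P A (Prd P B B)" by (rule pair_in[OF f g])
  obtain h where h: "h \<in> Hom P A B" and dh: "diag P B \<cdot> h = pair P f g"
    using c[unfolded comprehensive_diagonals_def is_comprehension_def, rule_format, OF B,
        THEN conjunct2, THEN conjunct2, THEN conjunct2, THEN conjunct2, rule_format, of "pair P f g"] fgp d e
    by (auto simp: Hom_def)
  have "diag P B \<cdot> h = pair P h h"
    using pair_comp[OF i i h] idn_comp[of h] h by (auto simp: diag_def Hom_def)
  then show "f = g"
    using dh pr1_pair[OF f g] pr2_pair[OF f g] pr1_pair[OF h h] pr2_pair[OF h h] by metis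
next
  assume u: "\<forall>f g. int_eq P f g \<longrightarrow> f = g"
  show "comprehensive_diagonals P"
    unfolding comprehensive_diagonals_def is_comprehension_def
  proof (intro ballI conjI impI)
    fix A assume A: "A \<in> Ob P"
    note i = idn_hom[OF A] and p = pr_in[OF A A]
    have d: "diag P A \<in> Hom P A (Prd P A A)" unfolding diag_def by (rule pair_in[OF i i])
    then show "diag P A \<in> Ar P" "Cod P (diag P A) = Prd P A A" by (auto simp: Hom_def)
    show "delta P A \<in> carrier (Fib P (Prd P A A))" by (rule delta_in[OF A])
    show "Sub P (diag P A) (delta P A) = \<top>\<^bsub>Fib P (Dom P (diag P A))\<^esub>"
      using delta_refl[OF i] d by (simp add: diag_def Hom_def)
    fix f assume f: "f \<in> Ar P" and f': "Cod P f = Prd P A A \<and> Sub P f (delta P A) = \<top>\<^bsub>Fib P (Dom P f)\<^esub>"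
    then have fH: "f \<in> Hom P (Dom P f) (Prd P A A)" by (simp add: Hom_def)
    note f1 = comp_in[OF fH p(2)] and f2 = comp_in[OF fH p(3)]
    have fp: "f = pair P (Pr1 P A A \<cdot> f) (Pr2 P A A \<cdot> f)" by (rule pair_eqI[OF fH refl refl f1 f2])
    then have "int_eq P (Pr1 P A A \<cdot> f) (Pr2 P A A \<cdot> f)" using int_eq_iff[OF f1 f2] f' by simp
    then have e: "Pr2 P A A \<cdot> f = Pr1 P A A \<cdot> f" using u by metis
    have dh: "diag P A \<cdot> h = pair P h h" if h: "h \<in> Hom P (Dom P f) A" for h
      using pair_comp[OF i i h] idn_comp[of h] h by (auto simp: diag_def Hom_def)
    show "\<exists>!h. h \<in> Hom P (Dom P f) (Dom P (diag P A)) \<and> diag P A \<cdot> h = f"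
    proof (rule ex1I[of _ "Pr1 P A A \<cdot> f"])
      show "Pr1 P A A \<cdot> f \<in> Hom P (Dom P f) (Dom P (diag P A)) \<and> diag P A \<cdot> (Pr1 P A A \<cdot> f) = f"
        using f1 dh[OF f1] fp e d by (simp add: Hom_def)
      show "h = Pr1 P A A \<cdot> f" if "h \<in> Hom P (Dom P f) (Dom P (diag P A)) \<and> diag P A \<cdot> h = f" for h
      proof -
        have h: "h \<in> Hom P (Dom P f) A" "diag P A \<cdot> h = f" using that d by (simp_all add: Hom_def)
        then show ?thesis using dh[OF h(1)] pr1_pair[OF h(1) h(1)] by simp
      qed
    qed
  qed
qed

end

section \<open>The extensional collapse\<close>

locale named_doctrine = elementary_doctrine P
  for P :: "('o, 'm, 'p) doctrine"  (structure) +
  fixes q :: "('o, 'm, 'p) doctrine \<Rightarrow> 'm set \<Rightarrow> 'm"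
  assumes naming: "class_naming q"
begin

abbreviation cl :: "'m \<Rightarrow> 'm" where "cl \<equiv> eqv q P"
abbreviation PX :: "('o, 'm, 'p) doctrine" where "PX \<equiv> collapse q P"

text \<open>Every arrow preserves internal equality, so the collapse is a quotient of all arrows and \<open>f \<mapsto> [f]\<close> is
defined on the whole of \<open>P\<close>.\<close>

lemma ext_arrow_iff: "ext_arrow P f \<longleftrightarrow> f \<in> Ar P"
  using ext_le_iff[of f "Dom P f" "Cod P f" f] delta_refl[of f "Dom P f" "Cod P f"]
  by (auto simp: ext_arrow_def Hom_def)

text \<open>The names of the classes separate them, so they may stand for the classes. From here on the collapse
is handled through this lemma, not through the naming.\<close>

lemma cl_eq_iff:
  assumes f: "f \<in> Ar P" and g: "g \<in> Ar P"
  shows "cl f = cl g \<longleftrightarrow> int_eq P f g"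
proof -
  have c: "k \<in> ext_class P h \<longleftrightarrow> int_eq P h k" if "h \<in> Ar P" for h k
    using ext_class_iff[of h "Dom P h" "Cod P h" k] that by (auto simp: Hom_def int_eq_def)
  have "inj_on (q P) {ext_class P f | f. ext_arrow P f}"
    using naming elementary_doctrine_axioms by (simp add: class_naming_def)
  then have "cl f = cl g \<longleftrightarrow> ext_class P f = ext_class P g"
    unfolding eqv_def using f g ext_arrow_iff by (intro inj_on_eq_iff) auto
  also have "\<dots> \<longleftrightarrow> int_eq P f g"
    using c[OF f, of g] c[OF g, of g] int_eq_refl[OF g] ext_class_disjoint[OF f g, of g] by blast
  finally show ?thesis .
qed

lemma collapse_simps [simp]:
  "Ob PX = Ob P" "Prd PX = Prd P" "Fib PX = Fib P" "Ar PX = cl ` Ar P"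
  "Idn PX A = cl (Idn P A)" "Pr1 PX A B = cl (Pr1 P A B)" "Pr2 PX A B = cl (Pr2 P A B)"
  by (auto simp: collapse_def ext_arrow_iff)

lemma rep_cl: "f \<in> Ar P \<Longrightarrow> int_eq P f (rep q P (cl f))"
  and rep_Ar: "x \<in> Ar PX \<Longrightarrow> rep q P x \<in> Ar P"
proof -
  have *: "rep q P x \<in> Ar P \<and> cl (rep q P x) = x" if "x \<in> Ar PX" for x
    using someI_ex[of "\<lambda>f. ext_arrow P f \<and> cl f = x"] that by (auto simp: rep_def ext_arrow_iff)
  show "x \<in> Ar PX \<Longrightarrow> rep q P x \<in> Ar P" using * by auto
  show "f \<in> Ar P \<Longrightarrow> int_eq P f (rep q P (cl f))" using *[of "cl f"] cl_eq_iff int_eq_sym by (metis collapse_simps(4) imageI)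
qed

lemma Dom_cl: "f \<in> Ar P \<Longrightarrow> Dom PX (cl f) = Dom P f" and Cod_cl: "f \<in> Ar P \<Longrightarrow> Cod PX (cl f) = Cod P f"
  using rep_cl[of f] by (auto simp: collapse_def int_eq_def Hom_def)

lemma cl_in: "f \<in> Hom P A B \<Longrightarrow> cl f \<in> Hom PX A B"
  by (auto simp: Hom_def Dom_cl Cod_cl)

lemma Hom_PX: "x \<in> Hom PX A B \<Longrightarrow> \<exists>f \<in> Hom P A B. x = cl f"
  by (auto simp: Hom_def Dom_cl Cod_cl)

lemma comp_cl:
  assumes f: "f \<in> Hom P A B" and g: "g \<in> Hom P B D"
  shows "cl g \<cdot>\<^bsub>PX\<^esub> cl f = cl (g \<cdot> f)"
proof -
  have fA: "f \<in> Ar P" and gA: "g \<in> Ar P" using f g by (auto simp: Hom_def)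
  have e: "int_eq P (g \<cdot> f) (rep q P (cl g) \<cdot> rep q P (cl f))"
    by (rule int_eq_comp[OF f g rep_cl[OF fA] rep_cl[OF gA]])
  have "g \<cdot> f \<in> Ar P" using comp_in[OF f g] by (simp add: Hom_def)
  moreover have "rep q P (cl g) \<cdot> rep q P (cl f) \<in> Ar P" using e by (auto simp: int_eq_def Hom_def)
  ultimately show ?thesis using cl_eq_iff int_eq_sym[OF e] by (simp add: collapse_def)
qed

lemma Sub_cl: "\<lbrakk>f \<in> Hom P A B; \<alpha> \<in> carrier (Fib P B)\<rbrakk> \<Longrightarrow> Sub PX (cl f) \<alpha> = Sub P f \<alpha>"
  using int_eq_Sub[of f A B "rep q P (cl f)" \<alpha>] rep_cl[of f] by (simp add: collapse_def Hom_def)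

text \<open>The point that is not formal is uniqueness of the pairing \<open>[h]\<close> of \<open>[f]\<close> and \<open>[g]\<close>: its projections agree
with \<open>f\<close> and \<open>g\<close> up to internal equality only, and \<open>int_eq_pair\<close> turns this into internal equality of
\<open>h\<close> and \<open>(f, g)\<close>.\<close>

lemma category_with_products_collapse: "category_with_products PX"
proof (intro category_with_products.intro category_with_products_axioms.intro)
  show "category PX"
  proof
    show "Dom PX x \<in> Ob PX" "Cod PX x \<in> Ob PX" if "x \<in> Ar PX" for x
      using that by (auto simp: Dom_cl Cod_cl dom_ob cod_ob)
    show "Idn PX A \<in> Hom PX A A" if "A \<in> Ob PX" for A
      using cl_in[OF idn_hom] that by simp
    show "y \<cdot>\<^bsub>PX\<^esub> x \<in> Hom PX (Dom PX x) (Cod PX y)" if c: "x \<in> Ar PX" "y \<in> Ar PX" "Dom PX y = Cod PX x" for x y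
    proof -
      obtain f g where e: "f \<in> Ar P" "g \<in> Ar P" "x = cl f" "y = cl g" using c(1,2) by auto
      then have f: "f \<in> Hom P (Dom P f) (Cod P f)" and g: "g \<in> Hom P (Cod P f) (Cod P g)"
        using c(3) by (auto simp: Dom_cl Cod_cl Hom_def)
      show ?thesis using comp_cl[OF f g] cl_in[OF comp_in[OF f g]] e by (simp add: Dom_cl Cod_cl)
    qed
    show "x \<cdot>\<^bsub>PX\<^esub> Idn PX (Dom PX x) = x" "Idn PX (Cod PX x) \<cdot>\<^bsub>PX\<^esub> x = x" if x: "x \<in> Ar PX" for x
    proof -
      obtain f where e: "f \<in> Ar P" "x = cl f" using x by auto
      then have f: "f \<in> Hom P (Dom P f) (Cod P f)" by (auto simp: Hom_def)
      note i = idn_hom[OF dom_ob[OF e(1)]] idn_hom[OF cod_ob[OF e(1)]]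
      show "x \<cdot>\<^bsub>PX\<^esub> Idn PX (Dom PX x) = x" "Idn PX (Cod PX x) \<cdot>\<^bsub>PX\<^esub> x = x"
        using comp_cl[OF i(1) f] comp_cl[OF f i(2)] e comp_idn[OF e(1)] idn_comp[OF e(1)]
        by (simp_all add: Dom_cl Cod_cl)
    qed
    show "(z \<cdot>\<^bsub>PX\<^esub> y) \<cdot>\<^bsub>PX\<^esub> x = z \<cdot>\<^bsub>PX\<^esub> (y \<cdot>\<^bsub>PX\<^esub> x)"
      if c: "x \<in> Ar PX" "y \<in> Ar PX" "z \<in> Ar PX" "Dom PX y = Cod PX x" "Dom PX z = Cod PX y" for x y z
    proof -
      obtain f g h where e: "f \<in> Ar P" "g \<in> Ar P" "h \<in> Ar P" "x = cl f" "y = cl g" "z = cl h"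
        using c(1-3) by auto
      then have f: "f \<in> Hom P (Dom P f) (Cod P f)" and g: "g \<in> Hom P (Cod P f) (Cod P g)"
        and h: "h \<in> Hom P (Cod P g) (Cod P h)"
        using c(4,5) by (auto simp: Dom_cl Cod_cl Hom_def)
      show ?thesis unfolding e(4-6)
        using comp_cl[OF f g] comp_cl[OF g h] comp_cl[OF comp_in[OF f g] h] comp_cl[OF f comp_in[OF g h]]
          assoc_in[OF f g h] by simp
    qed
  qed
next
  fix A B assume "A \<in> Ob PX" "B \<in> Ob PX"
  then have A: "A \<in> Ob P" and B: "B \<in> Ob P" by auto
  note p = pr_in[OF A B]
  show "is_product PX A B (Prd PX A B) (Pr1 PX A B) (Pr2 PX A B)"
    unfolding is_product_def collapse_simps
  proof (intro conjI ballI impI)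
    show "Prd P A B \<in> Ob P" by (rule p(1))
    show "cl (Pr1 P A B) \<in> Hom PX (Prd P A B) A" "cl (Pr2 P A B) \<in> Hom PX (Prd P A B) B"
      by (rule cl_in[OF p(2)] cl_in[OF p(3)])+
    fix x y assume "x \<in> cl ` Ar P" "y \<in> cl ` Ar P" and s: "Dom PX x = Dom PX y \<and> Cod PX x = A \<and> Cod PX y = B"
    then obtain f g where e: "f \<in> Ar P" "g \<in> Ar P" "x = cl f" "y = cl g" by auto
    define Z where "Z = Dom P f"
    have Z: "Dom PX x = Z" using e by (simp add: Dom_cl Z_def)
    have f: "f \<in> Hom P Z A" and g: "g \<in> Hom P Z B"
      using e s by (auto simp: Dom_cl Cod_cl Hom_def Z_def)
    show "\<exists>!h. h \<in> Hom PX (Dom PX x) (Prd P A B) \<and> cl (Pr1 P A B) \<cdot>\<^bsub>PX\<^esub> h = x \<and> cl (Pr2 P A B) \<cdot>\<^bsub>PX\<^esub> h = y"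
      unfolding Z
    proof (rule ex1I[of _ "cl (pair P f g)"])
      show "cl (pair P f g) \<in> Hom PX Z (Prd P A B) \<and> cl (Pr1 P A B) \<cdot>\<^bsub>PX\<^esub> cl (pair P f g) = x
          \<and> cl (Pr2 P A B) \<cdot>\<^bsub>PX\<^esub> cl (pair P f g) = y"
        using cl_in[OF pair_in[OF f g]] comp_cl[OF pair_in[OF f g] p(2)] comp_cl[OF pair_in[OF f g] p(3)]
          pr1_pair[OF f g] pr2_pair[OF f g] e by simp
      fix k assume k: "k \<in> Hom PX Z (Prd P A B) \<and> cl (Pr1 P A B) \<cdot>\<^bsub>PX\<^esub> k = x \<and> cl (Pr2 P A B) \<cdot>\<^bsub>PX\<^esub> k = y"
      then obtain h where h: "h \<in> Hom P Z (Prd P A B)" "k = cl h" using Hom_PX by blast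
      note h1 = comp_in[OF h(1) p(2)] and h2 = comp_in[OF h(1) p(3)]
      have "cl (Pr1 P A B \<cdot> h) = cl f" "cl (Pr2 P A B \<cdot> h) = cl g"
        using k h(2) e comp_cl[OF h(1) p(2)] comp_cl[OF h(1) p(3)] by simp_all
      then have "int_eq P (Pr1 P A B \<cdot> h) f" "int_eq P (Pr2 P A B \<cdot> h) g"
        using cl_eq_iff h1 h2 e by (auto simp: Hom_def)
      from int_eq_pair[OF h1 h2 this] have "int_eq P h (pair P f g)"
        using pair_eqI[OF h(1) refl refl h1 h2] by simp
      then show "k = cl (pair P f g)"
        using cl_eq_iff[of h "pair P f g"] h pair_in[OF f g] by (simp add: Hom_def)
    qed
  qed
qed

lemma pair_cl:
  assumes f: "f \<in> Hom P Z A" and g: "g \<in> Hom P Z B"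
  shows "pair PX (cl f) (cl g) = cl (pair P f g)"
proof -
  interpret X: category_with_products PX by (rule category_with_products_collapse)
  have A: "A \<in> Ob P" and B: "B \<in> Ob P" using f g Hom_ob by blast+
  note p = pr_in[OF A B] and h = pair_in[OF f g]
  show ?thesis
    by (rule X.pair_eqI[symmetric, of _ Z A B])
      (use comp_cl[OF h p(2)] comp_cl[OF h p(3)] pr1_pair[OF f g] pr2_pair[OF f g] cl_in[OF h] cl_in[OF f] cl_in[OF g]
        in simp_all)
qed

text \<open>The fibres and the reindexing maps are those of \<open>P\<close>, so the same \<open>\<delta>\<close> satisfies the two adjunctions.\<close>

lemma elementary_doctrine_collapse: "elementary_doctrine PX"
  and delta_collapse: "A \<in> Ob P \<Longrightarrow> delta PX A = delta P A"
proof -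
  interpret X: category_with_products PX by (rule category_with_products_collapse)
  have D: "doctrine PX"
  proof (intro doctrine.intro doctrine_axioms.intro category_with_products_collapse)
    show "inf_semilattice (Fib PX A)" if "A \<in> Ob PX" for A using fib that by simp
    show "inf_hom (Fib PX (Cod PX x)) (Fib PX (Dom PX x)) (Sub PX x)" if "x \<in> Ar PX" for x
      using sub_hom[OF rep_Ar[OF that]] by (simp add: collapse_def)
    show "Sub PX (Idn PX A) \<alpha> = \<alpha>" if "A \<in> Ob PX" "\<alpha> \<in> carrier (Fib PX A)" for A \<alpha>
      using that Sub_cl[OF idn_hom] sub_idn by simp
    show "Sub PX (y \<cdot>\<^bsub>PX\<^esub> x) \<alpha> = Sub PX x (Sub PX y \<alpha>)"
      if c: "x \<in> Ar PX" "y \<in> Ar PX" "Dom PX y = Cod PX x" "\<alpha> \<in> carrier (Fib PX (Cod PX y))" for x y \<alpha>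
    proof -
      obtain f g where e: "f \<in> Ar P" "g \<in> Ar P" "x = cl f" "y = cl g" using c(1,2) by auto
      then have f: "f \<in> Hom P (Dom P f) (Cod P f)" and g: "g \<in> Hom P (Cod P f) (Cod P g)"
        and \<alpha>: "\<alpha> \<in> carrier (Fib P (Cod P g))"
        using c(3,4) by (auto simp: Dom_cl Cod_cl Hom_def)
      show ?thesis unfolding e(3,4)
        using comp_cl[OF f g] Sub_cl[OF comp_in[OF f g] \<alpha>] Sub_cl[OF g \<alpha>] Sub_cl[OF f sub_in[OF g \<alpha>]]
          sub_sub[OF f g \<alpha>] by simp
    qed
  qed
  have d: "is_delta PX A (delta P A)" if A: "A \<in> Ob P" for A
    unfolding is_delta_def Let_def collapse_simps
  proof (intro conjI ballI)
    note i = idn_hom[OF A] and p = pr_in[OF A A] and dA = is_delta_delta[OF A, unfolded is_delta_def Let_def]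
    have dg: "diag PX A = cl (diag P A)" "diag P A \<in> Hom P A (Prd P A A)"
      using pair_cl[OF i i] pair_in[OF i i] by (simp_all add: diag_def)
    show "delta P A \<in> carrier (Fib P (Prd P A A))" by (rule delta_in[OF A])
    show "Sub PX (cl (Pr1 P A A)) \<alpha> \<sqinter>\<^bsub>Fib P (Prd P A A)\<^esub> delta P A \<sqsubseteq>\<^bsub>Fib P (Prd P A A)\<^esub> \<beta> \<longleftrightarrow>
        \<alpha> \<sqsubseteq>\<^bsub>Fib P A\<^esub> Sub PX (diag PX A) \<beta>"
      if "\<alpha> \<in> carrier (Fib P A)" "\<beta> \<in> carrier (Fib P (Prd P A A))" for \<alpha> \<beta>
      using dA that Sub_cl[OF p(2) that(1)] Sub_cl[OF dg(2) that(2)] dg(1) by simp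
    fix X \<alpha> \<beta> assume X: "X \<in> Ob P" and \<alpha>: "\<alpha> \<in> carrier (Fib P (Prd P X A))"
      and \<beta>: "\<beta> \<in> carrier (Fib P (Prd P (Prd P X A) A))"
    note r = pr_in[OF X A] and t = pr_in[OF pr_in(1)[OF X A] A]
    have tc: "tpr1 PX X A = cl (tpr1 P X A)" "tpr2 PX X A = cl (tpr2 P X A)" "tpr3 PX X A = cl (tpr3 P X A)"
      unfolding tpr1_def tpr2_def tpr3_def using comp_cl[OF t(2) r(2)] comp_cl[OF t(2) r(3)] by simp_all
    have ti: "tpr1 P X A \<in> Hom P (Prd P (Prd P X A) A) X" "tpr2 P X A \<in> Hom P (Prd P (Prd P X A) A) A"
      "tpr3 P X A \<in> Hom P (Prd P (Prd P X A) A) A"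
      unfolding tpr1_def tpr2_def tpr3_def by (rule comp_in[OF t(2) r(2)] comp_in[OF t(2) r(3)] t(3))+
    note e = pair_in[OF pair_in[OF r(2) r(3)] r(3)]
    show "Sub PX (pair PX (tpr1 PX X A) (tpr2 PX X A)) \<alpha>
        \<sqinter>\<^bsub>Fib P (Prd P (Prd P X A) A)\<^esub> Sub PX (pair PX (tpr2 PX X A) (tpr3 PX X A)) (delta P A)
        \<sqsubseteq>\<^bsub>Fib P (Prd P (Prd P X A) A)\<^esub> \<beta> \<longleftrightarrow>
        \<alpha> \<sqsubseteq>\<^bsub>Fib P (Prd P X A)\<^esub>
          Sub PX (pair PX (pair PX (cl (Pr1 P X A)) (cl (Pr2 P X A))) (cl (Pr2 P X A))) \<beta>"
      unfolding tc using dA[THEN conjunct2, THEN conjunct2, rule_format, OF X \<alpha> \<beta>]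
        pair_cl[OF ti(1,2)] pair_cl[OF ti(2,3)] pair_cl[OF r(2,3)] pair_cl[OF pair_in[OF r(2) r(3)] r(3)]
        Sub_cl[OF pair_in[OF ti(1,2)] \<alpha>] Sub_cl[OF pair_in[OF ti(2,3)] delta_in[OF A]] Sub_cl[OF e \<beta>]
      by simp
  qed
  show E: "elementary_doctrine PX"
    by (intro elementary_doctrine.intro elementary_doctrine_axioms.intro D) (use d in auto)
  show "delta PX A = delta P A" if "A \<in> Ob P" for A
    using elementary_doctrine.delta_unique[OF E] elementary_doctrine.is_delta_delta[OF E] d[OF that] that by simp
qed

lemma int_eq_cl:
  assumes f: "f \<in> Hom P A B" and g: "g \<in> Hom P A B"
  shows "int_eq PX (cl f) (cl g) \<longleftrightarrow> int_eq P f g"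
proof -
  have B: "B \<in> Ob P" using f Hom_ob by blast
  show ?thesis
    using elementary_doctrine.int_eq_iff[OF elementary_doctrine_collapse cl_in[OF f] cl_in[OF g]]
      int_eq_iff[OF f g] pair_cl[OF f g] Sub_cl[OF pair_in[OF f g] delta_in[OF B]] delta_collapse[OF B] by simp
qed

text \<open>As \<open>\<delta>\<close> does not change, arrows \<open>[f]\<close> and \<open>[g]\<close> are internally equal iff \<open>f\<close> and \<open>g\<close> are, hence iff
\<open>[f] = [g]\<close>.\<close>

lemma comprehensive_diagonals_collapse: "comprehensive_diagonals PX"
proof -
  interpret X: elementary_doctrine PX by (rule elementary_doctrine_collapse)
  have "x = y" if xy: "int_eq PX x y" for x y
  proof -
    obtain A B where "x \<in> Hom PX A B" "y \<in> Hom PX A B" using X.int_eqE[OF xy] by blast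
    then obtain f g where "f \<in> Hom P A B" "g \<in> Hom P A B" "x = cl f" "y = cl g" using Hom_PX by meson
    then show ?thesis using xy int_eq_cl cl_eq_iff by (auto simp: Hom_def)
  qed
  then show ?thesis using X.comprehensive_diagonals_iff by blast
qed

lemma rep_cl_eq: "\<lbrakk>comprehensive_diagonals P; f \<in> Ar P\<rbrakk> \<Longrightarrow> rep q P (cl f) = f"
  using comprehensive_diagonals_iff rep_cl by metis

end

section \<open>Product-preserving functors\<close>

lemma is_functorD:
  assumes "is_functor C D Fo Fa"
  shows "A \<in> Ob C \<Longrightarrow> Fo A \<in> Ob D"
    and "f \<in> Hom C A B \<Longrightarrow> Fa f \<in> Hom D (Fo A) (Fo B)"
    and "A \<in> Ob C \<Longrightarrow> Fa (Idn C A) = Idn D (Fo A)"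
    and "\<lbrakk>f \<in> Hom C A B; g \<in> Hom C B E\<rbrakk> \<Longrightarrow> Fa (g \<cdot>\<^bsub>C\<^esub> f) = Fa g \<cdot>\<^bsub>D\<^esub> Fa f"
  using assms by (auto simp: is_functor_def Hom_def)

lemma is_functorI:
  assumes "\<And>A. A \<in> Ob C \<Longrightarrow> Fo A \<in> Ob D"
    and "\<And>f A B. f \<in> Hom C A B \<Longrightarrow> Fa f \<in> Hom D (Fo A) (Fo B)"
    and "\<And>A. A \<in> Ob C \<Longrightarrow> Fa (Idn C A) = Idn D (Fo A)"
    and "\<And>f g A B E. \<lbrakk>f \<in> Hom C A B; g \<in> Hom C B E\<rbrakk> \<Longrightarrow> Fa (g \<cdot>\<^bsub>C\<^esub> f) = Fa g \<cdot>\<^bsub>D\<^esub> Fa f"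
  shows "is_functor C D Fo Fa"
  using assms by (simp add: is_functor_def Hom_def)

lemma is_productD:
  assumes "is_product C A B W p q" and "f \<in> Hom C Z A" and "g \<in> Hom C Z B"
  shows "\<exists>!h. h \<in> Hom C Z W \<and> p \<cdot>\<^bsub>C\<^esub> h = f \<and> q \<cdot>\<^bsub>C\<^esub> h = g"
proof -
  have "f \<in> Ar C" "g \<in> Ar C" "Dom C f = Dom C g \<and> Cod C f = A \<and> Cod C g = B" and Z: "Dom C f = Z"
    using assms(2,3) by (auto simp: Hom_def)
  from assms(1)[unfolded is_product_def, THEN conjunct2, THEN conjunct2, THEN conjunct2, rule_format, OF this(1-3)]
  show ?thesis unfolding Z .
qed

lemma is_productI:
  assumes "W \<in> Ob C" "p \<in> Hom C W A" "q \<in> Hom C W B"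
    and "\<And>Z f g. \<lbrakk>f \<in> Hom C Z A; g \<in> Hom C Z B\<rbrakk> \<Longrightarrow>
      \<exists>!h. h \<in> Hom C Z W \<and> p \<cdot>\<^bsub>C\<^esub> h = f \<and> q \<cdot>\<^bsub>C\<^esub> h = g"
  shows "is_product C A B W p q"
  unfolding is_product_def by (intro conjI ballI impI assms) (auto simp: Hom_def)

text \<open>Every product cone on \<open>A\<close>, \<open>B\<close> is isomorphic to the chosen one, and functors preserve isomorphisms.
This is why morphisms of doctrines compose: the image of a chosen product need not be chosen.\<close>

lemma preserves_is_product:
  assumes C: "category_with_products C" and D: "category D"
    and F: "is_functor C D Fo Fa" and pres: "preserves_products C D Fo Fa"
    and W: "is_product C A B W p q" and A: "A \<in> Ob C" and B: "B \<in> Ob C"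
  shows "is_product D (Fo A) (Fo B) (Fo W) (Fa p) (Fa q)"
proof -
  interpret C: category_with_products C by (rule C)
  interpret D: category D by (rule D)
  note F = is_functorD[OF F] and pr = C.pr_in[OF A B]
  have Wo: "W \<in> Ob C" and p: "p \<in> Hom C W A" and q: "q \<in> Hom C W B" using W by (auto simp: is_product_def)
  have c: "pair C p q \<in> Hom C W (Prd C A B)" by (rule C.pair_in[OF p q])
  obtain k where k: "k \<in> Hom C (Prd C A B) W" "p \<cdot>\<^bsub>C\<^esub> k = Pr1 C A B" "q \<cdot>\<^bsub>C\<^esub> k = Pr2 C A B"
    using is_productD[OF W pr(2,3)] by blast
  \<comment> \<open>The comparison \<open>(p, q) : W \<rightarrow> A \<times> B\<close> has the left inverse \<open>k\<close>; this is what uniqueness below needs.\<close>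
  have kc: "k \<cdot>\<^bsub>C\<^esub> pair C p q = Idn C W"
  proof -
    have "p \<cdot>\<^bsub>C\<^esub> (k \<cdot>\<^bsub>C\<^esub> pair C p q) = p" "q \<cdot>\<^bsub>C\<^esub> (k \<cdot>\<^bsub>C\<^esub> pair C p q) = q"
      using C.assoc_in[OF c k(1) p] C.assoc_in[OF c k(1) q] k C.pr1_pair[OF p q] C.pr2_pair[OF p q] by simp_all
    moreover have "p \<cdot>\<^bsub>C\<^esub> Idn C W = p" "q \<cdot>\<^bsub>C\<^esub> Idn C W = q"
      using C.comp_idn[of p] C.comp_idn[of q] p q by (auto simp: Hom_def)
    ultimately show ?thesis
      using is_productD[OF W p q] C.comp_in[OF c k(1)] C.idn_hom[OF Wo] by blast
  qed
  note FPr = pres[unfolded preserves_products_def, rule_format, OF A B]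
  note Fp = F(2)[OF p] and Fq = F(2)[OF q] and Fk = F(2)[OF k(1)] and Fc = F(2)[OF c]
    and F1 = F(2)[OF pr(2)] and F2 = F(2)[OF pr(3)]
  have Fpk: "Fa p \<cdot>\<^bsub>D\<^esub> Fa k = Fa (Pr1 C A B)" "Fa q \<cdot>\<^bsub>D\<^esub> Fa k = Fa (Pr2 C A B)"
    using F(4)[OF k(1) p] F(4)[OF k(1) q] k by simp_all
  have Fpc: "Fa (Pr1 C A B) \<cdot>\<^bsub>D\<^esub> Fa (pair C p q) = Fa p" "Fa (Pr2 C A B) \<cdot>\<^bsub>D\<^esub> Fa (pair C p q) = Fa q"
    using F(4)[OF c pr(2)] F(4)[OF c pr(3)] C.pr1_pair[OF p q] C.pr2_pair[OF p q] by simp_all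
  have Fkc: "Fa k \<cdot>\<^bsub>D\<^esub> Fa (pair C p q) = Idn D (Fo W)"
    using F(4)[OF c k(1)] kc F(3)[OF Wo] by simp
  show ?thesis
  proof (rule is_productI[OF F(1)[OF Wo] Fp Fq])
    fix Z f g assume f: "f \<in> Hom D Z (Fo A)" and g: "g \<in> Hom D Z (Fo B)"
    note u = is_productD[OF FPr f g]
    obtain h where h: "h \<in> Hom D Z (Fo (Prd C A B))" "Fa (Pr1 C A B) \<cdot>\<^bsub>D\<^esub> h = f" "Fa (Pr2 C A B) \<cdot>\<^bsub>D\<^esub> h = g"
      using u by blast
    show "\<exists>!h. h \<in> Hom D Z (Fo W) \<and> Fa p \<cdot>\<^bsub>D\<^esub> h = f \<and> Fa q \<cdot>\<^bsub>D\<^esub> h = g"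
    proof (rule ex1I[of _ "Fa k \<cdot>\<^bsub>D\<^esub> h"])
      show "Fa k \<cdot>\<^bsub>D\<^esub> h \<in> Hom D Z (Fo W) \<and> Fa p \<cdot>\<^bsub>D\<^esub> (Fa k \<cdot>\<^bsub>D\<^esub> h) = f \<and> Fa q \<cdot>\<^bsub>D\<^esub> (Fa k \<cdot>\<^bsub>D\<^esub> h) = g"
        using D.comp_in[OF h(1) Fk] D.assoc_in[OF h(1) Fk Fp] D.assoc_in[OF h(1) Fk Fq] Fpk h by simp
      fix l assume l: "l \<in> Hom D Z (Fo W) \<and> Fa p \<cdot>\<^bsub>D\<^esub> l = f \<and> Fa q \<cdot>\<^bsub>D\<^esub> l = g"
      then have lH: "l \<in> Hom D Z (Fo W)" by blast
      have "Fa (pair C p q) \<cdot>\<^bsub>D\<^esub> l = h"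
        using D.comp_in[OF lH Fc] D.assoc_in[OF lH Fc F1] D.assoc_in[OF lH Fc F2] Fpc l h u by metis
      then have "Fa k \<cdot>\<^bsub>D\<^esub> h = (Fa k \<cdot>\<^bsub>D\<^esub> Fa (pair C p q)) \<cdot>\<^bsub>D\<^esub> l"
        using D.assoc_in[OF lH Fc Fk] by simp
      then show "l = Fa k \<cdot>\<^bsub>D\<^esub> h" using Fkc D.idn_comp[of l] lH by (auto simp: Hom_def)
    qed
  qed
qed

section \<open>Morphisms of elementary doctrines\<close>

lemma doctrine_morphismD:
  assumes "doctrine_morphism M"
  shows mor_src: "elementary_doctrine (MSrc M)" and mor_tgt: "elementary_doctrine (MTgt M)"
    and mor_functor: "is_functor (MSrc M) (MTgt M) (MOb M) (MAr M)"
    and mor_products: "preserves_products (MSrc M) (MTgt M) (MOb M) (MAr M)"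
    and mor_inf: "A \<in> Ob (MSrc M) \<Longrightarrow> inf_hom (Fib (MSrc M) A) (Fib (MTgt M) (MOb M A)) (MFib M A)"
    and mor_delta: "A \<in> Ob (MSrc M) \<Longrightarrow> MFib M (Prd (MSrc M) A A) (delta (MSrc M) A) =
       Sub (MTgt M) (pair (MTgt M) (MAr M (Pr1 (MSrc M) A A)) (MAr M (Pr2 (MSrc M) A A))) (delta (MTgt M) (MOb M A))"
    and mor_nat: "\<lbrakk>f \<in> Hom (MSrc M) A B; \<alpha> \<in> carrier (Fib (MSrc M) B)\<rbrakk> \<Longrightarrow>
       MFib M A (Sub (MSrc M) f \<alpha>) = Sub (MTgt M) (MAr M f) (MFib M B \<alpha>)"
    and mor_ext: "MOb M \<in> extensional (Ob (MSrc M))" "MAr M \<in> extensional (Ar (MSrc M))"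
      "MFib M \<in> extensional (Ob (MSrc M))"
      "A \<in> Ob (MSrc M) \<Longrightarrow> MFib M A \<in> extensional (carrier (Fib (MSrc M) A))"
  using assms by (auto simp: doctrine_morphism_def Let_def Hom_def)

lemmas mor_Ob = is_functorD(1)[OF mor_functor] and mor_Ar = is_functorD(2)[OF mor_functor]
  and mor_Idn = is_functorD(3)[OF mor_functor] and mor_Comp = is_functorD(4)[OF mor_functor]
  and mor_Fib = inf_hom_closed[OF mor_inf]

lemma doctrine_morphismI:
  assumes "elementary_doctrine (MSrc M)" "elementary_doctrine (MTgt M)"
    and "is_functor (MSrc M) (MTgt M) (MOb M) (MAr M)"
    and "preserves_products (MSrc M) (MTgt M) (MOb M) (MAr M)"
    and "\<And>A. A \<in> Ob (MSrc M) \<Longrightarrow> inf_hom (Fib (MSrc M) A) (Fib (MTgt M) (MOb M A)) (MFib M A)"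
    and "\<And>A. A \<in> Ob (MSrc M) \<Longrightarrow> MFib M (Prd (MSrc M) A A) (delta (MSrc M) A) =
       Sub (MTgt M) (pair (MTgt M) (MAr M (Pr1 (MSrc M) A A)) (MAr M (Pr2 (MSrc M) A A))) (delta (MTgt M) (MOb M A))"
    and "\<And>f A B \<alpha>. \<lbrakk>f \<in> Hom (MSrc M) A B; \<alpha> \<in> carrier (Fib (MSrc M) B)\<rbrakk> \<Longrightarrow>
       MFib M A (Sub (MSrc M) f \<alpha>) = Sub (MTgt M) (MAr M f) (MFib M B \<alpha>)"
    and "MOb M \<in> extensional (Ob (MSrc M))" "MAr M \<in> extensional (Ar (MSrc M))"
      "MFib M \<in> extensional (Ob (MSrc M))"
      "\<And>A. A \<in> Ob (MSrc M) \<Longrightarrow> MFib M A \<in> extensional (carrier (Fib (MSrc M) A))"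
  shows "doctrine_morphism M"
  using assms by (simp add: doctrine_morphism_def Let_def Hom_def)

text \<open>The components of a 1-cell are \<open>undefined\<close> outside their domains, so 1-cells are equal as soon as they
agree on cells of the source. All equations between 1-cells are proved through this lemma.\<close>

lemma doctrine_mor_eqI:
  assumes M: "doctrine_morphism M" and N: "doctrine_morphism N"
    and src: "MSrc M = MSrc N" and tgt: "MTgt M = MTgt N"
    and Ob: "\<And>A. A \<in> Ob (MSrc N) \<Longrightarrow> MOb M A = MOb N A"
    and Ar: "\<And>f. f \<in> Ar (MSrc N) \<Longrightarrow> MAr M f = MAr N f"
    and Fib: "\<And>A \<alpha>. \<lbrakk>A \<in> Ob (MSrc N); \<alpha> \<in> carrier (Fib (MSrc N) A)\<rbrakk> \<Longrightarrow> MFib M A \<alpha> = MFib N A \<alpha>"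
  shows "M = N"
proof -
  have "MOb M = MOb N"
    using mor_ext(1)[OF M] mor_ext(1)[OF N] Ob unfolding src by (rule extensionalityI)
  moreover have "MAr M = MAr N"
    using mor_ext(2)[OF M] mor_ext(2)[OF N] Ar unfolding src by (rule extensionalityI)
  moreover have "MFib M A = MFib N A" if "A \<in> Ob (MSrc N)" for A
    using mor_ext(4)[OF M, of A] mor_ext(4)[OF N, of A] Fib[of A] that unfolding src
    by (auto intro: extensionalityI)
  then have "MFib M = MFib N"
    using mor_ext(3)[OF M] mor_ext(3)[OF N] unfolding src by (auto intro: extensionalityI)
  ultimately show ?thesis using src tgt by (intro doctrine_mor.equality) simp_all
qed

lemma doctrine_comp_simps [simp]:
  "MSrc (doctrine_comp N M) = MSrc M" "MTgt (doctrine_comp N M) = MTgt N"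
  "A \<in> Ob (MSrc M) \<Longrightarrow> MOb (doctrine_comp N M) A = MOb N (MOb M A)"
  "f \<in> Ar (MSrc M) \<Longrightarrow> MAr (doctrine_comp N M) f = MAr N (MAr M f)"
  "\<lbrakk>A \<in> Ob (MSrc M); \<alpha> \<in> carrier (Fib (MSrc M) A)\<rbrakk> \<Longrightarrow>
    MFib (doctrine_comp N M) A \<alpha> = MFib N (MOb M A) (MFib M A \<alpha>)"
  by (simp_all add: doctrine_comp_def)

lemma doctrine_id_simps [simp]:
  "MSrc (doctrine_id P) = P" "MTgt (doctrine_id P) = P"
  "A \<in> Ob P \<Longrightarrow> MOb (doctrine_id P) A = A"
  "f \<in> Ar P \<Longrightarrow> MAr (doctrine_id P) f = f"
  "\<lbrakk>A \<in> Ob P; \<alpha> \<in> carrier (Fib P A)\<rbrakk> \<Longrightarrow> MFib (doctrine_id P) A \<alpha> = \<alpha>"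
  by (simp_all add: doctrine_id_def)

context elementary_doctrine
begin

lemma pair_projections: "\<lbrakk>A \<in> Ob P; B \<in> Ob P\<rbrakk> \<Longrightarrow> pair P (Pr1 P A B) (Pr2 P A B) = Idn P (Prd P A B)"
  using pair_eqI[of "Idn P (Prd P A B)" "Prd P A B" A B "Pr1 P A B" "Pr2 P A B"] pr_in[of A B]
    idn_hom comp_idn[of "Pr1 P A B"] comp_idn[of "Pr2 P A B"] by (simp add: Hom_def)

lemma Sub_pair_projections_delta:
  "A \<in> Ob P \<Longrightarrow> Sub P (pair P (Pr1 P A A) (Pr2 P A A)) (delta P A) = delta P A"
  using pair_projections[of A A] sub_idn[OF pr_in(1)] delta_in by simp

end

text \<open>Maps between fibres are restricted to the carrier, so they agree with the intended formula there only.\<close>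

lemma inf_hom_cong:
  assumes "inf_semilattice L" and h: "inf_hom L M h" and eq: "\<And>x. x \<in> carrier L \<Longrightarrow> h' x = h x"
  shows "inf_hom L M h'"
proof -
  have "\<Sqinter>\<^bsub>L\<^esub> S \<in> carrier L" if "finite S" "S \<subseteq> carrier L" for S
    using inf_semilattice_facts(3)[OF assms(1) that] by (auto dest: greatest_closed)
  moreover have "h' ` S = h ` S" if "S \<subseteq> carrier L" for S
    using eq that by (intro image_cong) auto
  ultimately show ?thesis using h eq by (auto simp: inf_hom_def)
qed

lemma inf_hom_comp:
  assumes h: "inf_hom L M h" and k: "inf_hom M N k"
  shows "inf_hom L N (\<lambda>x. k (h x))"
  unfolding inf_hom_def
proof (intro conjI allI impI)
  show "(\<lambda>x. k (h x)) \<in> carrier L \<rightarrow> carrier N" using h k by (auto simp: inf_hom_def)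
  fix S assume S: "finite S \<and> S \<subseteq> carrier L"
  then have "finite (h ` S)" "h ` S \<subseteq> carrier M" using h by (auto simp: inf_hom_def)
  then show "k (h (\<Sqinter>\<^bsub>L\<^esub> S)) = \<Sqinter>\<^bsub>N\<^esub> ((\<lambda>x. k (h x)) ` S)"
    using inf_hom_inf[OF h] inf_hom_inf[OF k] S by (simp add: image_image)
qed

lemma inf_hom_id: "inf_hom L L (\<lambda>x. x)"
  by (simp add: inf_hom_def)

text \<open>A 1-cell sends \<open>\<delta>\<close> to the reindexing of \<open>\<delta>\<close> along \<open>F(A \<times> A) \<rightarrow> F A \<times> F A\<close>, and it preserves the top element;
so the truth of \<open>\<delta>(f, g)\<close> entails that of \<open>\<delta>(F f, F g)\<close>. Hence 1-cells act on the classes of arrows.\<close>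

lemma mor_int_eq:
  assumes M: "doctrine_morphism M" and fg: "int_eq (MSrc M) f g"
  shows "int_eq (MTgt M) (MAr M f) (MAr M g)"
proof -
  interpret P: elementary_doctrine "MSrc M" by (rule mor_src[OF M])
  interpret R: elementary_doctrine "MTgt M" by (rule mor_tgt[OF M])
  obtain A B where f: "f \<in> Hom (MSrc M) A B" and g: "g \<in> Hom (MSrc M) A B"
    and e: "Sub (MSrc M) (pair (MSrc M) f g) (delta (MSrc M) B) = \<top>\<^bsub>Fib (MSrc M) A\<^esub>"
    using P.int_eqE[OF fg] by blast
  have A: "A \<in> Ob (MSrc M)" and B: "B \<in> Ob (MSrc M)" using P.Hom_ob[OF f] by auto
  note p = P.pr_in[OF B B] and fg' = P.pair_in[OF f g]
  note Fp = mor_Ar[OF M p(2)] mor_Ar[OF M p(3)] and Ffg = mor_Ar[OF M fg']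
  have "pair (MTgt M) (MAr M f) (MAr M g) =
      pair (MTgt M) (MAr M (Pr1 (MSrc M) B B)) (MAr M (Pr2 (MSrc M) B B)) \<cdot>\<^bsub>MTgt M\<^esub> MAr M (pair (MSrc M) f g)"
    using R.pair_comp[OF Fp Ffg] mor_Comp[OF M fg' p(2)] mor_Comp[OF M fg' p(3)] P.pr1_pair[OF f g] P.pr2_pair[OF f g]
    by simp
  then have "Sub (MTgt M) (pair (MTgt M) (MAr M f) (MAr M g)) (delta (MTgt M) (MOb M B)) =
      MFib M A (Sub (MSrc M) (pair (MSrc M) f g) (delta (MSrc M) B))"
    using R.sub_sub[OF Ffg R.pair_in[OF Fp] R.delta_in[OF mor_Ob[OF M B]]] mor_delta[OF M B]
      mor_nat[OF M fg' P.delta_in[OF B]] by simp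
  also have "\<dots> = \<top>\<^bsub>Fib (MTgt M) (MOb M A)\<^esub>" using e inf_hom_top[OF mor_inf[OF M A]] by simp
  finally show ?thesis using R.int_eq_iff[OF mor_Ar[OF M f] mor_Ar[OF M g]] by blast
qed

lemma doctrine_morphism_id:
  assumes P: "elementary_doctrine P"
  shows "doctrine_morphism (doctrine_id P)"
proof -
  interpret elementary_doctrine P by (rule P)
  have c: "g \<cdot>\<^bsub>P\<^esub> f \<in> Ar P" "f \<in> Ar P" "g \<in> Ar P" if "f \<in> Hom P A B" "g \<in> Hom P B D" for f g A B D
    using comp_in[OF that] that by (auto simp: Hom_def)
  have p: "Pr1 P A B \<in> Ar P" "Pr2 P A B \<in> Ar P" "Prd P A B \<in> Ob P" if "A \<in> Ob P" "B \<in> Ob P" for A B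
    using pr_in[OF that] by (auto simp: Hom_def)
  have i: "Idn P A \<in> Ar P" if "A \<in> Ob P" for A
    using idn_hom[OF that] by (auto simp: Hom_def)
  show ?thesis
  proof (rule doctrine_morphismI; simp add: P)
    show "is_functor P P (MOb (doctrine_id P)) (MAr (doctrine_id P))"
    proof (rule is_functorI)
      show "MAr (doctrine_id P) f \<in> Hom P (MOb (doctrine_id P) A) (MOb (doctrine_id P) B)" if "f \<in> Hom P A B" for f A B
        using that Hom_ob[OF that] HomD[OF that] by simp
      show "MAr (doctrine_id P) (g \<cdot>\<^bsub>P\<^esub> f) = MAr (doctrine_id P) g \<cdot>\<^bsub>P\<^esub> MAr (doctrine_id P) f"
        if "f \<in> Hom P A B" "g \<in> Hom P B D" for f g A B D
        using c[OF that] by simp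
    qed (use i in simp_all)
    show "preserves_products P P (MOb (doctrine_id P)) (MAr (doctrine_id P))"
      unfolding preserves_products_def using p products by simp
    show "inf_hom (Fib P A) (Fib P A) (MFib (doctrine_id P) A)" if "A \<in> Ob P" for A
      by (rule inf_hom_cong[OF fib[OF that] inf_hom_id]) (use that in simp)
    show "MFib (doctrine_id P) (Prd P A A) (delta P A) =
        Sub P (pair P (MAr (doctrine_id P) (Pr1 P A A)) (MAr (doctrine_id P) (Pr2 P A A))) (delta P A)"
      if "A \<in> Ob P" for A
      using that p delta_in Sub_pair_projections_delta by simp
    show "MFib (doctrine_id P) A (Sub P f \<alpha>) = Sub P (MAr (doctrine_id P) f) (MFib (doctrine_id P) B \<alpha>)"
      if "f \<in> Hom P A B" "\<alpha> \<in> carrier (Fib P B)" for f A B \<alpha>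
      using that sub_in[OF that] Hom_ob[OF that(1)] HomD[OF that(1)] by simp
  qed (simp_all add: doctrine_id_def)
qed

lemma doctrine_morphism_comp:
  assumes M: "doctrine_morphism M" and N: "doctrine_morphism N" and MN: "MSrc N = MTgt M"
  shows "doctrine_morphism (doctrine_comp N M)"
proof -
  interpret P: elementary_doctrine "MSrc M" by (rule mor_src[OF M])
  interpret Q: elementary_doctrine "MTgt M" by (rule mor_tgt[OF M])
  interpret R: elementary_doctrine "MTgt N" by (rule mor_tgt[OF N])
  note N' = mor_Ob[OF N, unfolded MN] mor_Ar[OF N, unfolded MN] mor_Idn[OF N, unfolded MN]
    mor_Comp[OF N, unfolded MN] mor_nat[OF N, unfolded MN] mor_delta[OF N, unfolded MN]
  have Ar: "f \<in> Hom (MSrc M) A B \<Longrightarrow> f \<in> Ar (MSrc M)" for f A B by (simp add: Hom_def)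
  show ?thesis
  proof (rule doctrine_morphismI; simp add: mor_src[OF M] mor_tgt[OF N])
    show "is_functor (MSrc M) (MTgt N) (MOb (doctrine_comp N M)) (MAr (doctrine_comp N M))"
    proof (rule is_functorI)
      show "MOb (doctrine_comp N M) A \<in> Ob (MTgt N)" if "A \<in> Ob (MSrc M)" for A
        using that mor_Ob[OF M] N' by simp
      show "MAr (doctrine_comp N M) f \<in> Hom (MTgt N) (MOb (doctrine_comp N M) A) (MOb (doctrine_comp N M) B)"
        if "f \<in> Hom (MSrc M) A B" for f A B
        using N'(2)[OF mor_Ar[OF M that]] P.Hom_ob[OF that] Ar[OF that] by simp
      show "MAr (doctrine_comp N M) (Idn (MSrc M) A) = Idn (MTgt N) (MOb (doctrine_comp N M) A)"
        if "A \<in> Ob (MSrc M)" for A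
        using that mor_Ob[OF M] mor_Idn[OF M] N' Ar[OF P.idn_hom] by simp
      show "MAr (doctrine_comp N M) (g \<cdot>\<^bsub>MSrc M\<^esub> f) =
          MAr (doctrine_comp N M) g \<cdot>\<^bsub>MTgt N\<^esub> MAr (doctrine_comp N M) f"
        if "f \<in> Hom (MSrc M) A B" "g \<in> Hom (MSrc M) B E" for f g A B E
        using N'(4)[OF mor_Ar[OF M that(1)] mor_Ar[OF M that(2)]] mor_Comp[OF M that] Ar[OF that(1)] Ar[OF that(2)]
          Ar[OF P.comp_in[OF that]] by simp
    qed
    show "preserves_products (MSrc M) (MTgt N) (MOb (doctrine_comp N M)) (MAr (doctrine_comp N M))"
      unfolding preserves_products_def
    proof (intro ballI)
      fix A B assume A: "A \<in> Ob (MSrc M)" and B: "B \<in> Ob (MSrc M)"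
      note p = P.pr_in[OF A B]
      have "is_product (MTgt M) (MOb M A) (MOb M B) (MOb M (Prd (MSrc M) A B)) (MAr M (Pr1 (MSrc M) A B)) (MAr M (Pr2 (MSrc M) A B))"
        using mor_products[OF M] A B by (simp add: preserves_products_def)
      from preserves_is_product[OF Q.category_with_products_axioms R.category_axioms mor_functor[OF N, unfolded MN]
        mor_products[OF N, unfolded MN] this mor_Ob[OF M A] mor_Ob[OF M B]]
      show "is_product (MTgt N) (MOb (doctrine_comp N M) A) (MOb (doctrine_comp N M) B)
         (MOb (doctrine_comp N M) (Prd (MSrc M) A B)) (MAr (doctrine_comp N M) (Pr1 (MSrc M) A B))
         (MAr (doctrine_comp N M) (Pr2 (MSrc M) A B))"
        using A B p Ar[OF p(2)] Ar[OF p(3)] by simp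
    qed
    show "inf_hom (Fib (MSrc M) A) (Fib (MTgt N) (MOb N (MOb M A))) (MFib (doctrine_comp N M) A)"
      if A: "A \<in> Ob (MSrc M)" for A
      by (rule inf_hom_cong[OF P.fib[OF A] inf_hom_comp[OF mor_inf[OF M A] mor_inf[OF N, unfolded MN, OF mor_Ob[OF M A]]]])
        (use A in simp)
    \<comment> \<open>The comparison \<open>G(F(A \<times> A)) \<rightarrow> G(F A) \<times> G(F A)\<close> is the image under \<open>G\<close> of that of \<open>F\<close>, followed by that
      of \<open>G\<close> at \<open>F A\<close>; here \<open>F\<close>, \<open>G\<close> are the functors of \<open>M\<close>, \<open>N\<close>.\<close>
    show "MFib (doctrine_comp N M) (Prd (MSrc M) A A) (delta (MSrc M) A) =
        Sub (MTgt N) (pair (MTgt N) (MAr (doctrine_comp N M) (Pr1 (MSrc M) A A)) (MAr (doctrine_comp N M) (Pr2 (MSrc M) A A)))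
          (delta (MTgt N) (MOb N (MOb M A)))"
      if A: "A \<in> Ob (MSrc M)" for A
    proof -
      note p = P.pr_in[OF A A] and MA = mor_Ob[OF M A]
      note r = Q.pr_in[OF MA MA]
      define f1 where "f1 = MAr M (Pr1 (MSrc M) A A)"
      define f2 where "f2 = MAr M (Pr2 (MSrc M) A A)"
      have f: "f1 \<in> Hom (MTgt M) (MOb M (Prd (MSrc M) A A)) (MOb M A)" "f2 \<in> Hom (MTgt M) (MOb M (Prd (MSrc M) A A)) (MOb M A)"
        unfolding f1_def f2_def by (rule mor_Ar[OF M p(2)] mor_Ar[OF M p(3)])+
      note k = Q.pair_in[OF f]
      note g = N'(2)[OF r(2)] N'(2)[OF r(3)]
      have "MFib (doctrine_comp N M) (Prd (MSrc M) A A) (delta (MSrc M) A) =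
          MFib N (MOb M (Prd (MSrc M) A A)) (Sub (MTgt M) (pair (MTgt M) f1 f2) (delta (MTgt M) (MOb M A)))"
        using p(1) P.delta_in[OF A] mor_delta[OF M A] by (simp add: f1_def f2_def)
      also have "\<dots> = Sub (MTgt N) (MAr N (pair (MTgt M) f1 f2))
          (Sub (MTgt N) (pair (MTgt N) (MAr N (Pr1 (MTgt M) (MOb M A) (MOb M A))) (MAr N (Pr2 (MTgt M) (MOb M A) (MOb M A))))
            (delta (MTgt N) (MOb N (MOb M A))))"
        using N'(5)[OF k Q.delta_in[OF MA]] N'(6)[OF MA] by simp
      also have "\<dots> = Sub (MTgt N) (pair (MTgt N) (MAr N (Pr1 (MTgt M) (MOb M A) (MOb M A))) (MAr N (Pr2 (MTgt M) (MOb M A) (MOb M A)))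
            \<cdot>\<^bsub>MTgt N\<^esub> MAr N (pair (MTgt M) f1 f2)) (delta (MTgt N) (MOb N (MOb M A)))"
        by (rule R.sub_sub[OF N'(2)[OF k] R.pair_in[OF g] R.delta_in[OF N'(1)[OF MA]]])
      also have "pair (MTgt N) (MAr N (Pr1 (MTgt M) (MOb M A) (MOb M A))) (MAr N (Pr2 (MTgt M) (MOb M A) (MOb M A)))
            \<cdot>\<^bsub>MTgt N\<^esub> MAr N (pair (MTgt M) f1 f2) = pair (MTgt N) (MAr N f1) (MAr N f2)"
        using R.pair_comp[OF g N'(2)[OF k]] N'(4)[OF k r(2)] N'(4)[OF k r(3)] Q.pr1_pair[OF f] Q.pr2_pair[OF f] by simp
      finally show ?thesis using Ar[OF p(2)] Ar[OF p(3)] by (simp add: f1_def f2_def)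
    qed
    show "MFib (doctrine_comp N M) A (Sub (MSrc M) f \<alpha>) =
        Sub (MTgt N) (MAr (doctrine_comp N M) f) (MFib (doctrine_comp N M) B \<alpha>)"
      if f: "f \<in> Hom (MSrc M) A B" and \<alpha>: "\<alpha> \<in> carrier (Fib (MSrc M) B)" for f A B \<alpha>
      using P.Hom_ob[OF f] Ar[OF f] \<alpha> P.sub_in[OF f \<alpha>] mor_nat[OF M f \<alpha>]
        N'(5)[OF mor_Ar[OF M f] mor_Fib[OF M _ \<alpha>]] by simp
  qed (simp_all add: doctrine_comp_def)
qed

section \<open>The 2-category of elementary doctrines\<close>

lemma doctrine_transformationD:
  assumes "doctrine_transformation \<theta>"
  shows cell_src: "doctrine_morphism (CSrc \<theta>)" and cell_tgt: "doctrine_morphism (CTgt \<theta>)"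
    and cell_par: "MSrc (CTgt \<theta>) = MSrc (CSrc \<theta>)" "MTgt (CTgt \<theta>) = MTgt (CSrc \<theta>)"
    and cell_ext: "CMap \<theta> \<in> extensional (Ob (MSrc (CSrc \<theta>)))"
    and cell_in: "A \<in> Ob (MSrc (CSrc \<theta>)) \<Longrightarrow>
      CMap \<theta> A \<in> Hom (MTgt (CSrc \<theta>)) (MOb (CSrc \<theta>) A) (MOb (CTgt \<theta>) A)"
    and cell_nat: "f \<in> Hom (MSrc (CSrc \<theta>)) A B \<Longrightarrow>
      MAr (CTgt \<theta>) f \<cdot>\<^bsub>MTgt (CSrc \<theta>)\<^esub> CMap \<theta> A = CMap \<theta> B \<cdot>\<^bsub>MTgt (CSrc \<theta>)\<^esub> MAr (CSrc \<theta>) f"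
    and cell_le: "\<lbrakk>A \<in> Ob (MSrc (CSrc \<theta>)); \<alpha> \<in> carrier (Fib (MSrc (CSrc \<theta>)) A)\<rbrakk> \<Longrightarrow>
      MFib (CSrc \<theta>) A \<alpha> \<sqsubseteq>\<^bsub>Fib (MTgt (CSrc \<theta>)) (MOb (CSrc \<theta>) A)\<^esub>
        Sub (MTgt (CSrc \<theta>)) (CMap \<theta> A) (MFib (CTgt \<theta>) A \<alpha>)"
  using assms by (auto simp: doctrine_transformation_def Let_def Hom_def)

lemma doctrine_transformationI:
  assumes "doctrine_morphism (CSrc \<theta>)" "doctrine_morphism (CTgt \<theta>)"
    and "MSrc (CTgt \<theta>) = MSrc (CSrc \<theta>)" "MTgt (CTgt \<theta>) = MTgt (CSrc \<theta>)"
    and "CMap \<theta> \<in> extensional (Ob (MSrc (CSrc \<theta>)))"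
    and "\<And>A. A \<in> Ob (MSrc (CSrc \<theta>)) \<Longrightarrow>
      CMap \<theta> A \<in> Hom (MTgt (CSrc \<theta>)) (MOb (CSrc \<theta>) A) (MOb (CTgt \<theta>) A)"
    and "\<And>f A B. f \<in> Hom (MSrc (CSrc \<theta>)) A B \<Longrightarrow>
      MAr (CTgt \<theta>) f \<cdot>\<^bsub>MTgt (CSrc \<theta>)\<^esub> CMap \<theta> A = CMap \<theta> B \<cdot>\<^bsub>MTgt (CSrc \<theta>)\<^esub> MAr (CSrc \<theta>) f"
    and "\<And>A \<alpha>. \<lbrakk>A \<in> Ob (MSrc (CSrc \<theta>)); \<alpha> \<in> carrier (Fib (MSrc (CSrc \<theta>)) A)\<rbrakk> \<Longrightarrow>
      MFib (CSrc \<theta>) A \<alpha> \<sqsubseteq>\<^bsub>Fib (MTgt (CSrc \<theta>)) (MOb (CSrc \<theta>) A)\<^esub>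
        Sub (MTgt (CSrc \<theta>)) (CMap \<theta> A) (MFib (CTgt \<theta>) A \<alpha>)"
  shows "doctrine_transformation \<theta>"
  using assms by (simp add: doctrine_transformation_def Let_def Hom_def)

lemma doctrine_cell_eqI:
  assumes \<theta>: "doctrine_transformation \<theta>" and \<phi>: "doctrine_transformation \<phi>"
    and "CSrc \<theta> = CSrc \<phi>" "CTgt \<theta> = CTgt \<phi>"
    and "\<And>A. A \<in> Ob (MSrc (CSrc \<phi>)) \<Longrightarrow> CMap \<theta> A = CMap \<phi> A"
  shows "\<theta> = \<phi>"
  using extensionalityI[OF cell_ext[OF \<theta>, unfolded assms(3)] cell_ext[OF \<phi>] assms(5)] assms(3,4)
  by (intro doctrine_cell.equality) simp_all

lemma ED_simps [simp]:
  "Cell0 ED = {P. elementary_doctrine P}" "Cell1 ED = {M. doctrine_morphism M}"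
  "Cell2 ED = {\<theta>. doctrine_transformation \<theta>}"
  "Src1 ED = MSrc" "Tgt1 ED = MTgt" "Src2 ED = CSrc" "Tgt2 ED = CTgt"
  "Id1 ED = doctrine_id" "Comp1 ED = doctrine_comp"
  "CSrc (Id2 ED M) = M" "CTgt (Id2 ED M) = M"
  "A \<in> Ob (MSrc M) \<Longrightarrow> CMap (Id2 ED M) A = Idn (MTgt M) (MOb M A)"
  "CSrc (\<phi> \<bullet>\<^bsub>ED\<^esub> \<theta>) = CSrc \<theta>" "CTgt (\<phi> \<bullet>\<^bsub>ED\<^esub> \<theta>) = CTgt \<phi>"
  "A \<in> Ob (MSrc (CSrc \<theta>)) \<Longrightarrow> CMap (\<phi> \<bullet>\<^bsub>ED\<^esub> \<theta>) A = CMap \<phi> A \<cdot>\<^bsub>MTgt (CSrc \<theta>)\<^esub> CMap \<theta> A"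
  "CSrc (\<phi> \<star>\<^bsub>ED\<^esub> \<theta>) = doctrine_comp (CSrc \<phi>) (CSrc \<theta>)"
  "CTgt (\<phi> \<star>\<^bsub>ED\<^esub> \<theta>) = doctrine_comp (CTgt \<phi>) (CTgt \<theta>)"
  "A \<in> Ob (MSrc (CSrc \<theta>)) \<Longrightarrow> CMap (\<phi> \<star>\<^bsub>ED\<^esub> \<theta>) A =
     CMap \<phi> (MOb (CTgt \<theta>) A) \<cdot>\<^bsub>MTgt (CSrc \<phi>)\<^esub> MAr (CSrc \<phi>) (CMap \<theta> A)"
  by (simp_all add: ED_def)

lemma fib_trans:
  assumes "elementary_doctrine P" "A \<in> Ob P" "\<alpha> \<in> carrier (Fib P A)" "\<beta> \<in> carrier (Fib P A)" "\<gamma> \<in> carrier (Fib P A)"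
    and "\<alpha> \<sqsubseteq>\<^bsub>Fib P A\<^esub> \<beta>" "\<beta> \<sqsubseteq>\<^bsub>Fib P A\<^esub> \<gamma>"
  shows "\<alpha> \<sqsubseteq>\<^bsub>Fib P A\<^esub> \<gamma>"
proof -
  interpret elementary_doctrine P by (rule assms(1))
  interpret partial_order "Fib P A" by (rule inf_semilattice_facts(1)[OF fib[OF assms(2)]])
  show ?thesis using le_trans[OF assms(6,7,3,4,5)] .
qed

lemma transformation_Id2:
  assumes M: "doctrine_morphism M"
  shows "doctrine_transformation (Id2 ED M)"
proof -
  interpret P: elementary_doctrine "MSrc M" by (rule mor_src[OF M])
  interpret R: elementary_doctrine "MTgt M" by (rule mor_tgt[OF M])
  show ?thesis
  proof (rule doctrine_transformationI; simp add: M)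
    show "CMap (Id2 ED M) \<in> extensional (Ob (MSrc M))" by (simp add: ED_def)
    show "Idn (MTgt M) (MOb M A) \<in> Hom (MTgt M) (MOb M A) (MOb M A)" if "A \<in> Ob (MSrc M)" for A
      using R.idn_hom mor_Ob[OF M that] by simp
    show "MAr M f \<cdot>\<^bsub>MTgt M\<^esub> CMap (Id2 ED M) A = CMap (Id2 ED M) B \<cdot>\<^bsub>MTgt M\<^esub> MAr M f"
      if "f \<in> Hom (MSrc M) A B" for f A B
      using P.Hom_ob[OF that] mor_Ar[OF M that] R.comp_idn[of "MAr M f"] R.idn_comp[of "MAr M f"]
      by (auto simp: Hom_def)
    show "MFib M A \<alpha> \<sqsubseteq>\<^bsub>Fib (MTgt M) (MOb M A)\<^esub> Sub (MTgt M) (Idn (MTgt M) (MOb M A)) (MFib M A \<alpha>)"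
      if "A \<in> Ob (MSrc M)" "\<alpha> \<in> carrier (Fib (MSrc M) A)" for A \<alpha>
      using R.sub_idn[OF mor_Ob[OF M that(1)] mor_Fib[OF M that]] R.fib_refl[OF mor_Ob[OF M that(1)] mor_Fib[OF M that]]
      by simp
  qed
qed

lemma transformation_vcomp:
  assumes \<theta>: "doctrine_transformation \<theta>" and \<phi>: "doctrine_transformation \<phi>" and s: "CSrc \<phi> = CTgt \<theta>"
  shows "doctrine_transformation (\<phi> \<bullet>\<^bsub>ED\<^esub> \<theta>)"
proof -
  define P where "P = MSrc (CSrc \<theta>)"
  define R where "R = MTgt (CSrc \<theta>)"
  interpret P: elementary_doctrine P unfolding P_def by (rule mor_src[OF cell_src[OF \<theta>]])
  interpret R: elementary_doctrine R unfolding R_def by (rule mor_tgt[OF cell_src[OF \<theta>]])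
  have e: "MSrc (CSrc \<theta>) = P" "MTgt (CSrc \<theta>) = R" "MSrc (CTgt \<theta>) = P" "MTgt (CTgt \<theta>) = R"
    "MSrc (CTgt \<phi>) = P" "MTgt (CTgt \<phi>) = R"
    using cell_par[OF \<theta>] cell_par[OF \<phi>] s by (simp_all add: P_def R_def)
  note t = cell_in[OF \<theta>, folded P_def R_def] cell_nat[OF \<theta>, folded P_def R_def] cell_le[OF \<theta>, folded P_def R_def]
  note f = cell_in[OF \<phi>, unfolded s e] cell_nat[OF \<phi>, unfolded s e] cell_le[OF \<phi>, unfolded s e]
  note M = cell_src[OF \<theta>] and N = cell_tgt[OF \<theta>] and L = cell_tgt[OF \<phi>]
  show ?thesis
  proof (rule doctrine_transformationI; simp add: cell_src[OF \<theta>] cell_tgt[OF \<phi>] e)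
    show "CMap (\<phi> \<bullet>\<^bsub>ED\<^esub> \<theta>) \<in> extensional (Ob P)" by (simp add: ED_def P_def)
    show "CMap \<phi> A \<cdot>\<^bsub>R\<^esub> CMap \<theta> A \<in> Hom R (MOb (CSrc \<theta>) A) (MOb (CTgt \<phi>) A)" if "A \<in> Ob P" for A
      by (rule R.comp_in[OF t(1)[OF that] f(1)[OF that]])
    show "MAr (CTgt \<phi>) k \<cdot>\<^bsub>R\<^esub> CMap (\<phi> \<bullet>\<^bsub>ED\<^esub> \<theta>) A = CMap (\<phi> \<bullet>\<^bsub>ED\<^esub> \<theta>) B \<cdot>\<^bsub>R\<^esub> MAr (CSrc \<theta>) k"
      if k: "k \<in> Hom P A B" for k A B
    proof -
      have A: "A \<in> Ob P" and B: "B \<in> Ob P" using P.Hom_ob[OF k] by auto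
      note Mk = mor_Ar[OF M, folded P_def R_def, OF k] and Nk = mor_Ar[OF N, unfolded e, OF k]
        and Lk = mor_Ar[OF L, unfolded e, OF k]
      have "MAr (CTgt \<phi>) k \<cdot>\<^bsub>R\<^esub> (CMap \<phi> A \<cdot>\<^bsub>R\<^esub> CMap \<theta> A) = (MAr (CTgt \<phi>) k \<cdot>\<^bsub>R\<^esub> CMap \<phi> A) \<cdot>\<^bsub>R\<^esub> CMap \<theta> A"
        using R.assoc_in[OF t(1)[OF A] f(1)[OF A] Lk] by simp
      also have "\<dots> = CMap \<phi> B \<cdot>\<^bsub>R\<^esub> (MAr (CTgt \<theta>) k \<cdot>\<^bsub>R\<^esub> CMap \<theta> A)"
        using f(2)[OF k] R.assoc_in[OF t(1)[OF A] Nk f(1)[OF B]] by simp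
      also have "\<dots> = (CMap \<phi> B \<cdot>\<^bsub>R\<^esub> CMap \<theta> B) \<cdot>\<^bsub>R\<^esub> MAr (CSrc \<theta>) k"
        using t(2)[OF k] R.assoc_in[OF Mk t(1)[OF B] f(1)[OF B]] by simp
      finally show ?thesis using A B by (simp add: e)
    qed
    show "MFib (CSrc \<theta>) A \<alpha> \<sqsubseteq>\<^bsub>Fib R (MOb (CSrc \<theta>) A)\<^esub> Sub R (CMap \<phi> A \<cdot>\<^bsub>R\<^esub> CMap \<theta> A) (MFib (CTgt \<phi>) A \<alpha>)"
      if A: "A \<in> Ob P" and \<alpha>: "\<alpha> \<in> carrier (Fib P A)" for A \<alpha>
    proof -
      note Ma = mor_Fib[OF M, folded P_def R_def, OF A \<alpha>] and Na = mor_Fib[OF N, unfolded e, OF A \<alpha>]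
        and La = mor_Fib[OF L, unfolded e, OF A \<alpha>]
      have MA: "MOb (CSrc \<theta>) A \<in> Ob R" using R.Hom_ob[OF t(1)[OF A]] by blast
      note fL = R.sub_in[OF f(1)[OF A] La]
      have "MFib (CSrc \<theta>) A \<alpha> \<sqsubseteq>\<^bsub>Fib R (MOb (CSrc \<theta>) A)\<^esub> Sub R (CMap \<theta> A) (Sub R (CMap \<phi> A) (MFib (CTgt \<phi>) A \<alpha>))"
        by (rule fib_trans[OF R.elementary_doctrine_axioms MA Ma R.sub_in[OF t(1)[OF A] Na] R.sub_in[OF t(1)[OF A] fL]
            t(3)[OF A \<alpha>] R.sub_mono[OF t(1)[OF A] Na fL f(3)[OF A \<alpha>]]])
      then show ?thesis
        using R.sub_sub[OF t(1)[OF A] f(1)[OF A] La] by simp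
    qed
  qed
qed

text \<open>For the inequality, apply the fibre map of the source of \<open>\<phi>\<close> to that of \<open>\<theta>\<close>, move it past the
reindexing by naturality, and reindex the inequality of \<open>\<phi>\<close>.\<close>

lemma transformation_hcomp:
  assumes \<theta>: "doctrine_transformation \<theta>" and \<phi>: "doctrine_transformation \<phi>"
    and s: "MSrc (CSrc \<phi>) = MTgt (CSrc \<theta>)"
  shows "doctrine_transformation (\<phi> \<star>\<^bsub>ED\<^esub> \<theta>)"
proof -
  define P where "P = MSrc (CSrc \<theta>)"
  define Q where "Q = MTgt (CSrc \<theta>)"
  define R where "R = MTgt (CSrc \<phi>)"
  interpret P: elementary_doctrine P unfolding P_def by (rule mor_src[OF cell_src[OF \<theta>]])
  interpret Q: elementary_doctrine Q unfolding Q_def by (rule mor_tgt[OF cell_src[OF \<theta>]])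
  interpret R: elementary_doctrine R unfolding R_def by (rule mor_tgt[OF cell_src[OF \<phi>]])
  note M = cell_src[OF \<theta>] and M' = cell_tgt[OF \<theta>] and N = cell_src[OF \<phi>] and N' = cell_tgt[OF \<phi>]
  have e: "MSrc (CSrc \<theta>) = P" "MTgt (CSrc \<theta>) = Q" "MSrc (CTgt \<theta>) = P" "MTgt (CTgt \<theta>) = Q"
    "MSrc (CSrc \<phi>) = Q" "MTgt (CSrc \<phi>) = R" "MSrc (CTgt \<phi>) = Q" "MTgt (CTgt \<phi>) = R"
    using cell_par[OF \<theta>] cell_par[OF \<phi>] s by (simp_all add: P_def Q_def R_def)
  note t = cell_in[OF \<theta>, unfolded e] cell_nat[OF \<theta>, unfolded e] cell_le[OF \<theta>, unfolded e]
  note f = cell_in[OF \<phi>, unfolded e] cell_nat[OF \<phi>, unfolded e] cell_le[OF \<phi>, unfolded e]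
  note Ob = mor_Ob[OF M, unfolded e] mor_Ob[OF M', unfolded e] mor_Ob[OF N, unfolded e] mor_Ob[OF N', unfolded e]
  note Ar = mor_Ar[OF M, unfolded e] mor_Ar[OF M', unfolded e] mor_Ar[OF N, unfolded e] mor_Ar[OF N', unfolded e]
  note Fb = mor_Fib[OF M, unfolded e] mor_Fib[OF M', unfolded e] mor_Fib[OF N, unfolded e] mor_Fib[OF N', unfolded e]
  note NC = mor_Comp[OF N, unfolded e]
  have MN: "doctrine_morphism (doctrine_comp (CSrc \<phi>) (CSrc \<theta>))" "doctrine_morphism (doctrine_comp (CTgt \<phi>) (CTgt \<theta>))"
    by (rule doctrine_morphism_comp[OF M N], simp add: e, rule doctrine_morphism_comp[OF M' N'], simp add: e)
  have Hi: "CMap \<phi> (MOb (CTgt \<theta>) A) \<cdot>\<^bsub>R\<^esub> MAr (CSrc \<phi>) (CMap \<theta> A) \<in>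
      Hom R (MOb (CSrc \<phi>) (MOb (CSrc \<theta>) A)) (MOb (CTgt \<phi>) (MOb (CTgt \<theta>) A))" if "A \<in> Ob P" for A
    by (rule R.comp_in[OF Ar(3)[OF t(1)[OF that]] f(1)[OF Ob(2)[OF that]]])
  show ?thesis
  proof (rule doctrine_transformationI; simp add: MN e)
    show "CMap (\<phi> \<star>\<^bsub>ED\<^esub> \<theta>) \<in> extensional (Ob P)" by (simp add: ED_def P_def)
    show "CMap \<phi> (MOb (CTgt \<theta>) A) \<cdot>\<^bsub>R\<^esub> MAr (CSrc \<phi>) (CMap \<theta> A) \<in>
        Hom R (MOb (CSrc \<phi>) (MOb (CSrc \<theta>) A)) (MOb (CTgt \<phi>) (MOb (CTgt \<theta>) A))" if "A \<in> Ob P" for A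
      by (rule Hi[OF that])
    show "MAr (doctrine_comp (CTgt \<phi>) (CTgt \<theta>)) k \<cdot>\<^bsub>R\<^esub> CMap (\<phi> \<star>\<^bsub>ED\<^esub> \<theta>) A =
        CMap (\<phi> \<star>\<^bsub>ED\<^esub> \<theta>) B \<cdot>\<^bsub>R\<^esub> MAr (doctrine_comp (CSrc \<phi>) (CSrc \<theta>)) k"
      if k: "k \<in> Hom P A B" for k A B
    proof -
      have A: "A \<in> Ob P" and B: "B \<in> Ob P" and kA: "k \<in> Ar P" using P.Hom_ob[OF k] k by (auto simp: Hom_def)
      note tA = t(1)[OF A] and tB = t(1)[OF B] and fA = f(1)[OF Ob(2)[OF A]] and fB = f(1)[OF Ob(2)[OF B]]
      note Mk = Ar(1)[OF k] and M'k = Ar(2)[OF k]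
      have "MAr (CTgt \<phi>) (MAr (CTgt \<theta>) k) \<cdot>\<^bsub>R\<^esub> (CMap \<phi> (MOb (CTgt \<theta>) A) \<cdot>\<^bsub>R\<^esub> MAr (CSrc \<phi>) (CMap \<theta> A)) =
          (MAr (CTgt \<phi>) (MAr (CTgt \<theta>) k) \<cdot>\<^bsub>R\<^esub> CMap \<phi> (MOb (CTgt \<theta>) A)) \<cdot>\<^bsub>R\<^esub> MAr (CSrc \<phi>) (CMap \<theta> A)"
        using R.assoc_in[OF Ar(3)[OF tA] fA Ar(4)[OF M'k]] by simp
      also have "\<dots> = CMap \<phi> (MOb (CTgt \<theta>) B) \<cdot>\<^bsub>R\<^esub> MAr (CSrc \<phi>) (MAr (CTgt \<theta>) k \<cdot>\<^bsub>Q\<^esub> CMap \<theta> A)"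
        using f(2)[OF M'k] R.assoc_in[OF Ar(3)[OF tA] Ar(3)[OF M'k] fB] NC[OF tA M'k] by simp
      also have "\<dots> = (CMap \<phi> (MOb (CTgt \<theta>) B) \<cdot>\<^bsub>R\<^esub> MAr (CSrc \<phi>) (CMap \<theta> B)) \<cdot>\<^bsub>R\<^esub> MAr (CSrc \<phi>) (MAr (CSrc \<theta>) k)"
        using t(2)[OF k] NC[OF Mk tB] R.assoc_in[OF Ar(3)[OF Mk] Ar(3)[OF tB] fB] by simp
      finally show ?thesis using A B kA by (simp add: e)
    qed
    show "MFib (CSrc \<phi>) (MOb (CSrc \<theta>) A) (MFib (CSrc \<theta>) A \<alpha>) \<sqsubseteq>\<^bsub>Fib R (MOb (CSrc \<phi>) (MOb (CSrc \<theta>) A))\<^esub>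
        Sub R (CMap \<phi> (MOb (CTgt \<theta>) A) \<cdot>\<^bsub>R\<^esub> MAr (CSrc \<phi>) (CMap \<theta> A))
          (MFib (CTgt \<phi>) (MOb (CTgt \<theta>) A) (MFib (CTgt \<theta>) A \<alpha>))"
      if A: "A \<in> Ob P" and \<alpha>: "\<alpha> \<in> carrier (Fib P A)" for A \<alpha>
    proof -
      note tA = t(1)[OF A] and fA = f(1)[OF Ob(2)[OF A]]
      note a = Fb(1)[OF A \<alpha>] and a' = Fb(2)[OF A \<alpha>]
      note b = Fb(3)[OF Ob(1)[OF A] a] and b' = Fb(4)[OF Ob(2)[OF A] a'] and c = Fb(3)[OF Ob(2)[OF A] a']
      note Nt = Ar(3)[OF tA] and NMA = Ob(3)[OF Ob(1)[OF A]]
      have 1: "MFib (CSrc \<phi>) (MOb (CSrc \<theta>) A) (MFib (CSrc \<theta>) A \<alpha>) \<sqsubseteq>\<^bsub>Fib R (MOb (CSrc \<phi>) (MOb (CSrc \<theta>) A))\<^esub>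
          MFib (CSrc \<phi>) (MOb (CSrc \<theta>) A) (Sub Q (CMap \<theta> A) (MFib (CTgt \<theta>) A \<alpha>))"
        by (rule inf_hom_mono[OF Q.fib[OF Ob(1)[OF A]] R.fib[OF NMA] mor_inf[OF N, unfolded e, OF Ob(1)[OF A]]
            a Q.sub_in[OF tA a'] t(3)[OF A \<alpha>]])
      have 2: "MFib (CSrc \<phi>) (MOb (CSrc \<theta>) A) (Sub Q (CMap \<theta> A) (MFib (CTgt \<theta>) A \<alpha>)) =
          Sub R (MAr (CSrc \<phi>) (CMap \<theta> A)) (MFib (CSrc \<phi>) (MOb (CTgt \<theta>) A) (MFib (CTgt \<theta>) A \<alpha>))"
        by (rule mor_nat[OF N, unfolded e, OF tA a'])
      have 3: "Sub R (MAr (CSrc \<phi>) (CMap \<theta> A)) (MFib (CSrc \<phi>) (MOb (CTgt \<theta>) A) (MFib (CTgt \<theta>) A \<alpha>))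
          \<sqsubseteq>\<^bsub>Fib R (MOb (CSrc \<phi>) (MOb (CSrc \<theta>) A))\<^esub> Sub R (MAr (CSrc \<phi>) (CMap \<theta> A))
            (Sub R (CMap \<phi> (MOb (CTgt \<theta>) A)) (MFib (CTgt \<phi>) (MOb (CTgt \<theta>) A) (MFib (CTgt \<theta>) A \<alpha>)))"
        by (rule R.sub_mono[OF Nt c R.sub_in[OF fA b'] f(3)[OF Ob(2)[OF A] a']])
      have "MFib (CSrc \<phi>) (MOb (CSrc \<theta>) A) (MFib (CSrc \<theta>) A \<alpha>) \<sqsubseteq>\<^bsub>Fib R (MOb (CSrc \<phi>) (MOb (CSrc \<theta>) A))\<^esub>
          Sub R (MAr (CSrc \<phi>) (CMap \<theta> A))
            (Sub R (CMap \<phi> (MOb (CTgt \<theta>) A)) (MFib (CTgt \<phi>) (MOb (CTgt \<theta>) A) (MFib (CTgt \<theta>) A \<alpha>)))"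
        by (rule fib_trans[OF R.elementary_doctrine_axioms NMA b R.sub_in[OF Nt c] R.sub_in[OF Nt R.sub_in[OF fA b']]
            1[unfolded 2] 3])
      then show ?thesis
        using R.sub_sub[OF Nt fA b'] by simp
    qed
  qed
qed

text \<open>Interchange is the naturality square of \<open>\<beta>\<close> at a component of \<open>\<alpha>'\<close>; the other laws hold componentwise by
the laws of the target category.\<close>

theorem two_category_ED: "two_category ED"
proof (rule two_category.intro)
  have id_r: "doctrine_comp M (doctrine_id (MSrc M)) = M" if M: "doctrine_morphism M" for M :: "('o, 'm, 'p) doctrine_mor"
    by (rule doctrine_mor_eqI[OF doctrine_morphism_comp[OF doctrine_morphism_id[OF mor_src[OF M]] M] M]) simp_all
  have id_l: "doctrine_comp (doctrine_id (MTgt M)) M = M" if M: "doctrine_morphism M" for M :: "('o, 'm, 'p) doctrine_mor"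
  proof (rule doctrine_mor_eqI[OF doctrine_morphism_comp[OF M doctrine_morphism_id[OF mor_tgt[OF M]]] M])
    interpret P: elementary_doctrine "MSrc M" by (rule mor_src[OF M])
    show "MAr (doctrine_comp (doctrine_id (MTgt M)) M) f = MAr M f" if "f \<in> Ar (MSrc M)" for f
      using that mor_Ar[OF M, of f "Dom (MSrc M) f" "Cod (MSrc M) f"] by (simp add: Hom_def)
  qed (use mor_Ob[OF M] mor_Fib[OF M] in simp_all)
  have mor_assoc: "doctrine_comp (doctrine_comp L N) M = doctrine_comp L (doctrine_comp N M)"
    if M: "doctrine_morphism M" and N: "doctrine_morphism N" and L: "doctrine_morphism L"
      and s: "MSrc N = MTgt M" "MSrc L = MTgt N" for L N M :: "('o, 'm, 'p) doctrine_mor"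
  proof (rule doctrine_mor_eqI)
    show "doctrine_morphism (doctrine_comp (doctrine_comp L N) M)"
      by (rule doctrine_morphism_comp[OF M doctrine_morphism_comp[OF N L]]) (simp_all add: s)
    show "doctrine_morphism (doctrine_comp L (doctrine_comp N M))"
      by (rule doctrine_morphism_comp[OF doctrine_morphism_comp[OF M N] L]) (simp_all add: s)
    show "MAr (doctrine_comp (doctrine_comp L N) M) f = MAr (doctrine_comp L (doctrine_comp N M)) f"
      if "f \<in> Ar (MSrc (doctrine_comp L (doctrine_comp N M)))" for f
      using that mor_Ar[OF M, of f "Dom (MSrc M) f" "Cod (MSrc M) f"] by (simp add: Hom_def s)
  qed (use mor_Ob[OF M] mor_Fib[OF M] in \<open>simp_all add: s\<close>)
  show "category (cat01 (ED :: (('o, 'm, 'p) doctrine, ('o, 'm, 'p) doctrine_mor, ('o, 'm, 'p) doctrine_cell) two_cat))"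
    by (rule category.intro)
      (simp_all add: Hom_def mor_src mor_tgt doctrine_morphism_id doctrine_morphism_comp id_r id_l mor_assoc)
  have CM: "CMap \<theta> A \<in> Ar (MTgt (CSrc \<theta>)) \<and> Dom (MTgt (CSrc \<theta>)) (CMap \<theta> A) = MOb (CSrc \<theta>) A \<and>
      Cod (MTgt (CSrc \<theta>)) (CMap \<theta> A) = MOb (CTgt \<theta>) A"
    if "doctrine_transformation \<theta>" "A \<in> Ob (MSrc (CSrc \<theta>))" for \<theta> :: "('o, 'm, 'p) doctrine_cell" and A
    using cell_in[OF that] by (simp add: Hom_def)
  have cat: "category (MTgt (CSrc \<theta>))" if "doctrine_transformation \<theta>" for \<theta> :: "('o, 'm, 'p) doctrine_cell"
  proof -
    interpret elementary_doctrine "MTgt (CSrc \<theta>)" by (rule mor_tgt[OF cell_src[OF that]])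
    show ?thesis by (rule category_axioms)
  qed
  show "category (cat12 (ED :: (('o, 'm, 'p) doctrine, ('o, 'm, 'p) doctrine_mor, ('o, 'm, 'p) doctrine_cell) two_cat))"
  proof (rule category.intro; simp add: Hom_def cell_src cell_tgt transformation_Id2 transformation_vcomp)
    fix \<theta> :: "('o, 'm, 'p) doctrine_cell" assume \<theta>: "doctrine_transformation \<theta>"
    interpret category "MTgt (CSrc \<theta>)" by (rule cat[OF \<theta>])
    have idn: "CMap \<theta> A \<cdot>\<^bsub>MTgt (CSrc \<theta>)\<^esub> Idn (MTgt (CSrc \<theta>)) (MOb (CSrc \<theta>) A) = CMap \<theta> A"
      "Idn (MTgt (CSrc \<theta>)) (MOb (CTgt \<theta>) A) \<cdot>\<^bsub>MTgt (CSrc \<theta>)\<^esub> CMap \<theta> A = CMap \<theta> A"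
      if "A \<in> Ob (MSrc (CSrc \<theta>))" for A
      using comp_idn[of "CMap \<theta> A"] idn_comp[of "CMap \<theta> A"] CM[OF \<theta> that] by simp_all
    show "\<theta> \<bullet>\<^bsub>ED\<^esub> Id2 ED (CSrc \<theta>) = \<theta>"
      by (rule doctrine_cell_eqI[OF transformation_vcomp[OF transformation_Id2[OF cell_src[OF \<theta>]] \<theta>] \<theta>])
        (use idn in simp_all)
    show "Id2 ED (CTgt \<theta>) \<bullet>\<^bsub>ED\<^esub> \<theta> = \<theta>"
      by (rule doctrine_cell_eqI[OF transformation_vcomp[OF \<theta> transformation_Id2[OF cell_tgt[OF \<theta>]]] \<theta>])
        (use idn cell_par[OF \<theta>] in simp_all)
  next
    fix \<theta> \<phi> \<psi> :: "('o, 'm, 'p) doctrine_cell"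
    assume c: "doctrine_transformation \<theta>" "doctrine_transformation \<phi>" "doctrine_transformation \<psi>"
      and s: "CSrc \<phi> = CTgt \<theta>" "CSrc \<psi> = CTgt \<phi>"
    interpret category "MTgt (CSrc \<theta>)" by (rule cat[OF c(1)])
    have e: "MSrc (CSrc \<psi>) = MSrc (CSrc \<theta>)" "MTgt (CSrc \<psi>) = MTgt (CSrc \<theta>)"
      "MSrc (CSrc \<phi>) = MSrc (CSrc \<theta>)" "MTgt (CSrc \<phi>) = MTgt (CSrc \<theta>)"
      using cell_par[OF c(1)] cell_par[OF c(2)] s by simp_all
    show "(\<psi> \<bullet>\<^bsub>ED\<^esub> \<phi>) \<bullet>\<^bsub>ED\<^esub> \<theta> = \<psi> \<bullet>\<^bsub>ED\<^esub> (\<phi> \<bullet>\<^bsub>ED\<^esub> \<theta>)"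
    proof (rule doctrine_cell_eqI)
      show "doctrine_transformation ((\<psi> \<bullet>\<^bsub>ED\<^esub> \<phi>) \<bullet>\<^bsub>ED\<^esub> \<theta>)"
        by (rule transformation_vcomp[OF c(1) transformation_vcomp[OF c(2,3)]]) (simp_all add: s)
      show "doctrine_transformation (\<psi> \<bullet>\<^bsub>ED\<^esub> (\<phi> \<bullet>\<^bsub>ED\<^esub> \<theta>))"
        by (rule transformation_vcomp[OF transformation_vcomp[OF c(1,2)] c(3)]) (simp_all add: s)
      fix A assume "A \<in> Ob (MSrc (CSrc (\<psi> \<bullet>\<^bsub>ED\<^esub> (\<phi> \<bullet>\<^bsub>ED\<^esub> \<theta>))))"
      then have A: "A \<in> Ob (MSrc (CSrc \<theta>))" by simp
      then show "CMap ((\<psi> \<bullet>\<^bsub>ED\<^esub> \<phi>) \<bullet>\<^bsub>ED\<^esub> \<theta>) A = CMap (\<psi> \<bullet>\<^bsub>ED\<^esub> (\<phi> \<bullet>\<^bsub>ED\<^esub> \<theta>)) A"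
        using assoc_in[OF cell_in[OF c(1), of A] cell_in[OF c(2), unfolded e, of A, unfolded s] cell_in[OF c(3), unfolded e, of A, unfolded s]]
        by (simp add: e)
    qed simp_all
  qed
  have hId: "doctrine_transformation (Id2 ED (doctrine_id P))" if "elementary_doctrine P" for P :: "('o, 'm, 'p) doctrine"
    by (rule transformation_Id2[OF doctrine_morphism_id[OF that]])
  show "category (cat02 (ED :: (('o, 'm, 'p) doctrine, ('o, 'm, 'p) doctrine_mor, ('o, 'm, 'p) doctrine_cell) two_cat))"
  proof (rule category.intro; simp add: Hom_def mor_src mor_tgt cell_src cell_tgt hId transformation_hcomp)
    fix \<theta> :: "('o, 'm, 'p) doctrine_cell" assume \<theta>: "doctrine_transformation \<theta>"
    note M = cell_src[OF \<theta>] and N = cell_tgt[OF \<theta>]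
    interpret P: elementary_doctrine "MSrc (CSrc \<theta>)" by (rule mor_src[OF M])
    interpret category "MTgt (CSrc \<theta>)" by (rule cat[OF \<theta>])
    note iP = hId[OF mor_src[OF M]] and iR = hId[OF mor_tgt[OF M]]
    show "\<theta> \<star>\<^bsub>ED\<^esub> Id2 ED (doctrine_id (MSrc (CSrc \<theta>))) = \<theta>"
    proof (rule doctrine_cell_eqI[OF transformation_hcomp[OF iP \<theta>] \<theta>]; simp add: id_r[OF M] id_r[OF N, unfolded cell_par[OF \<theta>]])
      fix A assume A: "A \<in> Ob (MSrc (CSrc \<theta>))"
      show "CMap \<theta> A \<cdot>\<^bsub>MTgt (CSrc \<theta>)\<^esub> MAr (CSrc \<theta>) (Idn (MSrc (CSrc \<theta>)) A) = CMap \<theta> A"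
        using mor_Idn[OF M A] comp_idn[of "CMap \<theta> A"] CM[OF \<theta> A] by simp
    qed
    show "Id2 ED (doctrine_id (MTgt (CSrc \<theta>))) \<star>\<^bsub>ED\<^esub> \<theta> = \<theta>"
    proof (rule doctrine_cell_eqI[OF transformation_hcomp[OF \<theta> iR] \<theta>]; simp add: id_l[OF M] id_l[OF N, unfolded cell_par[OF \<theta>]])
      fix A assume A: "A \<in> Ob (MSrc (CSrc \<theta>))"
      have "MOb (CTgt \<theta>) A \<in> Ob (MTgt (CSrc \<theta>))" using Hom_ob[OF cell_in[OF \<theta> A]] by blast
      then show "CMap (Id2 ED (doctrine_id (MTgt (CSrc \<theta>)))) (MOb (CTgt \<theta>) A) \<cdot>\<^bsub>MTgt (CSrc \<theta>)\<^esub>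
          MAr (doctrine_id (MTgt (CSrc \<theta>))) (CMap \<theta> A) = CMap \<theta> A"
        using idn_comp[of "CMap \<theta> A"] CM[OF \<theta> A] by simp
    qed
  next
    fix \<theta> \<phi> \<psi> :: "('o, 'm, 'p) doctrine_cell"
    assume c: "doctrine_transformation \<theta>" "doctrine_transformation \<phi>" "doctrine_transformation \<psi>"
      and s: "MSrc (CSrc \<phi>) = MTgt (CSrc \<theta>)" "MSrc (CSrc \<psi>) = MTgt (CSrc \<phi>)"
    interpret category "MTgt (CSrc \<psi>)" by (rule cat[OF c(3)])
    note M = cell_src[OF c(1)] cell_src[OF c(2)] cell_src[OF c(3)] and N = cell_tgt[OF c(1)] cell_tgt[OF c(2)] cell_tgt[OF c(3)]
    have s': "MSrc (CTgt \<phi>) = MTgt (CTgt \<theta>)" "MSrc (CTgt \<psi>) = MTgt (CTgt \<phi>)"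
      using s cell_par[OF c(1)] cell_par[OF c(2)] cell_par[OF c(3)] by simp_all
    show "(\<psi> \<star>\<^bsub>ED\<^esub> \<phi>) \<star>\<^bsub>ED\<^esub> \<theta> = \<psi> \<star>\<^bsub>ED\<^esub> (\<phi> \<star>\<^bsub>ED\<^esub> \<theta>)"
    proof (rule doctrine_cell_eqI)
      show "doctrine_transformation ((\<psi> \<star>\<^bsub>ED\<^esub> \<phi>) \<star>\<^bsub>ED\<^esub> \<theta>)"
        by (rule transformation_hcomp[OF c(1) transformation_hcomp[OF c(2,3)]]) (simp_all add: s)
      show "doctrine_transformation (\<psi> \<star>\<^bsub>ED\<^esub> (\<phi> \<star>\<^bsub>ED\<^esub> \<theta>))"
        by (rule transformation_hcomp[OF transformation_hcomp[OF c(1,2)] c(3)]) (simp_all add: s)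
      show "CSrc ((\<psi> \<star>\<^bsub>ED\<^esub> \<phi>) \<star>\<^bsub>ED\<^esub> \<theta>) = CSrc (\<psi> \<star>\<^bsub>ED\<^esub> (\<phi> \<star>\<^bsub>ED\<^esub> \<theta>))"
        using mor_assoc[OF M s] by simp
      show "CTgt ((\<psi> \<star>\<^bsub>ED\<^esub> \<phi>) \<star>\<^bsub>ED\<^esub> \<theta>) = CTgt (\<psi> \<star>\<^bsub>ED\<^esub> (\<phi> \<star>\<^bsub>ED\<^esub> \<theta>))"
        using mor_assoc[OF N s'] by simp
      fix A assume "A \<in> Ob (MSrc (CSrc (\<psi> \<star>\<^bsub>ED\<^esub> (\<phi> \<star>\<^bsub>ED\<^esub> \<theta>))))"
      then have A: "A \<in> Ob (MSrc (CSrc \<theta>))" by simp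
      note t = cell_in[OF c(1) A]
      have B: "MOb (CTgt \<theta>) A \<in> Ob (MTgt (CSrc \<theta>))" using category.Hom_ob[OF cat[OF c(1)] t] by blast
      note f = cell_in[OF c(2), unfolded s, OF B]
      have E: "MOb (CTgt \<phi>) (MOb (CTgt \<theta>) A) \<in> Ob (MTgt (CSrc \<phi>))" using category.Hom_ob[OF cat[OF c(2)] f] by blast
      note p = cell_in[OF c(3), unfolded s, OF E]
      note Mt = mor_Ar[OF M(2), unfolded s, OF t]
      have tA: "CMap \<theta> A \<in> Ar (MTgt (CSrc \<theta>))" using t by (simp add: Hom_def)
      show "CMap ((\<psi> \<star>\<^bsub>ED\<^esub> \<phi>) \<star>\<^bsub>ED\<^esub> \<theta>) A = CMap (\<psi> \<star>\<^bsub>ED\<^esub> (\<phi> \<star>\<^bsub>ED\<^esub> \<theta>)) A"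
        using A B tA mor_Comp[OF M(3), unfolded s, OF Mt f]
          assoc_in[OF mor_Ar[OF M(3), unfolded s, OF Mt] mor_Ar[OF M(3), unfolded s, OF f] p]
        by (simp add: s cell_par[OF c(1)])
    qed
  qed
  fix \<alpha> :: "('o, 'm, 'p) doctrine_cell" assume "\<alpha> \<in> Cell2 ED"
  then show "Src1 ED (Src2 ED \<alpha>) = Src1 ED (Tgt2 ED \<alpha>) \<and> Tgt1 ED (Src2 ED \<alpha>) = Tgt1 ED (Tgt2 ED \<alpha>)"
    using cell_par[of \<alpha>] by simp
next
  fix \<alpha> \<beta> :: "('o, 'm, 'p) doctrine_cell"
  show "Src2 ED (\<beta> \<star>\<^bsub>ED\<^esub> \<alpha>) = Src2 ED \<beta> \<odot>\<^bsub>ED\<^esub> Src2 ED \<alpha> \<and> Tgt2 ED (\<beta> \<star>\<^bsub>ED\<^esub> \<alpha>) = Tgt2 ED \<beta> \<odot>\<^bsub>ED\<^esub> Tgt2 ED \<alpha>"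
    by simp
next
  fix M N :: "('o, 'm, 'p) doctrine_mor" assume "M \<in> Cell1 ED" "N \<in> Cell1 ED" "Src1 ED N = Tgt1 ED M"
  then have M: "doctrine_morphism M" and N: "doctrine_morphism N" and s: "MSrc N = MTgt M" by simp_all
  interpret R: elementary_doctrine "MTgt N" by (rule mor_tgt[OF N])
  have "Id2 ED N \<star>\<^bsub>ED\<^esub> Id2 ED M = Id2 ED (doctrine_comp N M)"
  proof (rule doctrine_cell_eqI)
    show "doctrine_transformation (Id2 ED N \<star>\<^bsub>ED\<^esub> Id2 ED M)"
      by (rule transformation_hcomp[OF transformation_Id2[OF M] transformation_Id2[OF N]]) (simp add: s)
    show "doctrine_transformation (Id2 ED (doctrine_comp N M))"
      by (rule transformation_Id2[OF doctrine_morphism_comp[OF M N s]])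
    fix A assume "A \<in> Ob (MSrc (CSrc (Id2 ED (doctrine_comp N M))))"
    then have A: "A \<in> Ob (MSrc M)" by simp
    note MA = mor_Ob[OF M A]
    note i = R.idn_hom[OF mor_Ob[OF N, unfolded s, OF MA]]
    show "CMap (Id2 ED N \<star>\<^bsub>ED\<^esub> Id2 ED M) A = CMap (Id2 ED (doctrine_comp N M)) A"
      using A MA mor_Idn[OF N, unfolded s, OF MA] i R.comp_idn[of "Idn (MTgt N) (MOb N (MOb M A))"]
      by (simp add: s Hom_def)
  qed simp_all
  then show "Id2 ED N \<star>\<^bsub>ED\<^esub> Id2 ED M = Id2 ED (N \<odot>\<^bsub>ED\<^esub> M)" by simp
next
  fix \<alpha> \<alpha>' \<beta> \<beta>' :: "('o, 'm, 'p) doctrine_cell"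
  assume "\<alpha> \<in> Cell2 ED" "\<alpha>' \<in> Cell2 ED" "\<beta> \<in> Cell2 ED" "\<beta>' \<in> Cell2 ED"
    "Src2 ED \<alpha>' = Tgt2 ED \<alpha>" "Src2 ED \<beta>' = Tgt2 ED \<beta>" "Src1 ED (Src2 ED \<beta>) = Tgt1 ED (Src2 ED \<alpha>)"
  then have c: "doctrine_transformation \<alpha>" "doctrine_transformation \<alpha>'" "doctrine_transformation \<beta>" "doctrine_transformation \<beta>'"
    and s: "CSrc \<alpha>' = CTgt \<alpha>" "CSrc \<beta>' = CTgt \<beta>" "MSrc (CSrc \<beta>) = MTgt (CSrc \<alpha>)" by simp_all
  have p: "MSrc (CTgt \<alpha>) = MSrc (CSrc \<alpha>)" "MTgt (CTgt \<alpha>) = MTgt (CSrc \<alpha>)"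
    "MSrc (CTgt \<beta>) = MTgt (CSrc \<alpha>)" "MTgt (CTgt \<beta>) = MTgt (CSrc \<beta>)"
    using cell_par[OF c(1)] cell_par[OF c(3)] s by simp_all
  interpret Q: elementary_doctrine "MTgt (CSrc \<alpha>)" by (rule mor_tgt[OF cell_src[OF c(1)]])
  interpret R: elementary_doctrine "MTgt (CSrc \<beta>)" by (rule mor_tgt[OF cell_src[OF c(3)]])
  show "(\<beta>' \<bullet>\<^bsub>ED\<^esub> \<beta>) \<star>\<^bsub>ED\<^esub> (\<alpha>' \<bullet>\<^bsub>ED\<^esub> \<alpha>) = (\<beta>' \<star>\<^bsub>ED\<^esub> \<alpha>') \<bullet>\<^bsub>ED\<^esub> (\<beta> \<star>\<^bsub>ED\<^esub> \<alpha>)"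
  proof (rule doctrine_cell_eqI)
    show "doctrine_transformation ((\<beta>' \<bullet>\<^bsub>ED\<^esub> \<beta>) \<star>\<^bsub>ED\<^esub> (\<alpha>' \<bullet>\<^bsub>ED\<^esub> \<alpha>))"
      by (rule transformation_hcomp[OF transformation_vcomp[OF c(1,2)] transformation_vcomp[OF c(3,4)]]) (simp_all add: s)
    show "doctrine_transformation ((\<beta>' \<star>\<^bsub>ED\<^esub> \<alpha>') \<bullet>\<^bsub>ED\<^esub> (\<beta> \<star>\<^bsub>ED\<^esub> \<alpha>))"
      by (rule transformation_vcomp[OF transformation_hcomp[OF c(1,3)] transformation_hcomp[OF c(2,4)]]) (simp_all add: s p)
    fix A assume "A \<in> Ob (MSrc (CSrc ((\<beta>' \<star>\<^bsub>ED\<^esub> \<alpha>') \<bullet>\<^bsub>ED\<^esub> (\<beta> \<star>\<^bsub>ED\<^esub> \<alpha>))))"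
    then have A: "A \<in> Ob (MSrc (CSrc \<alpha>))" by simp
    note a = cell_in[OF c(1) A] and a' = cell_in[OF c(2), unfolded s, unfolded p, OF A]
    have B: "MOb (CTgt \<alpha>) A \<in> Ob (MTgt (CSrc \<alpha>))" "MOb (CTgt \<alpha>') A \<in> Ob (MTgt (CSrc \<alpha>))"
      using Q.Hom_ob[OF a] Q.Hom_ob[OF a'] by auto
    note b = cell_in[OF c(3), unfolded s, OF B(1)] cell_in[OF c(3), unfolded s, OF B(2)]
      and b' = cell_in[OF c(4), unfolded s, unfolded p, OF B(2)]
    note Sa = mor_Ar[OF cell_src[OF c(3)], unfolded s, OF a] and Sa' = mor_Ar[OF cell_src[OF c(3)], unfolded s, OF a']
      and Ta' = mor_Ar[OF cell_tgt[OF c(3)], unfolded p, OF a']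
    have "(CMap \<beta>' (MOb (CTgt \<alpha>') A) \<cdot>\<^bsub>MTgt (CSrc \<beta>)\<^esub> CMap \<beta> (MOb (CTgt \<alpha>') A)) \<cdot>\<^bsub>MTgt (CSrc \<beta>)\<^esub>
          MAr (CSrc \<beta>) (CMap \<alpha>' A \<cdot>\<^bsub>MTgt (CSrc \<alpha>)\<^esub> CMap \<alpha> A)
        = CMap \<beta>' (MOb (CTgt \<alpha>') A) \<cdot>\<^bsub>MTgt (CSrc \<beta>)\<^esub> ((CMap \<beta> (MOb (CTgt \<alpha>') A) \<cdot>\<^bsub>MTgt (CSrc \<beta>)\<^esub>
          MAr (CSrc \<beta>) (CMap \<alpha>' A)) \<cdot>\<^bsub>MTgt (CSrc \<beta>)\<^esub> MAr (CSrc \<beta>) (CMap \<alpha> A))"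
      using mor_Comp[OF cell_src[OF c(3)], unfolded s, OF a a'] R.assoc_in[OF R.comp_in[OF Sa Sa'] b(2) b']
        R.assoc_in[OF Sa Sa' b(2)] by simp
    also have "\<dots> = CMap \<beta>' (MOb (CTgt \<alpha>') A) \<cdot>\<^bsub>MTgt (CSrc \<beta>)\<^esub> ((MAr (CTgt \<beta>) (CMap \<alpha>' A) \<cdot>\<^bsub>MTgt (CSrc \<beta>)\<^esub>
          CMap \<beta> (MOb (CTgt \<alpha>) A)) \<cdot>\<^bsub>MTgt (CSrc \<beta>)\<^esub> MAr (CSrc \<beta>) (CMap \<alpha> A))"
      using cell_nat[OF c(3), unfolded s, OF a'] by simp
    also have "\<dots> = (CMap \<beta>' (MOb (CTgt \<alpha>') A) \<cdot>\<^bsub>MTgt (CSrc \<beta>)\<^esub> MAr (CTgt \<beta>) (CMap \<alpha>' A)) \<cdot>\<^bsub>MTgt (CSrc \<beta>)\<^esub>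
          (CMap \<beta> (MOb (CTgt \<alpha>) A) \<cdot>\<^bsub>MTgt (CSrc \<beta>)\<^esub> MAr (CSrc \<beta>) (CMap \<alpha> A))"
      using R.assoc_in[OF Sa b(1) Ta'] R.assoc_in[OF R.comp_in[OF Sa b(1)] Ta' b'] by simp
    finally show "CMap ((\<beta>' \<bullet>\<^bsub>ED\<^esub> \<beta>) \<star>\<^bsub>ED\<^esub> (\<alpha>' \<bullet>\<^bsub>ED\<^esub> \<alpha>)) A = CMap ((\<beta>' \<star>\<^bsub>ED\<^esub> \<alpha>') \<bullet>\<^bsub>ED\<^esub> (\<beta> \<star>\<^bsub>ED\<^esub> \<alpha>)) A"
      using A B by (simp add: s p)
  qed (simp_all add: s)
qed

section \<open>The completion as a strictly idempotent 2-monad\<close>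

context named_doctrine
begin

lemma is_functor_cl: "is_functor P PX (\<lambda>A. A) cl"
  by (rule is_functorI) (simp_all add: cl_in comp_cl[symmetric])

text \<open>The chosen projections of the collapse are the classes of those of \<open>P\<close>, so \<open>f \<mapsto> [f]\<close> preserves the chosen
products and with them all products.\<close>

lemma is_product_cl:
  assumes "is_product P A B W f g" and "A \<in> Ob P" and "B \<in> Ob P"
  shows "is_product PX A B W (cl f) (cl g)"
proof -
  interpret X: category_with_products PX by (rule category_with_products_collapse)
  have "preserves_products P PX (\<lambda>A. A) cl"
    unfolding preserves_products_def using X.products by simp
  from preserves_is_product[OF category_with_products_axioms X.category_axioms is_functor_cl this assms]
  show ?thesis .
qed

lemma Td_unit_simps [simp]:
  "MSrc (Td_unit q P) = P" "MTgt (Td_unit q P) = PX"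
  "A \<in> Ob P \<Longrightarrow> MOb (Td_unit q P) A = A"
  "f \<in> Ar P \<Longrightarrow> MAr (Td_unit q P) f = cl f"
  "\<lbrakk>A \<in> Ob P; \<alpha> \<in> carrier (Fib P A)\<rbrakk> \<Longrightarrow> MFib (Td_unit q P) A \<alpha> = \<alpha>"
  by (simp_all add: Td_unit_def)

lemma doctrine_morphism_unit: "doctrine_morphism (Td_unit q P)"
proof (rule doctrine_morphismI; simp add: elementary_doctrine_axioms elementary_doctrine_collapse)
  interpret X: elementary_doctrine PX by (rule elementary_doctrine_collapse)
  show "is_functor P PX (MOb (Td_unit q P)) (MAr (Td_unit q P))"
  proof (rule is_functorI)
    show "MAr (Td_unit q P) f \<in> Hom PX (MOb (Td_unit q P) A) (MOb (Td_unit q P) B)"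
      if "f \<in> Hom P A B" for f A B
      using cl_in[OF that] Hom_ob[OF that] HomD[OF that] by simp
    show "MAr (Td_unit q P) (Idn P A) = Idn PX (MOb (Td_unit q P) A)" if "A \<in> Ob P" for A
      using that idn_hom[OF that] by (simp add: Hom_def)
    show "MAr (Td_unit q P) (g \<cdot> f) = MAr (Td_unit q P) g \<cdot>\<^bsub>PX\<^esub> MAr (Td_unit q P) f"
      if "f \<in> Hom P A B" "g \<in> Hom P B D" for f g A B D
      using comp_cl[OF that] HomD[OF that(1)] HomD[OF that(2)] HomD[OF comp_in[OF that]] by simp
  qed simp
  have Ar: "Pr1 P A B \<in> Ar P" "Pr2 P A B \<in> Ar P" "Prd P A B \<in> Ob P" if "A \<in> Ob P" "B \<in> Ob P" for A B
    using pr_in[OF that] by (auto simp: Hom_def)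
  show "preserves_products P PX (MOb (Td_unit q P)) (MAr (Td_unit q P))"
    unfolding preserves_products_def using X.products Ar by simp
  show "inf_hom (Fib P A) (Fib P A) (MFib (Td_unit q P) A)" if "A \<in> Ob P" for A
    by (rule inf_hom_cong[OF fib[OF that] inf_hom_id]) (use that in simp)
  show "MFib (Td_unit q P) (Prd P A A) (delta P A) =
      Sub PX (pair PX (MAr (Td_unit q P) (Pr1 P A A)) (MAr (Td_unit q P) (Pr2 P A A))) (delta PX A)"
    if "A \<in> Ob P" for A
    using X.Sub_pair_projections_delta[of A] that Ar delta_in delta_collapse by simp
  show "MFib (Td_unit q P) A (Sub P f \<alpha>) = Sub PX (MAr (Td_unit q P) f) (MFib (Td_unit q P) B \<alpha>)"
    if "f \<in> Hom P A B" "\<alpha> \<in> carrier (Fib P B)" for f A B \<alpha>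
    using that sub_in[OF that] Hom_ob[OF that(1)] HomD[OF that(1)] Sub_cl[OF that] by simp
qed (simp_all add: Td_unit_def)

end

text \<open>When internally equal arrows are equal, each class has one element, and sending \<open>[f]\<close> to \<open>f\<close> is inverse
to the unit. The multiplication at \<open>P\<close> is this map for the collapse of \<open>P\<close>.\<close>

definition retraction :: "(('o, 'm, 'p) doctrine \<Rightarrow> 'm set \<Rightarrow> 'm) \<Rightarrow> ('o, 'm, 'p) doctrine \<Rightarrow> ('o, 'm, 'p) doctrine_mor" where
  "retraction q P = \<lparr>
     MSrc = collapse q P, MTgt = P,
     MOb = (\<lambda>A\<in>Ob P. A),
     MAr = (\<lambda>x\<in>Ar (collapse q P). rep q P x),
     MFib = (\<lambda>A\<in>Ob P. \<lambda>\<alpha>\<in>carrier (Fib P A). \<alpha>)\<rparr>"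

lemma Td_mult_eq_retraction: "Td_mult q P = retraction q (collapse q P)"
  by (simp add: Td_mult_def retraction_def collapse_def)

context named_doctrine
begin

lemma retraction_simps [simp]:
  "MSrc (retraction q P) = PX" "MTgt (retraction q P) = P"
  "A \<in> Ob P \<Longrightarrow> MOb (retraction q P) A = A"
  "\<lbrakk>A \<in> Ob P; \<alpha> \<in> carrier (Fib P A)\<rbrakk> \<Longrightarrow> MFib (retraction q P) A \<alpha> = \<alpha>"
  by (simp_all add: retraction_def)

lemma retraction_cl:
  "\<lbrakk>comprehensive_diagonals P; f \<in> Ar P\<rbrakk> \<Longrightarrow> MAr (retraction q P) (cl f) = f"
  by (simp add: retraction_def rep_cl_eq)

lemma doctrine_morphism_retraction:
  assumes c: "comprehensive_diagonals P"
  shows "doctrine_morphism (retraction q P)"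
proof (rule doctrine_morphismI; (simp only: retraction_simps(1,2) collapse_simps)?)
  note r = retraction_cl[OF c]
  have Ar: "Pr1 P A B \<in> Ar P" "Pr2 P A B \<in> Ar P" "Prd P A B \<in> Ob P" if "A \<in> Ob P" "B \<in> Ob P" for A B
    using pr_in[OF that] by (auto simp: Hom_def)
  show "elementary_doctrine P" "elementary_doctrine PX"
    by (rule elementary_doctrine_axioms elementary_doctrine_collapse)+
  show "is_functor PX P (MOb (retraction q P)) (MAr (retraction q P))"
  proof (rule is_functorI)
    show "MAr (retraction q P) x \<in> Hom P (MOb (retraction q P) A) (MOb (retraction q P) B)"
      if x: "x \<in> Hom PX A B" for x A B
    proof -
      obtain f where f: "f \<in> Hom P A B" "x = cl f" using Hom_PX[OF x] by blast
      then show ?thesis using Hom_ob[OF f(1)] HomD[OF f(1)] r by simp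
    qed
    show "MAr (retraction q P) (Idn PX A) = Idn P (MOb (retraction q P) A)" if "A \<in> Ob PX" for A
      using that HomD[OF idn_hom] r by simp
    show "MAr (retraction q P) (y \<cdot>\<^bsub>PX\<^esub> x) = MAr (retraction q P) y \<cdot> MAr (retraction q P) x"
      if x: "x \<in> Hom PX A B" and y: "y \<in> Hom PX B D" for x y A B D
    proof -
      obtain f where f: "f \<in> Hom P A B" "x = cl f" using Hom_PX[OF x] by blast
      obtain g where g: "g \<in> Hom P B D" "y = cl g" using Hom_PX[OF y] by blast
      show ?thesis
        using comp_cl[OF f(1) g(1)] HomD[OF f(1)] HomD[OF g(1)] HomD[OF comp_in[OF f(1) g(1)]] r f g by simp
    qed
  qed simp
  show "preserves_products PX P (MOb (retraction q P)) (MAr (retraction q P))"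
    unfolding preserves_products_def using products Ar r by simp
  show "inf_hom (Fib P A) (Fib P (MOb (retraction q P) A)) (MFib (retraction q P) A)" if "A \<in> Ob P" for A
    using inf_hom_cong[OF fib[OF that] inf_hom_id, of "MFib (retraction q P) A"] that by simp
  show "MFib (retraction q P) (Prd P A A) (delta PX A) =
      Sub P (pair P (MAr (retraction q P) (cl (Pr1 P A A))) (MAr (retraction q P) (cl (Pr2 P A A))))
        (delta P (MOb (retraction q P) A))"
    if "A \<in> Ob P" for A
    using that Ar r delta_in delta_collapse Sub_pair_projections_delta by simp
  show "MFib (retraction q P) A (Sub PX x \<alpha>) = Sub P (MAr (retraction q P) x) (MFib (retraction q P) B \<alpha>)"
    if x: "x \<in> Hom PX A B" and \<alpha>: "\<alpha> \<in> carrier (Fib P B)" for x A B \<alpha>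
  proof -
    obtain f where f: "f \<in> Hom P A B" "x = cl f" using Hom_PX[OF x] by blast
    show ?thesis
      using \<alpha> sub_in[OF f(1) \<alpha>] Hom_ob[OF f(1)] HomD[OF f(1)] Sub_cl[OF f(1) \<alpha>] f r by simp
  qed
qed (simp_all add: retraction_def)

lemma retraction_unit:
  assumes c: "comprehensive_diagonals P"
  shows "doctrine_comp (retraction q P) (Td_unit q P) = doctrine_id P"
  by (rule doctrine_mor_eqI[OF doctrine_morphism_comp[OF doctrine_morphism_unit doctrine_morphism_retraction[OF c]]
        doctrine_morphism_id[OF elementary_doctrine_axioms]])
    (simp_all add: retraction_cl[OF c])

lemma unit_retraction:
  assumes c: "comprehensive_diagonals P"
  shows "doctrine_comp (Td_unit q P) (retraction q P) = doctrine_id PX"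
  by (rule doctrine_mor_eqI[OF doctrine_morphism_comp[OF doctrine_morphism_retraction[OF c] doctrine_morphism_unit]
        doctrine_morphism_id[OF elementary_doctrine_collapse]])
    (auto simp: retraction_cl[OF c])

text \<open>The unit is the identity on objects and fibres and surjective on arrows, so only its injectivity on
arrows is at stake. A left inverse forces this, that is, internally equal arrows are then equal.\<close>

lemma is_iso_unit_iff: "is_iso (cat01 ED) (Td_unit q P) \<longleftrightarrow> comprehensive_diagonals P"
proof
  assume "is_iso (cat01 ED) (Td_unit q P)"
  then obtain R where R: "doctrine_morphism R" "MSrc R = PX" "doctrine_comp R (Td_unit q P) = doctrine_id P"
    by (auto simp: is_iso_def Hom_def)
  have inv: "MAr R (cl f) = f" if "f \<in> Ar P" for f
    using that R(3) doctrine_comp_simps(4)[of f "Td_unit q P" R] by simp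
  have "f = g" if "int_eq P f g" for f g
  proof -
    have f: "f \<in> Ar P" and g: "g \<in> Ar P" using that by (auto simp: int_eq_def Hom_def)
    then have "cl f = cl g" using cl_eq_iff that by blast
    then show ?thesis using inv[OF f] inv[OF g] by metis
  qed
  then show "comprehensive_diagonals P" using comprehensive_diagonals_iff by blast
next
  assume c: "comprehensive_diagonals P"
  show "is_iso (cat01 ED) (Td_unit q P)"
    unfolding is_iso_def
  proof (intro conjI bexI[of _ "retraction q P"])
    show "retraction q P \<in> Hom (cat01 ED) (Cod (cat01 ED) (Td_unit q P)) (Dom (cat01 ED) (Td_unit q P))"
      using doctrine_morphism_retraction[OF c] by (simp add: Hom_def)
  qed (simp_all add: doctrine_morphism_unit retraction_unit[OF c] unit_retraction[OF c])
qed

end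

locale naming =
  fixes q :: "('o, 'm, 'p) doctrine \<Rightarrow> 'm set \<Rightarrow> 'm"
  assumes naming: "class_naming q"
begin

lemma named: "elementary_doctrine P \<Longrightarrow> named_doctrine P q"
  by (intro named_doctrine.intro named_doctrine_axioms.intro naming)

lemma named_collapse: "elementary_doctrine P \<Longrightarrow> named_doctrine (collapse q P) q"
  by (rule named[OF named_doctrine.elementary_doctrine_collapse[OF named]])

lemma collapse_mor_simps [simp]:
  "MSrc (collapse_mor q M) = collapse q (MSrc M)" "MTgt (collapse_mor q M) = collapse q (MTgt M)"
  "MOb (collapse_mor q M) = MOb M" "MFib (collapse_mor q M) = MFib M"
  by (simp_all add: collapse_mor_def)

lemma Ob_collapse [simp]: "Ob (collapse q P) = Ob P" and Fib_collapse [simp]: "Fib (collapse q P) = Fib P"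
  by (simp_all add: collapse_def)

text \<open>The action of a 1-cell on classes is defined by chosen representatives; by \<open>mor_int_eq\<close> the choice does
not matter.\<close>

lemma MAr_collapse_mor:
  assumes M: "doctrine_morphism M" and f: "f \<in> Ar (MSrc M)"
  shows "MAr (collapse_mor q M) (eqv q (MSrc M) f) = eqv q (MTgt M) (MAr M f)"
proof -
  interpret P: named_doctrine "MSrc M" q by (rule named[OF mor_src[OF M]])
  interpret R: named_doctrine "MTgt M" q by (rule named[OF mor_tgt[OF M]])
  have "int_eq (MTgt M) (MAr M f) (MAr M (rep q (MSrc M) (P.cl f)))"
    by (rule mor_int_eq[OF M P.rep_cl[OF f]])
  then have "R.cl (MAr M f) = R.cl (MAr M (rep q (MSrc M) (P.cl f)))"
    using R.cl_eq_iff by (auto simp: int_eq_def Hom_def)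
  then show ?thesis using f by (simp add: collapse_mor_def)
qed

lemma doctrine_morphism_collapse:
  assumes M: "doctrine_morphism M"
  shows "doctrine_morphism (collapse_mor q M)"
proof -
  interpret P: named_doctrine "MSrc M" q by (rule named[OF mor_src[OF M]])
  interpret R: named_doctrine "MTgt M" q by (rule named[OF mor_tgt[OF M]])
  note r = MAr_collapse_mor[OF M]
  have Ar: "Pr1 (MSrc M) A B \<in> Ar (MSrc M)" "Pr2 (MSrc M) A B \<in> Ar (MSrc M)"
    if "A \<in> Ob (MSrc M)" "B \<in> Ob (MSrc M)" for A B
    using P.pr_in[OF that] by (auto simp: Hom_def)
  show ?thesis
  proof (rule doctrine_morphismI; (simp only: collapse_mor_simps P.collapse_simps(1-3) R.collapse_simps(1-3))?)
    show "elementary_doctrine P.PX" "elementary_doctrine R.PX"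
      by (rule P.elementary_doctrine_collapse R.elementary_doctrine_collapse)+
    show "is_functor P.PX R.PX (MOb M) (MAr (collapse_mor q M))"
    proof (rule is_functorI)
      show "MAr (collapse_mor q M) x \<in> Hom R.PX (MOb M A) (MOb M B)" if x: "x \<in> Hom P.PX A B" for x A B
      proof -
        obtain f where f: "f \<in> Hom (MSrc M) A B" "x = P.cl f" using P.Hom_PX[OF x] by blast
        then show ?thesis using R.cl_in[OF mor_Ar[OF M f(1)]] r[of f] by (simp add: Hom_def)
      qed
      show "MAr (collapse_mor q M) (Idn P.PX A) = Idn R.PX (MOb M A)" if "A \<in> Ob P.PX" for A
        using that P.HomD[OF P.idn_hom, of A] r mor_Idn[OF M] by simp
      show "MAr (collapse_mor q M) (y \<cdot>\<^bsub>P.PX\<^esub> x) = MAr (collapse_mor q M) y \<cdot>\<^bsub>R.PX\<^esub> MAr (collapse_mor q M) x"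
        if x: "x \<in> Hom P.PX A B" and y: "y \<in> Hom P.PX B D" for x y A B D
      proof -
        obtain f where f: "f \<in> Hom (MSrc M) A B" "x = P.cl f" using P.Hom_PX[OF x] by blast
        obtain g where g: "g \<in> Hom (MSrc M) B D" "y = P.cl g" using P.Hom_PX[OF y] by blast
        show ?thesis
          using P.comp_cl[OF f(1) g(1)] R.comp_cl[OF mor_Ar[OF M f(1)] mor_Ar[OF M g(1)]] mor_Comp[OF M f(1) g(1)]
            P.HomD[OF f(1)] P.HomD[OF g(1)] P.HomD[OF P.comp_in[OF f(1) g(1)]] r f g by simp
      qed
    qed (simp add: mor_Ob[OF M])
    show "preserves_products P.PX R.PX (MOb M) (MAr (collapse_mor q M))"
      unfolding preserves_products_def
    proof (intro ballI)
      fix A B assume "A \<in> Ob P.PX" "B \<in> Ob P.PX"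
      then have A: "A \<in> Ob (MSrc M)" and B: "B \<in> Ob (MSrc M)" by simp_all
      then have "is_product (MTgt M) (MOb M A) (MOb M B) (MOb M (Prd (MSrc M) A B))
          (MAr M (Pr1 (MSrc M) A B)) (MAr M (Pr2 (MSrc M) A B))"
        using mor_products[OF M] by (simp add: preserves_products_def)
      from R.is_product_cl[OF this mor_Ob[OF M A] mor_Ob[OF M B]]
      show "is_product R.PX (MOb M A) (MOb M B) (MOb M (Prd P.PX A B)) (MAr (collapse_mor q M) (Pr1 P.PX A B))
          (MAr (collapse_mor q M) (Pr2 P.PX A B))"
        using Ar[OF A B] r by simp
    qed
    show "inf_hom (Fib (MSrc M) A) (Fib (MTgt M) (MOb M A)) (MFib M A)" if "A \<in> Ob (MSrc M)" for A
      by (rule mor_inf[OF M that])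
    show "MFib M (Prd (MSrc M) A A) (delta P.PX A) = Sub R.PX (pair R.PX (MAr (collapse_mor q M) (Pr1 P.PX A A))
        (MAr (collapse_mor q M) (Pr2 P.PX A A))) (delta R.PX (MOb M A))" if A: "A \<in> Ob (MSrc M)" for A
    proof -
      note p = P.pr_in[OF A A] and MA = mor_Ob[OF M A]
      note Fp = mor_Ar[OF M p(2)] mor_Ar[OF M p(3)]
      show ?thesis
        using mor_delta[OF M A] P.delta_collapse[OF A] R.delta_collapse[OF MA] R.pair_cl[OF Fp]
          R.Sub_cl[OF R.pair_in[OF Fp] R.delta_in[OF MA]] r Ar[OF A A] by simp
    qed
    show "MFib M A (Sub P.PX x \<alpha>) = Sub R.PX (MAr (collapse_mor q M) x) (MFib M B \<alpha>)"
      if x: "x \<in> Hom P.PX A B" and \<alpha>: "\<alpha> \<in> carrier (Fib (MSrc M) B)" for x A B \<alpha>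
    proof -
      obtain f where f: "f \<in> Hom (MSrc M) A B" "x = P.cl f" using P.Hom_PX[OF x] by blast
      have B: "B \<in> Ob (MSrc M)" using P.Hom_ob[OF f(1)] by blast
      show ?thesis
        using P.Sub_cl[OF f(1) \<alpha>] R.Sub_cl[OF mor_Ar[OF M f(1)] mor_Fib[OF M B \<alpha>]] mor_nat[OF M f(1) \<alpha>]
          P.HomD[OF f(1)] f(2) r by simp
    qed
    show "MAr (collapse_mor q M) \<in> extensional (Ar P.PX)" by (simp only: collapse_mor_def doctrine_mor.simps restrict_extensional)
  qed (simp_all add: mor_ext[OF M])
qed

lemma collapse_cell_simps [simp]:
  "CSrc (collapse_cell q \<theta>) = collapse_mor q (CSrc \<theta>)" "CTgt (collapse_cell q \<theta>) = collapse_mor q (CTgt \<theta>)"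
  "A \<in> Ob (MSrc (CSrc \<theta>)) \<Longrightarrow> CMap (collapse_cell q \<theta>) A = eqv q (MTgt (CSrc \<theta>)) (CMap \<theta> A)"
  by (simp_all add: collapse_cell_def)

lemma doctrine_transformation_collapse:
  assumes \<theta>: "doctrine_transformation \<theta>"
  shows "doctrine_transformation (collapse_cell q \<theta>)"
proof -
  note M = cell_src[OF \<theta>] and N = cell_tgt[OF \<theta>] and e = cell_par[OF \<theta>]
  interpret P: named_doctrine "MSrc (CSrc \<theta>)" q by (rule named[OF mor_src[OF M]])
  interpret R: named_doctrine "MTgt (CSrc \<theta>)" q by (rule named[OF mor_tgt[OF M]])
  show ?thesis
  proof (rule doctrine_transformationI; simp add: doctrine_morphism_collapse[OF M] doctrine_morphism_collapse[OF N] e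
      del: R.collapse_simps(4-7) P.collapse_simps(4-7))
    show "CMap (collapse_cell q \<theta>) \<in> extensional (Ob (MSrc (CSrc \<theta>)))" by (simp add: collapse_cell_def)
    show "R.cl (CMap \<theta> A) \<in> Hom R.PX (MOb (CSrc \<theta>) A) (MOb (CTgt \<theta>) A)" if "A \<in> Ob (MSrc (CSrc \<theta>))" for A
      by (rule R.cl_in[OF cell_in[OF \<theta> that]])
    show "MAr (collapse_mor q (CTgt \<theta>)) x \<cdot>\<^bsub>R.PX\<^esub> CMap (collapse_cell q \<theta>) A =
        CMap (collapse_cell q \<theta>) B \<cdot>\<^bsub>R.PX\<^esub> MAr (collapse_mor q (CSrc \<theta>)) x"
      if x: "x \<in> Hom P.PX A B" for x A B
    proof -
      obtain f where f: "f \<in> Hom (MSrc (CSrc \<theta>)) A B" "x = P.cl f" using P.Hom_PX[OF x] by blast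
      have A: "A \<in> Ob (MSrc (CSrc \<theta>))" and B: "B \<in> Ob (MSrc (CSrc \<theta>))" using P.Hom_ob[OF f(1)] by auto
      show ?thesis
        using R.comp_cl[OF cell_in[OF \<theta> A] mor_Ar[OF N, unfolded e, OF f(1)]]
          R.comp_cl[OF mor_Ar[OF M f(1)] cell_in[OF \<theta> B]] cell_nat[OF \<theta> f(1)]
          MAr_collapse_mor[OF M, of f] MAr_collapse_mor[OF N, unfolded e, of f] P.HomD[OF f(1)] A B f(2) by simp
    qed
    show "MFib (CSrc \<theta>) A \<alpha> \<sqsubseteq>\<^bsub>Fib (MTgt (CSrc \<theta>)) (MOb (CSrc \<theta>) A)\<^esub>
        Sub R.PX (R.cl (CMap \<theta> A)) (MFib (CTgt \<theta>) A \<alpha>)"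
      if "A \<in> Ob (MSrc (CSrc \<theta>))" "\<alpha> \<in> carrier (Fib (MSrc (CSrc \<theta>)) A)" for A \<alpha>
      using R.Sub_cl[OF cell_in[OF \<theta> that(1)] mor_Fib[OF N, unfolded e, OF that]] cell_le[OF \<theta> that] by simp
  qed
qed

lemma collapse_id:
  assumes P: "elementary_doctrine P"
  shows "collapse_mor q (doctrine_id P) = doctrine_id (collapse q P)"
proof -
  interpret named_doctrine P q by (rule named[OF P])
  note i = doctrine_morphism_id[OF P]
  show ?thesis
  proof (rule doctrine_mor_eqI[OF doctrine_morphism_collapse[OF i] doctrine_morphism_id[OF elementary_doctrine_collapse]])
    fix x assume "x \<in> Ar (MSrc (doctrine_id PX))"
    then show "MAr (collapse_mor q (doctrine_id P)) x = MAr (doctrine_id PX) x"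
      using MAr_collapse_mor[OF i] by auto
  qed simp_all
qed

lemma collapse_comp:
  assumes M: "doctrine_morphism M" and N: "doctrine_morphism N" and MN: "MSrc N = MTgt M"
  shows "collapse_mor q (doctrine_comp N M) = doctrine_comp (collapse_mor q N) (collapse_mor q M)"
proof -
  interpret P: named_doctrine "MSrc M" q by (rule named[OF mor_src[OF M]])
  note NM = doctrine_morphism_comp[OF M N MN]
  note TM = doctrine_morphism_collapse[OF M] and TN = doctrine_morphism_collapse[OF N]
  show ?thesis
  proof (rule doctrine_mor_eqI[OF doctrine_morphism_collapse[OF NM] doctrine_morphism_comp[OF TM TN]])
    fix x assume "x \<in> Ar (MSrc (doctrine_comp (collapse_mor q N) (collapse_mor q M)))"
    then obtain f where f: "f \<in> Ar (MSrc M)" "x = P.cl f" by auto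
    have "MAr M f \<in> Ar (MTgt M)" using mor_Ar[OF M, of f] f(1) by (simp add: Hom_def)
    then show "MAr (collapse_mor q (doctrine_comp N M)) x = MAr (doctrine_comp (collapse_mor q N) (collapse_mor q M)) x"
      using MAr_collapse_mor[OF NM, of f] MAr_collapse_mor[OF M f(1)] MAr_collapse_mor[OF N, of "MAr M f"] f MN by simp
  qed (simp_all add: MN)
qed

lemma two_functor_Td: "two_functor ED ED (Td q)"
  unfolding two_functor_def
proof (intro conjI)
  have [simp]: "Map0 (Td q) = collapse q" "Map1 (Td q) = collapse_mor q" "Map2 (Td q) = collapse_cell q"
    by (simp_all add: Td_def)
  have E: "elementary_doctrine (collapse q P)" if "elementary_doctrine P" for P
    by (rule named_doctrine.elementary_doctrine_collapse[OF named[OF that]])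
  show "is_functor (cat01 ED) (cat01 ED) (Map0 (Td q)) (Map1 (Td q))"
    by (rule is_functorI) (auto simp: Hom_def E doctrine_morphism_collapse collapse_id collapse_comp)
  have Id2: "collapse_cell q (Id2 ED M) = Id2 ED (collapse_mor q M)" if M: "doctrine_morphism M" for M
  proof (rule doctrine_cell_eqI[OF doctrine_transformation_collapse[OF transformation_Id2[OF M]]
        transformation_Id2[OF doctrine_morphism_collapse[OF M]]])
    interpret R: named_doctrine "MTgt M" q by (rule named[OF mor_tgt[OF M]])
    fix A assume "A \<in> Ob (MSrc (CSrc (Id2 ED (collapse_mor q M))))"
    then show "CMap (collapse_cell q (Id2 ED M)) A = CMap (Id2 ED (collapse_mor q M)) A" by simp
  qed simp_all
  show "is_functor (cat12 ED) (cat12 ED) (Map1 (Td q)) (Map2 (Td q))"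
  proof (rule is_functorI)
    fix \<theta> \<phi> :: "('o, 'm, 'p) doctrine_cell" and L M N
    assume "\<theta> \<in> Hom (cat12 ED) L M" "\<phi> \<in> Hom (cat12 ED) M N"
    then have \<theta>: "doctrine_transformation \<theta>" and \<phi>: "doctrine_transformation \<phi>" and s: "CSrc \<phi> = CTgt \<theta>"
      by (simp_all add: Hom_def)
    interpret R: named_doctrine "MTgt (CSrc \<theta>)" q by (rule named[OF mor_tgt[OF cell_src[OF \<theta>]]])
    have "collapse_cell q (\<phi> \<bullet>\<^bsub>ED\<^esub> \<theta>) = collapse_cell q \<phi> \<bullet>\<^bsub>ED\<^esub> collapse_cell q \<theta>"
    proof (rule doctrine_cell_eqI)
      show "doctrine_transformation (collapse_cell q (\<phi> \<bullet>\<^bsub>ED\<^esub> \<theta>))"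
        by (rule doctrine_transformation_collapse[OF transformation_vcomp[OF \<theta> \<phi> s]])
      show "doctrine_transformation (collapse_cell q \<phi> \<bullet>\<^bsub>ED\<^esub> collapse_cell q \<theta>)"
        by (rule transformation_vcomp[OF doctrine_transformation_collapse[OF \<theta>] doctrine_transformation_collapse[OF \<phi>]])
          (simp add: s)
      fix A assume "A \<in> Ob (MSrc (CSrc (collapse_cell q \<phi> \<bullet>\<^bsub>ED\<^esub> collapse_cell q \<theta>)))"
      then have A: "A \<in> Ob (MSrc (CSrc \<theta>))" by simp
      then show "CMap (collapse_cell q (\<phi> \<bullet>\<^bsub>ED\<^esub> \<theta>)) A = CMap (collapse_cell q \<phi> \<bullet>\<^bsub>ED\<^esub> collapse_cell q \<theta>) A"
        using R.comp_cl[OF cell_in[OF \<theta> A] cell_in[OF \<phi>, unfolded s cell_par[OF \<theta>], OF A]] cell_par[OF \<theta>] s by simp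
    qed simp_all
    then show "Map2 (Td q) (\<phi> \<cdot>\<^bsub>cat12 ED\<^esub> \<theta>) = Map2 (Td q) \<phi> \<cdot>\<^bsub>cat12 ED\<^esub> Map2 (Td q) \<theta>" by simp
  qed (auto simp: Hom_def doctrine_morphism_collapse doctrine_transformation_collapse Id2)
  show "is_functor (cat02 ED) (cat02 ED) (Map0 (Td q)) (Map2 (Td q))"
  proof (rule is_functorI)
    fix \<theta> \<phi> :: "('o, 'm, 'p) doctrine_cell" and P Q R
    assume "\<theta> \<in> Hom (cat02 ED) P Q" "\<phi> \<in> Hom (cat02 ED) Q R"
    then have \<theta>: "doctrine_transformation \<theta>" and \<phi>: "doctrine_transformation \<phi>" and s: "MSrc (CSrc \<phi>) = MTgt (CSrc \<theta>)"
      by (simp_all add: Hom_def)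
    note M = cell_src[OF \<theta>] and M' = cell_tgt[OF \<theta>] and N = cell_src[OF \<phi>] and N' = cell_tgt[OF \<phi>]
    interpret P: named_doctrine "MSrc (CSrc \<theta>)" q by (rule named[OF mor_src[OF M]])
    interpret Q: named_doctrine "MTgt (CSrc \<theta>)" q by (rule named[OF mor_tgt[OF M]])
    interpret R: named_doctrine "MTgt (CSrc \<phi>)" q by (rule named[OF mor_tgt[OF N]])
    have s': "MSrc (CTgt \<phi>) = MTgt (CTgt \<theta>)" using s cell_par[OF \<theta>] cell_par[OF \<phi>] by simp
    have "collapse_cell q (\<phi> \<star>\<^bsub>ED\<^esub> \<theta>) = collapse_cell q \<phi> \<star>\<^bsub>ED\<^esub> collapse_cell q \<theta>"
    proof (rule doctrine_cell_eqI)
      show "doctrine_transformation (collapse_cell q (\<phi> \<star>\<^bsub>ED\<^esub> \<theta>))"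
        by (rule doctrine_transformation_collapse[OF transformation_hcomp[OF \<theta> \<phi> s]])
      show "doctrine_transformation (collapse_cell q \<phi> \<star>\<^bsub>ED\<^esub> collapse_cell q \<theta>)"
        by (rule transformation_hcomp[OF doctrine_transformation_collapse[OF \<theta>] doctrine_transformation_collapse[OF \<phi>]])
          (simp add: s)
      show "CSrc (collapse_cell q (\<phi> \<star>\<^bsub>ED\<^esub> \<theta>)) = CSrc (collapse_cell q \<phi> \<star>\<^bsub>ED\<^esub> collapse_cell q \<theta>)"
        using collapse_comp[OF M N s] by simp
      show "CTgt (collapse_cell q (\<phi> \<star>\<^bsub>ED\<^esub> \<theta>)) = CTgt (collapse_cell q \<phi> \<star>\<^bsub>ED\<^esub> collapse_cell q \<theta>)"
        using collapse_comp[OF M' N' s'] by simp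
      fix A assume "A \<in> Ob (MSrc (CSrc (collapse_cell q \<phi> \<star>\<^bsub>ED\<^esub> collapse_cell q \<theta>)))"
      then have A: "A \<in> Ob (MSrc (CSrc \<theta>))" by simp
      note t = cell_in[OF \<theta> A]
      have B: "MOb (CTgt \<theta>) A \<in> Ob (MTgt (CSrc \<theta>))" using Q.Hom_ob[OF t] by blast
      note Nt = mor_Ar[OF N, unfolded s, OF t] and f = cell_in[OF \<phi>, unfolded s, OF B]
      show "CMap (collapse_cell q (\<phi> \<star>\<^bsub>ED\<^esub> \<theta>)) A = CMap (collapse_cell q \<phi> \<star>\<^bsub>ED\<^esub> collapse_cell q \<theta>) A"
        using R.comp_cl[OF Nt f] MAr_collapse_mor[OF N, unfolded s, of "CMap \<theta> A"] Q.HomD[OF t] A B s by simp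
    qed
    then show "Map2 (Td q) (\<phi> \<cdot>\<^bsub>cat02 ED\<^esub> \<theta>) = Map2 (Td q) \<phi> \<cdot>\<^bsub>cat02 ED\<^esub> Map2 (Td q) \<theta>" by simp
  qed (auto simp: Hom_def E doctrine_transformation_collapse Id2 doctrine_morphism_id collapse_id)
qed

lemma two_natural_unit: "two_natural ED ED id_map (Td q) (Td_unit q)"
  unfolding two_natural_def
proof (intro conjI ballI)
  have [simp]: "Map0 (Td q) = collapse q" "Map1 (Td q) = collapse_mor q" "Map2 (Td q) = collapse_cell q"
    by (simp_all add: Td_def)
  have [simp]: "MSrc (Td_unit q P) = P" "MTgt (Td_unit q P) = collapse q P" for P
    by (simp_all add: Td_unit_def)
  have u: "doctrine_morphism (Td_unit q P)" if "elementary_doctrine P" for P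
    by (rule named_doctrine.doctrine_morphism_unit[OF named[OF that]])
  show "Td_unit q P \<in> Hom (cat01 ED) (Map0 id_map P) (Map0 (Td q) P)" if "P \<in> Cell0 ED" for P
    using u that by (simp add: Hom_def id_map_def)
  have nat: "doctrine_comp (collapse_mor q M) (Td_unit q (MSrc M)) = doctrine_comp (Td_unit q (MTgt M)) M"
    if M: "doctrine_morphism M" for M
  proof -
    interpret P: named_doctrine "MSrc M" q by (rule named[OF mor_src[OF M]])
    interpret R: named_doctrine "MTgt M" q by (rule named[OF mor_tgt[OF M]])
    show ?thesis
    proof (rule doctrine_mor_eqI[OF doctrine_morphism_comp[OF u[OF mor_src[OF M]] doctrine_morphism_collapse[OF M]]
          doctrine_morphism_comp[OF M u[OF mor_tgt[OF M]]]])
      fix f assume "f \<in> Ar (MSrc (doctrine_comp (Td_unit q (MTgt M)) M))"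
      then have f: "f \<in> Ar (MSrc M)" by simp
      have "MAr M f \<in> Ar (MTgt M)" using mor_Ar[OF M, of f] f by (simp add: Hom_def)
      then show "MAr (doctrine_comp (collapse_mor q M) (Td_unit q (MSrc M))) f = MAr (doctrine_comp (Td_unit q (MTgt M)) M) f"
        using f MAr_collapse_mor[OF M f] by simp
    qed (simp_all add: mor_Ob[OF M] mor_Fib[OF M])
  qed
  show "Map1 (Td q) M \<odot>\<^bsub>ED\<^esub> Td_unit q (Src1 ED M) = Td_unit q (Tgt1 ED M) \<odot>\<^bsub>ED\<^esub> Map1 id_map M"
    if "M \<in> Cell1 ED" for M
    using nat that by (simp add: id_map_def)
  fix \<theta> :: "('o, 'm, 'p) doctrine_cell" assume "\<theta> \<in> Cell2 ED"
  then have \<theta>: "doctrine_transformation \<theta>" by simp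
  note M = cell_src[OF \<theta>] and N = cell_tgt[OF \<theta>] and e = cell_par[OF \<theta>]
  note uP = u[OF mor_src[OF M]] and uR = u[OF mor_tgt[OF M]]
  interpret P: named_doctrine "MSrc (CSrc \<theta>)" q by (rule named[OF mor_src[OF M]])
  interpret R: named_doctrine "MTgt (CSrc \<theta>)" q by (rule named[OF mor_tgt[OF M]])
  interpret RX: elementary_doctrine R.PX by (rule R.elementary_doctrine_collapse)
  have "collapse_cell q \<theta> \<star>\<^bsub>ED\<^esub> Id2 ED (Td_unit q (MSrc (CSrc \<theta>))) = Id2 ED (Td_unit q (MTgt (CSrc \<theta>))) \<star>\<^bsub>ED\<^esub> \<theta>"
  proof (rule doctrine_cell_eqI)
    show "doctrine_transformation (collapse_cell q \<theta> \<star>\<^bsub>ED\<^esub> Id2 ED (Td_unit q (MSrc (CSrc \<theta>))))"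
      by (rule transformation_hcomp[OF transformation_Id2[OF uP] doctrine_transformation_collapse[OF \<theta>]]) simp
    show "doctrine_transformation (Id2 ED (Td_unit q (MTgt (CSrc \<theta>))) \<star>\<^bsub>ED\<^esub> \<theta>)"
      by (rule transformation_hcomp[OF \<theta> transformation_Id2[OF uR]]) simp
    fix A assume "A \<in> Ob (MSrc (CSrc (Id2 ED (Td_unit q (MTgt (CSrc \<theta>))) \<star>\<^bsub>ED\<^esub> \<theta>)))"
    then have A: "A \<in> Ob (MSrc (CSrc \<theta>))" by simp
    note t = cell_in[OF \<theta> A]
    have MA: "MOb (CSrc \<theta>) A \<in> Ob (MTgt (CSrc \<theta>))" "MOb (CTgt \<theta>) A \<in> Ob (MTgt (CSrc \<theta>))"
      using R.Hom_ob[OF t] by auto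
    note tx = R.cl_in[OF t]
    have "R.cl (CMap \<theta> A) \<cdot>\<^bsub>R.PX\<^esub> Idn R.PX (MOb (CSrc \<theta>) A) = R.cl (CMap \<theta> A)"
      "Idn R.PX (MOb (CTgt \<theta>) A) \<cdot>\<^bsub>R.PX\<^esub> R.cl (CMap \<theta> A) = R.cl (CMap \<theta> A)"
      using RX.comp_idn[of "R.cl (CMap \<theta> A)"] RX.idn_comp[of "R.cl (CMap \<theta> A)"] RX.HomD[OF tx]
      by (simp_all del: R.collapse_simps(4-7))
    moreover have "MAr (collapse_mor q (CSrc \<theta>)) (Idn P.PX A) = Idn R.PX (MOb (CSrc \<theta>) A)"
      using mor_Idn[OF doctrine_morphism_collapse[OF M], of A] A by (simp del: R.collapse_simps(4-7) P.collapse_simps(4-7))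
    ultimately show "CMap (collapse_cell q \<theta> \<star>\<^bsub>ED\<^esub> Id2 ED (Td_unit q (MSrc (CSrc \<theta>)))) A =
        CMap (Id2 ED (Td_unit q (MTgt (CSrc \<theta>))) \<star>\<^bsub>ED\<^esub> \<theta>) A"
      using A MA R.HomD[OF t] by (simp del: R.collapse_simps(4-7) P.collapse_simps(4-7))
  qed (use nat[OF M] nat[OF N] e in simp_all)
  then show "Map2 (Td q) \<theta> \<star>\<^bsub>ED\<^esub> Id2 ED (Td_unit q (Src1 ED (Src2 ED \<theta>))) =
      Id2 ED (Td_unit q (Tgt1 ED (Src2 ED \<theta>))) \<star>\<^bsub>ED\<^esub> Map2 id_map \<theta>"
    by (simp add: id_map_def)
qed

text \<open>Both sides send \<open>[f]\<close> to \<open>[[f]]\<close>.\<close>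

lemma collapse_unit:
  assumes P: "elementary_doctrine P"
  shows "collapse_mor q (Td_unit q P) = Td_unit q (collapse q P)"
proof -
  interpret named_doctrine P q by (rule named[OF P])
  interpret X: named_doctrine PX q by (rule named_collapse[OF P])
  show ?thesis
  proof (rule doctrine_mor_eqI[OF doctrine_morphism_collapse[OF doctrine_morphism_unit] X.doctrine_morphism_unit])
    fix x assume "x \<in> Ar (MSrc (Td_unit q PX))"
    then obtain f where f: "f \<in> Ar P" "x = cl f" by auto
    then show "MAr (collapse_mor q (Td_unit q P)) x = MAr (Td_unit q PX) x"
      using MAr_collapse_mor[OF doctrine_morphism_unit, of f] by simp
  qed simp_all
qed

lemma idempotent_Td: "idempotent_two_monad ED (Td q) (Td_mult q) (Td_unit q)"
proof (intro idempotent_two_monad.intro idempotent_two_monad_axioms.intro two_category_ED two_functor_Td two_natural_unit)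
  have T: "Map0 (Td q) = collapse q" "Map1 (Td q) = collapse_mor q" "Map2 (Td q) = collapse_cell q"
    by (simp_all add: Td_def)
  fix P :: "('o, 'm, 'p) doctrine" assume "P \<in> Cell0 ED"
  then have P: "elementary_doctrine P" by simp
  interpret named_doctrine P q by (rule named[OF P])
  interpret X: named_doctrine PX q by (rule named_collapse[OF P])
  note c = comprehensive_diagonals_collapse
  show "Map1 (Td q) (Td_unit q P) = Td_unit q (Map0 (Td q) P)"
    using collapse_unit[OF P] by (simp add: T)
  show "Td_mult q P \<in> Hom (cat01 ED) (Map0 (Td q) (Map0 (Td q) P)) (Map0 (Td q) P)"
    using X.doctrine_morphism_retraction[OF c] by (simp add: T Td_mult_eq_retraction Hom_def)
  show "Td_mult q P \<odot>\<^bsub>ED\<^esub> Td_unit q (Map0 (Td q) P) = Id1 ED (Map0 (Td q) P)"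
    using X.retraction_unit[OF c] by (simp add: T Td_mult_eq_retraction)
  show "Td_unit q (Map0 (Td q) P) \<odot>\<^bsub>ED\<^esub> Td_mult q P = Id1 ED (Map0 (Td q) (Map0 (Td q) P))"
    using X.unit_retraction[OF c] by (simp add: T Td_mult_eq_retraction)
qed

lemma CED_eq_full_sub: "CED = full_sub ED (\<lambda>P. is_iso (cat01 ED) (Td_unit q P))"
proof -
  have "CED = full_sub ED comprehensive_diagonals"
    by (simp add: CED_def full_sub_def)
  also have "\<dots> = full_sub ED (\<lambda>P. is_iso (cat01 ED) (Td_unit q P))"
    using named_doctrine.is_iso_unit_iff[OF named] by (intro full_sub_cong[OF two_category_ED]) simp
  finally show ?thesis .
qed

end

theorem theorem5p10:
  fixes q :: "('o, 'm, 'p) doctrine \<Rightarrow> 'm set \<Rightarrow> 'm"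
  assumes "class_naming q"
  shows "two_monad (ED :: (('o, 'm, 'p) doctrine, ('o, 'm, 'p) doctrine_mor, ('o, 'm, 'p) doctrine_cell) two_cat)
           (Td q) (Td_mult q) (Td_unit q) \<and>
         two_equivalent (Alg ED (Td q) (Td_mult q) (Td_unit q))
           (CED :: (('o, 'm, 'p) doctrine, ('o, 'm, 'p) doctrine_mor, ('o, 'm, 'p) doctrine_cell) two_cat)"
proof -
  interpret naming q by unfold_locales (rule assms)
  interpret idempotent_two_monad ED "Td q" "Td_mult q" "Td_unit q" by (rule idempotent_Td)
  show ?thesis using two_monad Alg_equivalent_full_sub unfolding CED_eq_full_sub by blast
qed

end
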